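(* Let $e_0,\dots,e_4\in\mathbb{R}[t]$ with $\gcd(e_0,\dots,e_4)=1$ parametrize a spine curve, let $d\in\mathbb{R}$, and let $D,D'\in\mathbb{R}[t]^5$ be the associated vectors, assumed $\mathbb{R}[t]$-linearly independent and with non-constant Plücker map. Let $D_1,D_2$ be a $\mu$-basis of the module $\langle D,D'\rangle$ quasi-generated by $D$ and $D'$, and let $k$ be the degree of the parametrization $t\mapsto D\wedge D'$ of the Plücker curve. Then $$k\cdot\deg\mathcal V_d(\hat{\mathcal E})=\deg D_1+\deg D_2=\deg(D\wedge D')-\deg q_{D,D'},\qquad q_{D,D'}=\gcd(D\wedge D'),$$ and, up to a nonzero constant factor, $$\operatorname{Res}_t\big(D_1\cdot(u,y_0,y_1,y_2,y_3)^T,\ D_2\cdot(u,y_0,y_1,y_2,y_3)^T\big)=F_{\mathcal V_d(\hat{\mathcal E})}^{\,k},$$ where $F_{\mathcal V_d(\hat{\mathcal E})}$ is the implicit equation of the hypersurface $\mathcal V_d(\hat{\mathcal E})\subset\mathbb{P}^4$.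
   Context: Write $e=(e_1,e_2,e_3,e_4)$ and $\langle v,w\rangle=v_1w_1+v_2w_2+v_3w_3-v_4w_4$. The spine curve is $t\mapsto(e_0:e_1:e_2:e_3:e_4)\in\mathbb{P}^4$, and $\hat{\mathcal E}$ denotes its lift $t\mapsto(\langle e,e\rangle:e_0^2:e_0e_1:e_0e_2:e_0e_3:e_0e_4)\in\mathbb{P}^5$. For $d\in\mathbb{R}$ put $$D=\Big(-\tfrac{e_0^2}{2},\ -\tfrac{\langle e,e\rangle}{2}+d\,e_0e_4,\ e_0e_1,\ e_0e_2,\ e_0e_3\Big)\in\mathbb{R}[t]^5$$ and let $D'=dD/dt$, i.e. $D'=\big(-e_0e_0',\,-\langle e',e\rangle+d(e_0'e_4+e_0e_4'),\,(e_0e_1)',\,(e_0e_2)',\,(e_0e_3)'\big)$. For $\mathbb{R}[t]$-linearly independent $A,B\in\mathbb{R}[t]^m$, the module quasi-generated by $A,B$ is $M=\langle A,B\rangle=\{aA+bB\in\mathbb{R}[t]^m : a,b\in\mathbb{R}(t)\}$; any linearly independent pair with $\langle A,B\rangle=M$ is called a pair of quasi-generators of $M$. $A\wedge B=([i,j])_{i<j}$, $[i,j]=A_iB_j-A_jB_i$; $\deg(A\wedge B)$ is the maximal degree of the entries and $\gcd(A\wedge B)$ their gcd. $\deg A$ is the maximal degree of the entries of $A$; $\deg M=\min\{\deg(\tilde A\wedge\tilde B):\langle\tilde A,\tilde B\rangle=M\}$; quasi-generators $\tilde A,\tilde B$ form a $\mu$-basis of $M$ if $\deg\tilde A+\deg\tilde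 B=\deg M$. The Plücker map is $\mathbb{P}^1\dashrightarrow\mathbb{P}^{m(m-1)/2-1}$, $t\mapsto([i,j])_{i<j}$; its closed image is the Plücker curve and its degree is the cardinality of the fibre over a generic point of the image (over $\mathbb{C}$). For a parameter $t_0$ let $L(M,t_0)=\{x : C(t_0)\cdot x=0\ \forall\, C\in M\}$, where $C\cdot x=\sum_i C_ix_i$, and $\mathcal S_M=\bigcup_t\mathbb{P}(L(M,t))\subset\mathbb{P}^{m-1}$ ($t\in\mathbb{P}^1$; at $t=\infty$ use leading coefficient vectors). Define $\mathcal V_d(\hat{\mathcal E})=\mathcal S_{\langle D,D'\rangle}\subset\mathbb{P}^4$ (here $m=5$); its implicit equation is the irreducible form defining its Zariski closure. $\operatorname{Res}_t$ is the Sylvester resultant with respect to $t$ of polynomials of $t$-degrees $\deg D_1$, $\deg D_2$. *)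

theory Defs
  imports
    "HOL-Computational_Algebra.Computational_Algebra"
    "HOL-Computational_Algebra.Field_as_Ring"
    "HOL-Library.Poly_Mapping"
    "Subresultants.Resultant_Prelim"
begin

section \<open>Vectors of polynomials and quasi-generated modules\<close>

definition vec_degree :: "'a::zero poly vec \<Rightarrow> nat" where
  "vec_degree A = Max (Polynomial.degree ` set\<^sub>v A)"

definition wedge :: "'a::comm_ring_1 vec \<Rightarrow> 'a vec \<Rightarrow> 'a vec" where
  "wedge A B = vec_of_list
     [A $ i * B $ j - A $ j * B $ i. i \<leftarrow> [0..<dim_vec A], j \<leftarrow> [Suc i..<dim_vec A]]"

definition lin_indep_pair :: "nat \<Rightarrow> 'a::comm_ring_1 vec \<Rightarrow> 'a vec \<Rightarrow> bool" where
  "lin_indep_pair m A B \<longleftrightarrow>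
     A \<in> carrier_vec m \<and> B \<in> carrier_vec m \<and>
     (\<forall>a b. a \<cdot>\<^sub>v A + b \<cdot>\<^sub>v B = 0\<^sub>v m \<longrightarrow> a = 0 \<and> b = 0)"

definition quasi_module :: "nat \<Rightarrow> 'a::idom vec \<Rightarrow> 'a vec \<Rightarrow> 'a vec set" where
  "quasi_module m A B =
     {C \<in> carrier_vec m. \<exists>a b :: 'a fract.
        map_vec to_fract C = a \<cdot>\<^sub>v map_vec to_fract A + b \<cdot>\<^sub>v map_vec to_fract B}"

definition quasi_generators :: "nat \<Rightarrow> 'a::idom vec set \<Rightarrow> 'a vec \<Rightarrow> 'a vec \<Rightarrow> bool" where
  "quasi_generators m M A B \<longleftrightarrow> lin_indep_pair m A B \<and> quasi_module m A B = M"

definition module_degree :: "nat \<Rightarrow> 'a::idom poly vec set \<Rightarrow> nat" where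
  "module_degree m M = (LEAST n. \<exists>A B. quasi_generators m M A B \<and> n = vec_degree (wedge A B))"

definition mu_basis :: "nat \<Rightarrow> 'a::idom poly vec set \<Rightarrow> 'a poly vec \<Rightarrow> 'a poly vec \<Rightarrow> bool" where
  "mu_basis m M A B \<longleftrightarrow>
     quasi_generators m M A B \<and> vec_degree A + vec_degree B = module_degree m M"


section \<open>Projective points and the degree of the Pluecker map\<close>

datatype 'k proj_line = Affine 'k | Infinity

text \<open>
  A vector of polynomials is homogenized with respect to its own degree, so its value at
  infinity is its leading coefficient vector.
\<close>

fun proj_eval :: "'k::comm_semiring_0 poly vec \<Rightarrow> 'k proj_line \<Rightarrow> 'k vec" where
  "proj_eval C (Affine t) = map_vec (\<lambda>p. poly p t) C"
| "proj_eval C Infinity = map_vec (\<lambda>p. Polynomial.coeff p (vec_degree C)) C"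

text \<open>
  A point of a projective space is the set of all its homogeneous coordinate vectors;
  \<open>proj_space m\<close> has projective dimension \<open>m - 1\<close>.
\<close>

definition proj_point :: "'k::field vec \<Rightarrow> 'k vec set" where
  "proj_point v = {c \<cdot>\<^sub>v v | c. c \<noteq> 0}"

definition proj_space :: "nat \<Rightarrow> 'k::field vec set set" where
  "proj_space m = proj_point ` (carrier_vec m - {0\<^sub>v m})"

definition complex_wedge :: "real poly vec \<Rightarrow> real poly vec \<Rightarrow> complex poly vec" where
  "complex_wedge A B = map_vec (map_poly complex_of_real) (wedge A B)"

definition plucker_domain :: "real poly vec \<Rightarrow> real poly vec \<Rightarrow> complex proj_line set" where
  "plucker_domain A B =
     {t. proj_eval (complex_wedge A B) t \<noteq> 0\<^sub>v (dim_vec (complex_wedge A B))}"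

definition plucker_map :: "real poly vec \<Rightarrow> real poly vec \<Rightarrow> complex proj_line \<Rightarrow> complex vec set" where
  "plucker_map A B t = proj_point (proj_eval (complex_wedge A B) t)"

definition plucker_nonconstant :: "real poly vec \<Rightarrow> real poly vec \<Rightarrow> bool" where
  "plucker_nonconstant A B \<longleftrightarrow>
     (\<exists>s\<in>plucker_domain A B. \<exists>t\<in>plucker_domain A B. plucker_map A B s \<noteq> plucker_map A B t)"

text \<open>
  A property holds at the generic point of a curve if it fails at only finitely many points.
\<close>

definition plucker_degree :: "real poly vec \<Rightarrow> real poly vec \<Rightarrow> nat" where
  "plucker_degree A B = (THE k. finite {p \<in> plucker_map A B ` plucker_domain A B.
      card {t \<in> plucker_domain A B. plucker_map A B t = p} \<noteq> k})"


section \<open>Forms, Zariski closure and implicit equations\<close>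

text \<open>
  Polynomials in the variables \<open>x\<^sub>0, x\<^sub>1, \<dots>\<close>: a monomial maps each variable index to its exponent.
\<close>

type_synonym 'k mpol = "(nat \<Rightarrow>\<^sub>0 nat) \<Rightarrow>\<^sub>0 'k"

definition mpol_const :: "'k::zero \<Rightarrow> 'k mpol" where
  "mpol_const c = Poly_Mapping.single 0 c"

definition mpol_var :: "nat \<Rightarrow> 'k::zero_neq_one mpol" where
  "mpol_var i = Poly_Mapping.single (Poly_Mapping.single i 1) 1"

definition mpol_eval :: "'k::comm_semiring_1 mpol \<Rightarrow> 'k vec \<Rightarrow> 'k" where
  "mpol_eval F x = (\<Sum>a\<in>Poly_Mapping.keys F. Poly_Mapping.lookup F a *
      (\<Prod>i\<in>Poly_Mapping.keys a. x $ i ^ Poly_Mapping.lookup a i))"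

definition monom_degree :: "(nat \<Rightarrow>\<^sub>0 nat) \<Rightarrow> nat" where
  "monom_degree a = (\<Sum>i\<in>Poly_Mapping.keys a. Poly_Mapping.lookup a i)"

definition form_in :: "nat \<Rightarrow> 'k::zero mpol \<Rightarrow> bool" where
  "form_in m F \<longleftrightarrow>
     (\<forall>a\<in>Poly_Mapping.keys F. Poly_Mapping.keys a \<subseteq> {..<m}) \<and>
     (\<exists>n. \<forall>a\<in>Poly_Mapping.keys F. monom_degree a = n)"

definition total_degree :: "'k::zero mpol \<Rightarrow> nat" where
  "total_degree F = Max (insert 0 (monom_degree ` Poly_Mapping.keys F))"

definition vanishes_at :: "'k::field mpol \<Rightarrow> 'k vec set \<Rightarrow> bool" where
  "vanishes_at F p \<longleftrightarrow> (\<forall>x\<in>p. mpol_eval F x = 0)"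

definition zariski_closure :: "nat \<Rightarrow> 'k::field vec set set \<Rightarrow> 'k vec set set" where
  "zariski_closure m S =
     {p \<in> proj_space m. \<forall>F. form_in m F \<and> (\<forall>q\<in>S. vanishes_at F q) \<longrightarrow> vanishes_at F p}"

definition is_implicit_equation :: "nat \<Rightarrow> 'k::field vec set set \<Rightarrow> 'k mpol \<Rightarrow> bool" where
  "is_implicit_equation m S F \<longleftrightarrow>
     form_in m F \<and> Factorial_Ring.irreducible F \<and>
     {p \<in> proj_space m. vanishes_at F p} = zariski_closure m S"

text \<open>Determined up to a nonzero constant factor when the closure is a hypersurface.\<close>

definition implicit_equation :: "nat \<Rightarrow> 'k::field vec set set \<Rightarrow> 'k mpol" where
  "implicit_equation m S = (SOME F. is_implicit_equation m S F)"

definition hypersurface_degree :: "nat \<Rightarrow> 'k::field vec set set \<Rightarrow> nat" where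
  "hypersurface_degree m S = total_degree (implicit_equation m S)"


section \<open>The variety swept out by a quasi-generated module\<close>

text \<open>
  The base field stays generic here. Real parameters are Zariski dense in the complex projective
  line, so for a real module the real and the complex swept variety have the same implicit
  equation up to a constant.
\<close>

definition fibre_space :: "nat \<Rightarrow> 'k::field poly vec set \<Rightarrow> 'k proj_line \<Rightarrow> 'k vec set" where
  "fibre_space m M t = {x \<in> carrier_vec m. \<forall>C\<in>M. proj_eval C t \<bullet> x = 0}"

definition swept_variety :: "nat \<Rightarrow> 'k::field poly vec set \<Rightarrow> 'k vec set set" where
  "swept_variety m M = (\<Union>t. proj_point ` (fibre_space m M t - {0\<^sub>v m}))"

definition mink :: "(nat \<Rightarrow> 'a::comm_ring_1) \<Rightarrow> (nat \<Rightarrow> 'a) \<Rightarrow> 'a" where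
  "mink v w = v 1 * w 1 + v 2 * w 2 + v 3 * w 3 - v 4 * w 4"

definition spine_vec :: "real \<Rightarrow> (nat \<Rightarrow> real poly) \<Rightarrow> real poly vec" where
  "spine_vec d e = vec_of_list
     [- Polynomial.smult (1/2) ((e 0)\<^sup>2),
      - Polynomial.smult (1/2) (mink e e) + Polynomial.smult d (e 0 * e 4),
      e 0 * e 1, e 0 * e 2, e 0 * e 3]"

definition spine_vec_deriv :: "real \<Rightarrow> (nat \<Rightarrow> real poly) \<Rightarrow> real poly vec" where
  "spine_vec_deriv d e = map_vec pderiv (spine_vec d e)"

definition dual_offset :: "real \<Rightarrow> (nat \<Rightarrow> real poly) \<Rightarrow> real vec set set" where
  "dual_offset d e = swept_variety 5 (quasi_module 5 (spine_vec d e) (spine_vec_deriv d e))"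

text \<open>
  \<open>dot_vars C\<close> is \<open>C \<bullet> (x\<^sub>0, \<dots>, x\<^sub>m\<^sub>-\<^sub>1)\<close> as a polynomial in \<open>t\<close> over the polynomials in the
  \<open>x\<^sub>i\<close>. Its degree in \<open>t\<close> is \<open>vec_degree C\<close>, since the leading coefficient vector of a nonzero
  \<open>C\<close> is nonzero; so \<open>resultant\<close>, which uses the actual degrees, is the Sylvester resultant for
  the degrees \<open>vec_degree C\<close>.
\<close>

definition dot_vars :: "'k::comm_ring_1 poly vec \<Rightarrow> 'k mpol poly" where
  "dot_vars C = map_vec (map_poly mpol_const) C \<bullet> vec (dim_vec C) (\<lambda>i. [:mpol_var i:])"

end

theory Submission
  imports Defs "Subresultants.Subresultant_Gcd" "Jordan_Normal_Form.Char_Poly"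
begin

text \<open>
  The vectors of a mu-basis \<open>D1, D2\<close> are independent at every complex parameter \<open>t\<close>, and their leading
  vectors are independent as well (\<open>mu_basis_plucker_primitive\<close>, \<open>mu_basis_top_nonzero\<close>): otherwise
  generators with Pluecker coordinates of smaller degree could be found. Therefore the common kernels
  \<open>L t\<close> of \<open>D1\<close> and \<open>D2\<close> are projective planes for all \<open>t\<close> in the projective line, the resultant
  \<open>R\<close> of \<open>D1 \<cdot> x\<close> and \<open>D2 \<cdot> x\<close> vanishes exactly on the union of these planes, and \<open>R\<close> is a form of
  degree \<open>deg D1 + deg D2\<close>. The Pluecker vector of \<open>D, D'\<close> is a multiple of that of \<open>D1, D2\<close>, which
  gives the second formula for this degree (\<open>vec_degree_wedge\<close>).

  The forms that vanish on all planes form a prime ideal, so an irreducible factor \<open>F\<close> of \<open>R\<close> vanishes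
  on them. By the Nullstellensatz for hypersurfaces (\<open>irreducible_dvd_if_zeros\<close>) every irreducible
  factor of \<open>R\<close> divides \<open>F\<close>, and \<open>F\<close> divides every form that vanishes on the planes. Since the
  real points of the planes with real parameter are dense (\<open>vanishes_on_planes_if_swept\<close>), \<open>F\<close> is
  the implicit equation of the swept variety, and \<open>R\<close> is a constant times \<open>F ^ j\<close> for some \<open>j\<close>.

  It remains to show that \<open>j\<close> is the degree of the Pluecker map, that is, the number of parameters
  \<open>t\<close> with \<open>L t = L s\<close> for a general \<open>s\<close> (\<open>card_fibre\<close>). Both numbers are the order to which \<open>R\<close>
  vanishes on a general line through a general point \<open>x\<close> of \<open>L s\<close>. For \<open>F ^ j\<close> this is so because \<open>x\<close>
  is a smooth point of \<open>F = 0\<close>. For the resultant, Poisson's formula along the line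
  (\<open>resultant_pencil\<close>) shows that the order is the number of planes through \<open>x\<close>, where \<open>L t\<close> is
  counted once for each parameter.

  The point where the special form of the module enters is that \<open>x\<close> lies on no plane besides \<open>L s\<close>
  (\<open>exists_point_on_one_plane\<close>). This fails for some modules, for instance if all planes lie in one
  hyperplane and envelop a surface there. Here the planes belong to the tangent lines of the curve
  \<open>D\<close>: that \<open>x\<close> lies on \<open>L t\<close> means that the polynomial \<open>D \<cdot> x\<close> has a double root at \<open>t\<close>, and the
  argument of Bertini's theorem in a pencil of points of \<open>L s\<close> excludes such double roots.
\<close>

section \<open>Evaluating and grading polynomials in several variables\<close>

abbreviation monomial_at :: "(nat \<Rightarrow> 'b::comm_semiring_1) \<Rightarrow> (nat \<Rightarrow>\<^sub>0 nat) \<Rightarrow> 'b" where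
  "monomial_at x a \<equiv> (\<Prod>i\<in>Poly_Mapping.keys a. x i ^ Poly_Mapping.lookup a i)"

definition mpol_subst :: "('k::zero \<Rightarrow> 'b::comm_semiring_1) \<Rightarrow> (nat \<Rightarrow> 'b) \<Rightarrow> 'k mpol \<Rightarrow> 'b" where
  "mpol_subst h x F = (\<Sum>a\<in>Poly_Mapping.keys F. h (Poly_Mapping.lookup F a) * monomial_at x a)"

lemma monomial_at_superset:
  assumes "finite S" "Poly_Mapping.keys a \<subseteq> S"
  shows "monomial_at x a = (\<Prod>i\<in>S. x i ^ Poly_Mapping.lookup a i)"
  by (rule prod.mono_neutral_left) (use assms in \<open>auto simp: in_keys_iff\<close>)

lemma monomial_at_add: "monomial_at x (a + b) = monomial_at x a * monomial_at x b"
proof -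
  let ?S = "Poly_Mapping.keys a \<union> Poly_Mapping.keys b"
  have "Poly_Mapping.keys (a + b) \<subseteq> ?S" by (rule Poly_Mapping.keys_add)
  then have "monomial_at x (a + b) = (\<Prod>i\<in>?S. x i ^ Poly_Mapping.lookup (a + b) i)"
    by (intro monomial_at_superset) auto
  moreover have "monomial_at x a = (\<Prod>i\<in>?S. x i ^ Poly_Mapping.lookup a i)"
    "monomial_at x b = (\<Prod>i\<in>?S. x i ^ Poly_Mapping.lookup b i)"
    by (intro monomial_at_superset; simp)+
  ultimately show ?thesis
    by (simp add: lookup_add power_add prod.distrib)
qed

lemma mpol_induct [case_names zero add]:
  assumes "P 0" "\<And>a r F. P F \<Longrightarrow> a \<notin> Poly_Mapping.keys F \<Longrightarrow> r \<noteq> 0 \<Longrightarrow> P (F + Poly_Mapping.single a r)"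
  shows "P (F :: 'a \<Rightarrow>\<^sub>0 'k::comm_monoid_add)"
proof (induction F rule: Poly_Mapping.update_induct)
  case const
  then show ?case using assms(1) by simp
next
  case (update F a r)
  have "Poly_Mapping.update a r F = F + Poly_Mapping.single a r"
    by (rule poly_mapping_eqI)
      (use update in \<open>auto simp: lookup_update lookup_add lookup_single in_keys_iff when_def\<close>)
  then show ?case using assms(2)[of F a r] update by simp
qed

context comm_ring_hom
begin

lemma mpol_subst_superset:
  assumes "finite S" "Poly_Mapping.keys F \<subseteq> S"
  shows "mpol_subst hom x F = (\<Sum>a\<in>S. hom (Poly_Mapping.lookup F a) * monomial_at x a)"
  unfolding mpol_subst_def
  by (rule sum.mono_neutral_left) (use assms in \<open>auto simp: in_keys_iff\<close>)

lemma mpol_subst_zero [simp]: "mpol_subst hom x 0 = 0"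
  by (simp add: mpol_subst_def)

lemma mpol_subst_add: "mpol_subst hom x (F + G) = mpol_subst hom x F + mpol_subst hom x G"
proof -
  let ?S = "Poly_Mapping.keys F \<union> Poly_Mapping.keys G"
  have "Poly_Mapping.keys (F + G) \<subseteq> ?S" by (rule Poly_Mapping.keys_add)
  then show ?thesis
    using mpol_subst_superset[of ?S F] mpol_subst_superset[of ?S G] mpol_subst_superset[of ?S "F + G"]
    by (simp add: lookup_add hom_add distrib_right sum.distrib)
qed

lemma mpol_subst_single: "mpol_subst hom x (Poly_Mapping.single a r) = hom r * monomial_at x a"
  by (subst mpol_subst_superset[of "{a}"]) auto

lemma mpol_subst_mult_single:
  "mpol_subst hom x (F * Poly_Mapping.single b s) = mpol_subst hom x F * (hom s * monomial_at x b)"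
proof (induction F rule: mpol_induct)
  case (add a r F)
  show ?case
    unfolding distrib_right mpol_subst_add add mult_single mpol_subst_single hom_mult monomial_at_add
    by (simp only: mult_ac)
qed simp

lemma mpol_subst_mult: "mpol_subst hom x (F * G) = mpol_subst hom x F * mpol_subst hom x G"
proof (induction G rule: mpol_induct)
  case (add a r G)
  show ?case
    by (simp add: distrib_left mpol_subst_add add mpol_subst_mult_single mpol_subst_single)
qed simp

lemma mpol_subst_const [simp]: "mpol_subst hom x (mpol_const r) = hom r"
  by (simp add: mpol_const_def mpol_subst_single)

lemma mpol_subst_hom: "comm_ring_hom (mpol_subst hom x)"
proof
  show "mpol_subst hom x 1 = 1"
    using mpol_subst_const[of x 1] by (simp add: mpol_const_def)
qed (simp_all add: mpol_subst_add mpol_subst_mult)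

lemma mpol_subst_var [simp]: "mpol_subst hom x (mpol_var i) = x i"
  by (simp add: mpol_var_def mpol_subst_single)

end

lemma mpol_const_hom: "comm_ring_hom (mpol_const :: 'k::comm_ring_1 \<Rightarrow> 'k mpol)"
  by unfold_locales (auto simp: mpol_const_def single_add mult_single)

lemma single_power:
  "Poly_Mapping.single (b::nat \<Rightarrow>\<^sub>0 nat) (1::'k::comm_ring_1) ^ n = Poly_Mapping.single (of_nat n * b) 1"
  by (induction n) (simp_all add: mult_single distrib_right)

lemma single_as_product:
  "Poly_Mapping.single a (r::'k::comm_ring_1) = mpol_const r * monomial_at mpol_var a"
proof -
  have prod_single: "finite S \<Longrightarrow> (\<Prod>i\<in>S. Poly_Mapping.single (f i) (1::'k)) = Poly_Mapping.single (\<Sum>i\<in>S. f i) 1"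
    for S and f :: "nat \<Rightarrow> nat \<Rightarrow>\<^sub>0 nat"
    by (induction S rule: finite_induct) (simp_all add: mult_single)
  have "Poly_Mapping.lookup (\<Sum>i\<in>Poly_Mapping.keys a. of_nat (Poly_Mapping.lookup a i) * Poly_Mapping.single i (1::nat)) j = Poly_Mapping.lookup a j" for j
  proof -
    have *: "Poly_Mapping.lookup (of_nat m * Poly_Mapping.single i (1::nat)) j = (m when i = j)" for m i
      by (induction m) (auto simp: distrib_right lookup_add lookup_single when_def)
    show ?thesis
      unfolding lookup_sum * by (simp add: when_def in_keys_iff)
  qed
  then have "(\<Sum>i\<in>Poly_Mapping.keys a. of_nat (Poly_Mapping.lookup a i) * Poly_Mapping.single i (1::nat)) = a"
    by (rule poly_mapping_eqI)
  then show ?thesis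
    by (simp add: mpol_var_def single_power prod_single mult_single mpol_const_def)
qed

text \<open>
  This identifies the various evaluations of a polynomial (at real and complex points, along lines,
  in nested univariate polynomials) with substitutions, without computing with monomials.
\<close>

lemma hom_eq_mpol_subst:
  assumes "comm_ring_hom (\<phi> :: 'k::comm_ring_1 mpol \<Rightarrow> 'b::comm_ring_1)"
    and "\<And>r. \<phi> (mpol_const r) = h r"
    and "\<And>a i. a \<in> Poly_Mapping.keys F \<Longrightarrow> i \<in> Poly_Mapping.keys a \<Longrightarrow> \<phi> (mpol_var i) = x i"
  shows "\<phi> F = mpol_subst h x F"
proof -
  interpret comm_ring_hom \<phi> by fact
  interpret c: comm_ring_hom "mpol_const :: 'k \<Rightarrow> 'k mpol" by (rule mpol_const_hom)
  interpret h: comm_ring_hom h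
    by unfold_locales (simp_all add: assms(2)[symmetric] hom_distribs c.hom_add c.hom_mult)
  show ?thesis
    using assms(3)
  proof (induction F rule: mpol_induct)
    case (add a r F)
    have keys: "Poly_Mapping.keys (F + Poly_Mapping.single a r) = insert a (Poly_Mapping.keys F)"
      using add.hyps by (auto simp: in_keys_iff lookup_add lookup_single when_def split: if_splits)
    have "\<phi> (Poly_Mapping.single a r) = h r * monomial_at (\<lambda>i. \<phi> (mpol_var i)) a"
      unfolding single_as_product by (simp add: hom_mult hom_prod hom_power assms(2))
    also have "monomial_at (\<lambda>i. \<phi> (mpol_var i)) a = monomial_at x a"
      by (rule prod.cong) (use add.prems[of a] keys in auto)
    finally have "\<phi> (Poly_Mapping.single a r) = h r * monomial_at x a" .
    moreover have "\<phi> F = mpol_subst h x F"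
      by (rule add.IH, rule add.prems) (auto simp: keys)
    ultimately show ?case
      by (simp add: hom_add h.mpol_subst_add h.mpol_subst_single)
  qed simp
qed

lemma mpol_subst_cong:
  assumes "\<And>a i. a \<in> Poly_Mapping.keys F \<Longrightarrow> i \<in> Poly_Mapping.keys a \<Longrightarrow> x i = y i"
  shows "mpol_subst h x F = mpol_subst h y F"
  unfolding mpol_subst_def using assms by (auto intro!: sum.cong prod.cong)

lemma mpol_eval_eq_subst: "mpol_eval F v = mpol_subst (\<lambda>r. r) (vec_index v) F"
  by (simp add: mpol_eval_def mpol_subst_def)

lemma hom_mpol_subst:
  assumes "comm_ring_hom g" "comm_ring_hom h"
  shows "g (mpol_subst h x F) = mpol_subst (\<lambda>r. g (h r)) (\<lambda>i. g (x i)) F"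
proof -
  interpret g: comm_ring_hom g by fact
  interpret h: comm_ring_hom h by fact
  show ?thesis
    by (simp add: mpol_subst_def g.hom_sum g.hom_mult g.hom_prod g.hom_power)
qed

definition weight :: "(nat \<Rightarrow> nat) \<Rightarrow> (nat \<Rightarrow>\<^sub>0 nat) \<Rightarrow> nat" where
  "weight w a = (\<Sum>i\<in>Poly_Mapping.keys a. w i * Poly_Mapping.lookup a i)"

lemma weight_add: "weight w (a + b) = weight w a + weight w b"
proof -
  let ?S = "Poly_Mapping.keys a \<union> Poly_Mapping.keys b"
  have *: "weight w c = (\<Sum>i\<in>?S. w i * Poly_Mapping.lookup c i)" if "Poly_Mapping.keys c \<subseteq> ?S" for c
    unfolding weight_def by (rule sum.mono_neutral_left) (use that in \<open>auto simp: in_keys_iff\<close>)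
  show ?thesis
    using Poly_Mapping.keys_add[of a b] by (simp add: * lookup_add distrib_left sum.distrib)
qed

text \<open>
  The coefficient of \<open>T ^ n\<close> in \<open>graded w F\<close> is the part of \<open>F\<close> of weight \<open>n\<close>: every variable
  \<open>x\<^sub>i\<close> is multiplied by \<open>T ^ w i\<close>.
\<close>

definition graded :: "(nat \<Rightarrow> nat) \<Rightarrow> 'k::comm_ring_1 mpol \<Rightarrow> 'k mpol poly" where
  "graded w = mpol_subst (\<lambda>r. [:mpol_const r:]) (\<lambda>i. monom (mpol_var i) (w i))"

lemma const_poly_hom: "comm_ring_hom (\<lambda>r. [:r:] :: 'b::comm_ring_1 poly)"
  by unfold_locales (simp_all add: pCons_one)

lemma comm_ring_hom_comp:
  assumes "comm_ring_hom g" "comm_ring_hom h"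
  shows "comm_ring_hom (\<lambda>r. g (h r))"
proof -
  interpret g: comm_ring_hom g by fact
  interpret h: comm_ring_hom h by fact
  show ?thesis by unfold_locales (simp_all add: h.hom_add h.hom_mult g.hom_add g.hom_mult)
qed

lemma const_const_hom: "comm_ring_hom (\<lambda>r. [:mpol_const r:] :: 'k::comm_ring_1 mpol poly)"
  by (rule comm_ring_hom_comp[OF const_poly_hom mpol_const_hom])

lemma graded_hom: "comm_ring_hom (graded w :: 'k::comm_ring_1 mpol \<Rightarrow> _)"
  unfolding graded_def by (rule comm_ring_hom.mpol_subst_hom[OF const_const_hom])

lemma graded_eq_sum:
  "graded w F = (\<Sum>a\<in>Poly_Mapping.keys F. monom (Poly_Mapping.single a (Poly_Mapping.lookup F a)) (weight w a))"
proof -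
  have monom_prod: "finite S \<Longrightarrow> (\<Prod>i\<in>S. monom (f i) (n i)) = monom (\<Prod>i\<in>S. f i) (\<Sum>i\<in>S. n i)"
    for S :: "nat set" and f :: "nat \<Rightarrow> 'a mpol" and n
    by (induction S rule: finite_induct) (simp_all add: mult_monom)
  have "[:mpol_const r:] * monomial_at (\<lambda>i. monom (mpol_var i) (w i)) a
      = monom (Poly_Mapping.single a r) (weight w a)" for a and r :: 'a
    by (simp add: monom_power monom_prod single_as_product smult_monom weight_def mult.commute)
  then show ?thesis
    by (simp add: graded_def mpol_subst_def)
qed

lemma lookup_coeff_graded:
  "Poly_Mapping.lookup (coeff (graded w F) n) a = (if weight w a = n then Poly_Mapping.lookup F a else 0)"
proof -
  have "Poly_Mapping.lookup (coeff (monom (Poly_Mapping.single b r) m) n) a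
      = (if b = a then if m = n then r else 0 else 0)" for b m and r :: 'a
    by (simp add: lookup_single when_def)
  then have "Poly_Mapping.lookup (coeff (graded w F) n) a
      = (\<Sum>b\<in>Poly_Mapping.keys F. if b = a then if weight w b = n then Poly_Mapping.lookup F b else 0 else 0)"
    unfolding graded_eq_sum coeff_sum lookup_sum by (simp only:)
  also have "\<dots> = (if a \<in> Poly_Mapping.keys F then if weight w a = n then Poly_Mapping.lookup F a else 0 else 0)"
    by (rule sum.delta) simp
  also have "\<dots> = (if weight w a = n then Poly_Mapping.lookup F a else 0)"
    by (simp add: in_keys_iff)
  finally show ?thesis .
qed

definition homogeneous :: "(nat \<Rightarrow> nat) \<Rightarrow> nat \<Rightarrow> 'k::comm_ring_1 mpol \<Rightarrow> bool" where
  "homogeneous w n F \<longleftrightarrow> (\<forall>a\<in>Poly_Mapping.keys F. weight w a = n)"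

lemma homogeneous_iff_graded: "homogeneous w n F \<longleftrightarrow> graded w F = monom F n"
proof
  assume "homogeneous w n F"
  then have "coeff (graded w F) m = coeff (monom F n) m" for m
    by (intro poly_mapping_eqI) (auto simp: homogeneous_def lookup_coeff_graded in_keys_iff)
  then show "graded w F = monom F n"
    by (rule poly_eqI)
next
  assume "graded w F = monom F n"
  then have *: "(if weight w a = m then Poly_Mapping.lookup F a else 0) = (if n = m then Poly_Mapping.lookup F a else 0)" for a m
    using lookup_coeff_graded[of w F m a, symmetric] by simp
  show "homogeneous w n F"
    unfolding homogeneous_def
  proof (intro ballI, rule ccontr)
    fix a assume "a \<in> Poly_Mapping.keys F" "weight w a \<noteq> n"
    with *[of a "weight w a"] show False by (auto simp: in_keys_iff)
  qed
qed

lemma factor_of_monom: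
  fixes p q :: "'a::idom poly"
  assumes "p * q = monom c n" "c \<noteq> 0"
  shows "p = monom (lead_coeff p) (degree p)"
proof -
  have "reflect_poly (monom c n) = [:c:]"
    using assms(2) by (induction n) (simp_all add: monom_0 monom_Suc reflect_poly_pCons')
  then have "reflect_poly p * reflect_poly q = [:c:]"
    using assms(1) by (metis reflect_poly_mult)
  moreover from this have "reflect_poly p \<noteq> 0" "reflect_poly q \<noteq> 0"
    using assms(2) by auto
  ultimately have "degree (reflect_poly p) + degree (reflect_poly q) = 0"
    using degree_mult_eq[of "reflect_poly p" "reflect_poly q"] by simp
  then have *: "coeff (reflect_poly p) (degree p - m) = 0" if "m < degree p" for m
    using that by (simp add: coeff_eq_0)
  have "coeff p m = 0" if "m < degree p" for m
    using *[OF that] that by (simp add: coeff_reflect_poly less_imp_le split: if_splits)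
  then have "coeff p m = coeff (monom (lead_coeff p) (degree p)) m" for m
    by (cases m "degree p" rule: linorder_cases) (simp_all add: coeff_eq_0)
  then show ?thesis
    by (rule poly_eqI)
qed

text \<open>
  The grading is a ring homomorphism and turns a homogeneous product into a monomial in \<open>T\<close>, whose
  factors are monomials.
\<close>

lemma homogeneous_factor:
  fixes F :: "'k::idom mpol"
  assumes "homogeneous w n (F * G)" "F * G \<noteq> 0"
  shows "\<exists>m. homogeneous w m F"
proof -
  interpret comm_ring_hom "graded w :: 'k mpol \<Rightarrow> _" by (rule graded_hom)
  have "graded w F * graded w G = monom (F * G) n"
    using assms(1) by (simp add: homogeneous_iff_graded hom_mult)
  from factor_of_monom[OF this assms(2)] obtain H m where H: "graded w F = monom H m"
    by blast
  have "H = F"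
  proof (rule poly_mapping_eqI)
    fix a
    show "Poly_Mapping.lookup H a = Poly_Mapping.lookup F a"
    proof (cases "weight w a = m")
      case True
      then show ?thesis using lookup_coeff_graded[of w F m a] H by simp
    next
      case False
      have "Poly_Mapping.lookup F a = 0"
        using lookup_coeff_graded[of w F "weight w a" a] False by (simp add: H)
      moreover have "Poly_Mapping.lookup H a = 0"
        using lookup_coeff_graded[of w F m a] False by (simp add: H)
      ultimately show ?thesis by simp
    qed
  qed
  with H show ?thesis by (auto simp: homogeneous_iff_graded)
qed

definition form_of_degree :: "nat \<Rightarrow> nat \<Rightarrow> 'k::comm_ring_1 mpol \<Rightarrow> bool" where
  "form_of_degree m n F \<longleftrightarrow>
     (\<forall>a\<in>Poly_Mapping.keys F. Poly_Mapping.keys a \<subseteq> {..<m} \<and> monom_degree a = n)"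

lemma monom_degree_eq_weight: "monom_degree a = weight (\<lambda>_. 1) a"
  by (simp add: monom_degree_def weight_def)

text \<open>
  Being a polynomial in the variables below \<open>m\<close> is homogeneity of weight \<open>0\<close> for the weight that
  counts the other variables, so the factorization result covers both halves of being a form.
\<close>

lemma form_of_degree_iff:
  "form_of_degree m n F \<longleftrightarrow>
     homogeneous (\<lambda>i. if i < m then 0 else 1) 0 F \<and> homogeneous (\<lambda>_. 1) n F"
proof -
  have "weight (\<lambda>i. if i < m then 0 else 1) a = 0 \<longleftrightarrow> Poly_Mapping.keys a \<subseteq> {..<m}" for a
    by (auto simp: weight_def in_keys_iff)
  then show ?thesis
    by (auto simp: form_of_degree_def homogeneous_def monom_degree_eq_weight)
qed

lemma form_in_iff: "form_in m F \<longleftrightarrow> (\<exists>n. form_of_degree m n F)"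
  by (auto simp: form_in_def form_of_degree_def)

lemma form_of_degree_factor:
  fixes F :: "'k::idom mpol"
  assumes "form_of_degree m n (F * G)" "F * G \<noteq> 0"
  shows "\<exists>k. form_of_degree m k F"
proof -
  have 0: "homogeneous (\<lambda>i. if i < m then 0 else 1) 0 (F * G)" and 1: "homogeneous (\<lambda>_. 1) n (F * G)"
    using assms(1) by (simp_all add: form_of_degree_iff)
  obtain j where j: "homogeneous (\<lambda>i. if i < m then 0 else 1) j F"
    using homogeneous_factor[OF 0 assms(2)] by blast
  obtain j' where j': "homogeneous (\<lambda>i. if i < m then 0 else 1) j' G"
    using homogeneous_factor[of _ 0 G F] 0 assms(2) by (auto simp: mult.commute)
  interpret comm_ring_hom "graded (\<lambda>i. if i < m then 0 else 1) :: 'k mpol \<Rightarrow> _" by (rule graded_hom)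
  have "monom (F * G) (j + j') = monom (F * G) 0"
    using j j' 0 hom_mult[of F G] by (simp add: homogeneous_iff_graded mult_monom)
  then have "degree (monom (F * G) (j + j')) = degree (monom (F * G) 0)"
    by simp
  then have "j = 0"
    unfolding degree_monom_eq[OF assms(2)] by simp
  with j homogeneous_factor[OF 1 assms(2)] show ?thesis
    by (auto simp: form_of_degree_iff)
qed

lemma form_of_degree_mult:
  assumes "form_of_degree m n F" "form_of_degree m n' G"
  shows "form_of_degree m (n + n') (F * G)"
  unfolding form_of_degree_def
proof
  fix a assume "a \<in> Poly_Mapping.keys (F * G)"
  then obtain b c where "a = b + c" "b \<in> Poly_Mapping.keys F" "c \<in> Poly_Mapping.keys G"
    using Poly_Mapping.keys_mult by blast
  moreover from this have "Poly_Mapping.keys b \<subseteq> {..<m}" "monom_degree b = n"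
      "Poly_Mapping.keys c \<subseteq> {..<m}" "monom_degree c = n'"
    using assms unfolding form_of_degree_def by blast+
  ultimately show "Poly_Mapping.keys a \<subseteq> {..<m} \<and> monom_degree a = n + n'"
    using Poly_Mapping.keys_add[of b c]
    by (simp add: monom_degree_eq_weight weight_add) blast
qed

lemma form_of_degree_const: "form_of_degree m 0 (mpol_const c)"
  by (auto simp: form_of_degree_def mpol_const_def monom_degree_def)

lemma form_of_degree_power:
  assumes "form_of_degree m n F"
  shows "form_of_degree m (k * n) (F ^ k)"
proof (induction k)
  case 0
  then show ?case using form_of_degree_const[of m "1::'a"] by (simp add: mpol_const_def)
qed (use assms form_of_degree_mult in \<open>auto\<close>)

lemma form_of_degree_unique:
  assumes "form_of_degree m n F" "form_of_degree m n' F" "F \<noteq> 0"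
  shows "n = n'"
proof -
  obtain a where "a \<in> Poly_Mapping.keys F"
    using assms(3) keys_eq_empty[of F] by blast
  then show ?thesis using assms by (auto simp: form_of_degree_def)
qed

lemma total_degree_form:
  assumes "form_of_degree m n F" "F \<noteq> 0"
  shows "total_degree F = n"
proof -
  obtain a where "a \<in> Poly_Mapping.keys F"
    using assms(2) keys_eq_empty[of F] by blast
  moreover have "monom_degree b = n" if "b \<in> Poly_Mapping.keys F" for b
    using assms(1) that by (auto simp: form_of_degree_def)
  ultimately have "monom_degree ` Poly_Mapping.keys F = {n}"
    by force
  then show ?thesis by (simp add: total_degree_def)
qed

lemma form_of_degree_0:
  assumes "form_of_degree m 0 F"
  shows "F = mpol_const (Poly_Mapping.lookup F 0)"
proof (rule poly_mapping_eqI)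
  fix a
  have "Poly_Mapping.lookup F a = 0" if "a \<noteq> 0"
  proof (rule ccontr)
    assume "Poly_Mapping.lookup F a \<noteq> 0"
    then have "monom_degree a = 0"
      using assms by (simp add: form_of_degree_def in_keys_iff)
    then have "Poly_Mapping.lookup a i = 0" for i
      by (cases "i \<in> Poly_Mapping.keys a") (auto simp: monom_degree_def in_keys_iff)
    then have "a = 0" by (intro poly_mapping_eqI) simp
    with that show False by simp
  qed
  then show "Poly_Mapping.lookup F a = Poly_Mapping.lookup (mpol_const (Poly_Mapping.lookup F 0)) a"
    by (auto simp: mpol_const_def lookup_single when_def)
qed

lemma mpol_const_unit: "c \<noteq> (0::'k::field) \<Longrightarrow> mpol_const c dvd 1"
  by (rule dvdI[of _ _ "mpol_const (inverse c)"]) (simp add: mpol_const_def mult_single)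

lemma form_of_degree_one: "form_of_degree m 0 (1 :: 'k::comm_ring_1 mpol)"
  using form_of_degree_const[of m "1::'k"] by (simp add: mpol_const_def)

lemma form_of_degree_factors:
  fixes F G :: "'k::idom mpol"
  assumes "form_of_degree m n (F * G)" "F * G \<noteq> 0"
  obtains k l where "form_of_degree m k F" "form_of_degree m l G" "k + l = n"
proof -
  obtain k where k: "form_of_degree m k F"
    using form_of_degree_factor[OF assms] by blast
  obtain l where l: "form_of_degree m l G"
    using form_of_degree_factor[of m n G F] assms by (auto simp: mult.commute)
  have "k + l = n"
    by (rule form_of_degree_unique[OF form_of_degree_mult[OF k l] assms])
  with k l that show thesis by blast
qed

lemma form_degree_0_cases:
  assumes "form_of_degree m 0 F" "F \<noteq> 0"
  obtains c where "c \<noteq> 0" "F = mpol_const c"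
proof
  show F: "F = mpol_const (Poly_Mapping.lookup F 0)"
    by (rule form_of_degree_0[OF assms(1)])
  show "Poly_Mapping.lookup F 0 \<noteq> 0"
  proof
    assume "Poly_Mapping.lookup F 0 = 0"
    then have "F = 0" using F by (simp add: mpol_const_def)
    with assms(2) show False by blast
  qed
qed

lemma form_unit_iff:
  fixes F :: "'k::field mpol"
  assumes "form_of_degree m n F" "F \<noteq> 0"
  shows "F dvd 1 \<longleftrightarrow> n = 0"
proof
  assume "F dvd 1"
  then obtain G where G: "1 = F * G" by (elim dvdE)
  have "form_of_degree m 0 (F * G)" "F * G \<noteq> 0"
    unfolding G[symmetric] using form_of_degree_one by simp_all
  then obtain k l where "form_of_degree m k F" "k + l = 0"
    using form_of_degree_factors by blast
  then show "n = 0" using form_of_degree_unique[OF assms(1) _ assms(2)] by blast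
next
  assume "n = 0"
  then show "F dvd 1"
    using assms form_degree_0_cases mpol_const_unit by metis
qed

lemma irreducible_form_degree_pos:
  fixes F :: "'k::field mpol"
  assumes "irreducible F" "form_of_degree m n F"
  shows "n > 0"
proof -
  have "F \<noteq> 0" using assms(1) by auto
  then show ?thesis
    using form_unit_iff[OF assms(2)] irreducible_not_unit[OF assms(1)] by blast
qed

section \<open>Irreducible real polynomials are determined by their complex zeros\<close>

text \<open>
  A set of ring homomorphisms into the complex numbers plays the role of the complex points of the
  spectrum. It has to separate nonzero elements from zero, and \<open>nullstellensatz\<close> says that an
  irreducible element divides whatever vanishes at all its zeros. Both properties pass from a
  coefficient ring to its polynomials.
\<close>

definition complex_points :: "('a::comm_ring_1 \<Rightarrow> complex) set \<Rightarrow> bool" where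
  "complex_points E \<longleftrightarrow> (\<forall>\<epsilon>\<in>E. comm_ring_hom \<epsilon>) \<and> (\<forall>h. h \<noteq> 0 \<longrightarrow> (\<exists>\<epsilon>\<in>E. \<epsilon> h \<noteq> 0))"

definition nullstellensatz :: "('a::comm_ring_1 \<Rightarrow> complex) set \<Rightarrow> bool" where
  "nullstellensatz E \<longleftrightarrow>
     (\<forall>G H. irreducible G \<longrightarrow> (\<forall>\<epsilon>\<in>E. \<epsilon> G = 0 \<longrightarrow> \<epsilon> H = 0) \<longrightarrow> G dvd H)"

definition poly_points :: "('a::comm_ring_1 \<Rightarrow> complex) set \<Rightarrow> ('a poly \<Rightarrow> complex) set" where
  "poly_points E = {\<lambda>p. poly (map_poly \<epsilon> p) z | \<epsilon> z. \<epsilon> \<in> E}"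

lemma poly_map_poly_hom:
  assumes "comm_ring_hom (\<epsilon> :: 'a::comm_ring_1 \<Rightarrow> 'b::comm_ring_1)"
  shows "comm_ring_hom (\<lambda>p. poly (map_poly \<epsilon> p) z)"
proof -
  interpret comm_ring_hom \<epsilon> by fact
  interpret m: map_poly_comm_ring_hom \<epsilon> ..
  show ?thesis by unfold_locales (simp_all add: m.hom_add m.hom_mult)
qed

lemma
  assumes "comm_ring_hom (\<epsilon> :: 'a::comm_ring_1 \<Rightarrow> 'b::comm_ring_1)"
  shows poly_map_poly_const: "poly (map_poly \<epsilon> [:a:]) z = \<epsilon> a"
    and poly_map_poly_var: "poly (map_poly \<epsilon> [:0, 1:]) z = z"
proof -
  interpret comm_ring_hom \<epsilon> by fact
  show "poly (map_poly \<epsilon> [:a:]) z = \<epsilon> a" "poly (map_poly \<epsilon> [:0, 1:]) z = z"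
    by (simp_all add: map_poly_pCons_hom)
qed

lemma complex_points_poly:
  assumes "complex_points (E :: ('a::idom \<Rightarrow> complex) set)"
  shows "complex_points (poly_points E)"
  unfolding complex_points_def
proof (intro conjI ballI allI impI)
  fix \<epsilon>' assume "\<epsilon>' \<in> poly_points E"
  then show "comm_ring_hom \<epsilon>'"
    using assms poly_map_poly_hom by (auto simp: poly_points_def complex_points_def)
next
  fix h :: "'a poly" assume "h \<noteq> 0"
  then obtain \<epsilon> where \<epsilon>: "\<epsilon> \<in> E" "\<epsilon> (lead_coeff h) \<noteq> 0"
    using assms by (metis complex_points_def leading_coeff_0_iff)
  interpret comm_ring_hom \<epsilon> using assms \<epsilon> by (auto simp: complex_points_def)
  have "map_poly \<epsilon> h \<noteq> 0"
    using \<epsilon>(2) by (metis coeff_0 coeff_map_poly_hom)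
  then have "\<exists>z. poly (map_poly \<epsilon> h) z \<noteq> 0"
    using poly_all_0_iff_0 by blast
  with \<epsilon>(1) show "\<exists>\<epsilon>'\<in>poly_points E. \<epsilon>' h \<noteq> 0"
    by (auto simp: poly_points_def)
qed

text \<open>
  If \<open>G\<close> does not divide \<open>H\<close>, the two are coprime, so their resultant is a nonzero element of the
  coefficient ring. At a point where neither the resultant nor a leading coefficient vanishes, the
  specialized polynomials keep their degrees and stay coprime; but the specialization of \<open>G\<close> has a
  root, which is then a zero of \<open>G\<close> and not of \<open>H\<close>. If \<open>G\<close> is constant in the last variable, the
  claim for the coefficients of \<open>H\<close> suffices.
\<close>

lemma nullstellensatz_poly:
  fixes E :: "('a::{factorial_ring_gcd,semiring_gcd_mult_normalize} \<Rightarrow> complex) set"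
  assumes E: "complex_points E" "nullstellensatz E"
  shows "nullstellensatz (poly_points E)"
  unfolding nullstellensatz_def
proof (intro allI impI)
  fix G H :: "'a poly"
  assume irr: "irreducible G" and "\<forall>\<epsilon>\<in>poly_points E. \<epsilon> G = 0 \<longrightarrow> \<epsilon> H = 0"
  then have zeros: "poly (map_poly \<epsilon> H) z = 0" if "\<epsilon> \<in> E" "poly (map_poly \<epsilon> G) z = 0" for \<epsilon> z
    using that by (auto simp: poly_points_def)
  show "G dvd H"
  proof (cases "degree G = 0")
    case True
    then obtain g where G: "G = [:g:]" by (metis degree_eq_zeroE)
    have "irreducible g"
      using irr unfolding G by (simp add: irreducible_const_poly_iff)
    have "g dvd coeff H n" for n
    proof -
      have "\<epsilon> (coeff H n) = 0" if "\<epsilon> \<in> E" "\<epsilon> g = 0" for \<epsilon>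
      proof -
        interpret comm_ring_hom \<epsilon> using E(1) that by (auto simp: complex_points_def)
        have "poly (map_poly \<epsilon> H) z = 0" for z
          using zeros[OF that(1), of z] that(2) by (simp add: G poly_map_poly_const[OF comm_ring_hom_axioms])
        then have "map_poly \<epsilon> H = 0"
          using poly_all_0_iff_0 by blast
        then show ?thesis by (metis coeff_0 coeff_map_poly_hom)
      qed
      with \<open>irreducible g\<close> show ?thesis
        using E(2) by (auto simp: nullstellensatz_def)
    qed
    then show ?thesis
      unfolding G by (simp add: const_poly_dvd_iff)
  next
    case False
    show ?thesis
    proof (rule ccontr)
      assume ndvd: "\<not> G dvd H"
      then have "coprime G H"
        using irr by (meson irreducible_imp_prime_elem_gcd prime_elem_imp_coprime)
      then have "gcd G H = 1" by simp
      then have res: "resultant G H \<noteq> 0"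
        by (simp add: resultant_0_gcd)
      have "lead_coeff G * lead_coeff H * resultant G H \<noteq> 0"
        using res ndvd False by auto
      then obtain \<epsilon> where \<epsilon>: "\<epsilon> \<in> E" "\<epsilon> (lead_coeff G * lead_coeff H * resultant G H) \<noteq> 0"
        using E(1) unfolding complex_points_def by blast
      interpret comm_ring_hom \<epsilon> using E(1) \<epsilon> by (auto simp: complex_points_def)
      have nz: "\<epsilon> (lead_coeff G) \<noteq> 0" "\<epsilon> (lead_coeff H) \<noteq> 0" "\<epsilon> (resultant G H) \<noteq> 0"
        using \<epsilon>(2) by (auto simp: hom_mult)
      have dG: "degree (map_poly \<epsilon> G) = degree G"
        by (rule degree_map_poly) (use nz in auto)
      have dH: "degree (map_poly \<epsilon> H) = degree H"
        by (rule degree_map_poly) (use nz in auto)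
      have "resultant (map_poly \<epsilon> G) (map_poly \<epsilon> H) \<noteq> 0"
        using resultant_map_poly[OF dG dH] nz by simp
      then have deg: "degree (gcd (map_poly \<epsilon> G) (map_poly \<epsilon> H)) = 0"
        by (simp add: resultant_0_gcd)
      have "\<not> constant (poly (map_poly \<epsilon> G))"
        using False dG by (simp add: constant_degree)
      then obtain z where z: "poly (map_poly \<epsilon> G) z = 0"
        using fundamental_theorem_of_algebra by blast
      from z zeros[OF \<epsilon>(1) z] have "[:-z, 1:] dvd gcd (map_poly \<epsilon> G) (map_poly \<epsilon> H)"
        by (simp add: poly_eq_0_iff_dvd)
      moreover have "gcd (map_poly \<epsilon> G) (map_poly \<epsilon> H) \<noteq> 0"
        using False dG by auto
      ultimately have "degree [:-z, 1:] \<le> 0"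
        using deg by (metis dvd_imp_degree_le)
      then show False by simp
    qed
  qed
qed

text \<open>
  Nested univariate polynomials form a factorial ring in which the resultant detects common factors,
  so the induction over the number of variables takes place there. Its result is transferred to
  polynomials in the variables \<open>x\<^sub>0, \<dots>, x\<^sub>4\<close> along mutually inverse homomorphisms.
\<close>

type_synonym poly5 = "real poly poly poly poly poly"

definition poly5_const :: "real \<Rightarrow> poly5" where
  "poly5_const r = [:[:[:[:[:r:]:]:]:]:]"

definition poly5_var :: "nat \<Rightarrow> poly5" where
  "poly5_var i = (if i = 0 then [:[:[:[:[:0, 1:]:]:]:]:] else if i = 1 then [:[:[:[:0, 1:]:]:]:]
     else if i = 2 then [:[:[:0, 1:]:]:] else if i = 3 then [:[:0, 1:]:] else [:0, 1:])"

definition poly5_eval :: "(real \<Rightarrow> 'b::comm_ring_1) \<Rightarrow> (nat \<Rightarrow> 'b) \<Rightarrow> poly5 \<Rightarrow> 'b" where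
  "poly5_eval h x = (\<lambda>p. poly (map_poly (\<lambda>p. poly (map_poly (\<lambda>p. poly (map_poly (\<lambda>p. poly (map_poly (\<lambda>p.
     poly (map_poly h p) (x 0)) p) (x 1)) p) (x 2)) p) (x 3)) p) (x 4))"

lemma poly5_const_hom: "comm_ring_hom poly5_const"
  by unfold_locales (simp_all add: poly5_const_def pCons_one)

lemma poly5_eval_hom: "comm_ring_hom h \<Longrightarrow> comm_ring_hom (poly5_eval h x)"
  unfolding poly5_eval_def by (intro poly_map_poly_hom)

lemma
  assumes "comm_ring_hom (h :: real \<Rightarrow> 'b::comm_ring_1)"
  shows poly5_eval_const: "poly5_eval h x (poly5_const r) = h r"
    and poly5_eval_var: "i < 5 \<Longrightarrow> poly5_eval h x (poly5_var i) = x i"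
proof -
  note [simp] = assms poly_map_poly_hom poly_map_poly_const poly_map_poly_var
  show "poly5_eval h x (poly5_const r) = h r"
    unfolding poly5_const_def poly5_eval_def by simp
  assume "i < 5"
  then have "i = 0 \<or> i = 1 \<or> i = 2 \<or> i = 3 \<or> i = 4" by auto
  then show "poly5_eval h x (poly5_var i) = x i"
    unfolding poly5_var_def poly5_eval_def
    by (elim disjE) (simp_all del: map_poly_pCons add: poly_map_poly_var[unfolded pCons_one])
qed

lemma poly_hom_ext:
  assumes "comm_ring_hom \<phi>" "comm_ring_hom \<psi>" "\<And>a. \<phi> [:a:] = \<psi> [:a:]" "\<phi> [:0, 1:] = \<psi> [:0, 1:]"
  shows "\<phi> p = \<psi> (p :: 'a::comm_ring_1 poly)"
proof -
  interpret \<phi>: comm_ring_hom \<phi> by fact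
  interpret \<psi>: comm_ring_hom \<psi> by fact
  show ?thesis
  proof (induction p)
    case (pCons a p)
    have "pCons a p = [:a:] + [:0, 1:] * p" by simp
    then show ?case
      using assms(3,4) pCons.IH by (simp only: \<phi>.hom_add \<phi>.hom_mult \<psi>.hom_add \<psi>.hom_mult)
  qed simp
qed

lemma poly5_hom_ext:
  assumes "comm_ring_hom \<phi>" "comm_ring_hom \<psi>" "\<And>a. \<phi> (poly5_const a) = \<psi> (poly5_const a)"
    "\<And>i. i < 5 \<Longrightarrow> \<phi> (poly5_var i) = \<psi> (poly5_var i)"
  shows "\<phi> p = \<psi> p"
proof -
  have v: "\<phi> (poly5_var 0) = \<psi> (poly5_var 0)" "\<phi> (poly5_var 1) = \<psi> (poly5_var 1)"
    "\<phi> (poly5_var 2) = \<psi> (poly5_var 2)" "\<phi> (poly5_var 3) = \<psi> (poly5_var 3)"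
    "\<phi> (poly5_var 4) = \<psi> (poly5_var 4)"
    by (rule assms(4), simp)+
  have c: "comm_ring_hom (\<lambda>a :: 'x::comm_ring_1. [:a:])" "comm_ring_hom (\<lambda>a :: 'x. [:[:a:]:])"
    "comm_ring_hom (\<lambda>a :: 'x. [:[:[:a:]:]:])" "comm_ring_hom (\<lambda>a :: 'x. [:[:[:[:a:]:]:]:])"
    by (unfold_locales, simp_all add: pCons_one)+
  have hom: "comm_ring_hom (\<lambda>a. \<phi> [:[:[:[:a:]:]:]:])" "comm_ring_hom (\<lambda>a. \<psi> [:[:[:[:a:]:]:]:])"
    "comm_ring_hom (\<lambda>a. \<phi> [:[:[:a:]:]:])" "comm_ring_hom (\<lambda>a. \<psi> [:[:[:a:]:]:])"
    "comm_ring_hom (\<lambda>a. \<phi> [:[:a:]:])" "comm_ring_hom (\<lambda>a. \<psi> [:[:a:]:])"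
    "comm_ring_hom (\<lambda>a. \<phi> [:a:])" "comm_ring_hom (\<lambda>a. \<psi> [:a:])"
    using comm_ring_hom_comp[OF assms(1)] comm_ring_hom_comp[OF assms(2)] c by blast+
  note v = v[unfolded poly5_var_def, simplified]
  note c = assms(3)[unfolded poly5_const_def]
  have 1: "\<phi> [:[:[:[:a:]:]:]:] = \<psi> [:[:[:[:a:]:]:]:]" for a
    by (rule poly_hom_ext[OF hom(1,2)]) (simp_all add: c v)
  have 2: "\<phi> [:[:[:a:]:]:] = \<psi> [:[:[:a:]:]:]" for a
    by (rule poly_hom_ext[OF hom(3,4)]) (simp_all add: 1 v)
  have 3: "\<phi> [:[:a:]:] = \<psi> [:[:a:]:]" for a
    by (rule poly_hom_ext[OF hom(5,6)]) (simp_all add: 2 v)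
  have 4: "\<phi> [:a:] = \<psi> [:a:]" for a
    by (rule poly_hom_ext[OF hom(7,8)]) (simp_all add: 3 v)
  show ?thesis
    by (rule poly_hom_ext[OF assms(1,2)]) (simp_all add: 4 v)
qed

definition mpol_to_poly5 :: "real mpol \<Rightarrow> poly5" where
  "mpol_to_poly5 = mpol_subst poly5_const poly5_var"

definition poly5_to_mpol :: "poly5 \<Rightarrow> real mpol" where
  "poly5_to_mpol = poly5_eval mpol_const mpol_var"

lemma mpol_to_poly5_hom: "comm_ring_hom mpol_to_poly5"
  unfolding mpol_to_poly5_def by (rule comm_ring_hom.mpol_subst_hom[OF poly5_const_hom])

lemma poly5_to_mpol_hom: "comm_ring_hom poly5_to_mpol"
  unfolding poly5_to_mpol_def by (rule poly5_eval_hom[OF mpol_const_hom])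

lemmas poly5_to_mpol_simps =
  poly5_eval_const[OF mpol_const_hom, of mpol_var, folded poly5_to_mpol_def]
  poly5_eval_var[OF mpol_const_hom, of _ mpol_var, folded poly5_to_mpol_def]

lemmas mpol_to_poly5_simps =
  comm_ring_hom.mpol_subst_const[OF poly5_const_hom, of poly5_var, folded mpol_to_poly5_def]
  comm_ring_hom.mpol_subst_var[OF poly5_const_hom, of poly5_var, folded mpol_to_poly5_def]

lemma comm_ring_hom_id: "comm_ring_hom (\<lambda>p :: 'a::comm_ring_1. p)"
  by unfold_locales auto

lemma mpol_to_poly5_to_mpol: "mpol_to_poly5 (poly5_to_mpol p) = p"
proof (rule poly5_hom_ext[where \<phi> = "\<lambda>p. mpol_to_poly5 (poly5_to_mpol p)" and \<psi> = "\<lambda>p. p"])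
  show "comm_ring_hom (\<lambda>p. mpol_to_poly5 (poly5_to_mpol p))"
    by (rule comm_ring_hom_comp[OF mpol_to_poly5_hom poly5_to_mpol_hom])
qed (simp_all only: poly5_to_mpol_simps mpol_to_poly5_simps comm_ring_hom_id)

definition vars_below :: "nat \<Rightarrow> 'k::zero mpol \<Rightarrow> bool" where
  "vars_below m F \<longleftrightarrow> (\<forall>a\<in>Poly_Mapping.keys F. Poly_Mapping.keys a \<subseteq> {..<m})"

lemma poly5_to_mpol_to_poly5:
  assumes "vars_below 5 F"
  shows "poly5_to_mpol (mpol_to_poly5 F) = F"
proof -
  have lt: "i < 5" if "a \<in> Poly_Mapping.keys F" "i \<in> Poly_Mapping.keys a" for a i
    using assms that unfolding vars_below_def by blast
  have "poly5_to_mpol (mpol_to_poly5 F) = mpol_subst mpol_const mpol_var F"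
  proof (rule hom_eq_mpol_subst[where \<phi> = "\<lambda>F. poly5_to_mpol (mpol_to_poly5 F)"])
    show "comm_ring_hom (\<lambda>F. poly5_to_mpol (mpol_to_poly5 F))"
      by (rule comm_ring_hom_comp[OF poly5_to_mpol_hom mpol_to_poly5_hom])
  qed (simp_all only: poly5_to_mpol_simps mpol_to_poly5_simps lt)
  also have "\<dots> = F"
    by (rule hom_eq_mpol_subst[symmetric, OF comm_ring_hom_id]) (rule refl)+
  finally show ?thesis .
qed

lemma poly5_eval_mpol_to_poly5:
  assumes "vars_below 5 F" and h: "comm_ring_hom (h :: real \<Rightarrow> 'b::comm_ring_1)"
  shows "poly5_eval h x (mpol_to_poly5 F) = mpol_subst h x F"
proof (rule hom_eq_mpol_subst[where \<phi> = "\<lambda>F. poly5_eval h x (mpol_to_poly5 F)"])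
  show "comm_ring_hom (\<lambda>F. poly5_eval h x (mpol_to_poly5 F))"
    by (rule comm_ring_hom_comp[OF poly5_eval_hom[OF h] mpol_to_poly5_hom])
  have "i < 5" if "a \<in> Poly_Mapping.keys F" "i \<in> Poly_Mapping.keys a" for a i
    using assms(1) that unfolding vars_below_def by blast
  then show "poly5_eval h x (mpol_to_poly5 (mpol_var i)) = x i"
    if "a \<in> Poly_Mapping.keys F" "i \<in> Poly_Mapping.keys a" for a i
    using that by (simp only: mpol_to_poly5_simps poly5_eval_var[OF h])
qed (simp only: mpol_to_poly5_simps poly5_eval_const[OF h])

lemma comm_ring_hom_of_real: "comm_ring_hom (of_real :: real \<Rightarrow> complex)"
  by unfold_locales auto

lemma nullstellensatz_real:
  "complex_points {of_real :: real \<Rightarrow> complex}" "nullstellensatz {of_real :: real \<Rightarrow> complex}"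
  by (auto simp: complex_points_def nullstellensatz_def comm_ring_hom_of_real irreducible_def)

lemma nullstellensatz_poly5:
  assumes "irreducible (G :: poly5)"
    and "\<And>x :: nat \<Rightarrow> complex. poly5_eval of_real x G = 0 \<Longrightarrow> poly5_eval of_real x H = 0"
  shows "G dvd H"
proof -
  let ?E = "poly_points (poly_points (poly_points (poly_points (poly_points {of_real :: real \<Rightarrow> complex}))))"
  have "nullstellensatz ?E"
    by (intro nullstellensatz_poly complex_points_poly nullstellensatz_real)
  moreover have "\<epsilon> H = 0" if \<epsilon>: "\<epsilon> \<in> ?E" "\<epsilon> G = 0" for \<epsilon>
  proof -
    obtain a b c d e where *: "\<epsilon> = (\<lambda>p. poly (map_poly (\<lambda>p. poly (map_poly (\<lambda>p. poly (map_poly (\<lambda>p. poly (map_poly (\<lambda>p.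
     poly (map_poly of_real p) a) p) b) p) c) p) d) p) e)"
      using \<epsilon>(1) unfolding poly_points_def by blast
    have "\<epsilon> = poly5_eval of_real (nth [a, b, c, d, e])"
      unfolding * poly5_eval_def by simp
    with assms(2) \<epsilon>(2) show ?thesis by simp
  qed
  ultimately show ?thesis
    using assms(1) by (auto simp: nullstellensatz_def)
qed

lemma irreducible_mpol_to_poly5:
  assumes "irreducible F" "vars_below 5 F"
  shows "irreducible (mpol_to_poly5 F)"
proof -
  interpret fw: comm_ring_hom mpol_to_poly5 by (rule mpol_to_poly5_hom)
  interpret bk: comm_ring_hom poly5_to_mpol by (rule poly5_to_mpol_hom)
  have retract: "poly5_to_mpol (mpol_to_poly5 F) = F"
    by (rule poly5_to_mpol_to_poly5) fact
  have unit: "p dvd 1" if "poly5_to_mpol p dvd 1" for p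
    using fw.hom_dvd[OF that] by (simp add: mpol_to_poly5_to_mpol)
  show ?thesis
  proof (rule irreducibleI)
    show "mpol_to_poly5 F \<noteq> 0"
      using retract assms(1) by auto
    show "\<not> mpol_to_poly5 F dvd 1"
      using bk.hom_dvd[of "mpol_to_poly5 F" 1] retract assms(1) by (auto dest: irreducible_not_unit)
    fix p q assume "mpol_to_poly5 F = p * q"
    then have "F = poly5_to_mpol p * poly5_to_mpol q"
      using retract by (simp add: bk.hom_mult)
    then show "p dvd 1 \<or> q dvd 1"
      using assms(1) unit by (metis irreducibleD)
  qed
qed

abbreviation complex_eval :: "real mpol \<Rightarrow> (nat \<Rightarrow> complex) \<Rightarrow> complex" where
  "complex_eval F x \<equiv> mpol_subst of_real x F"

text \<open>
  Over the reals \<open>G\<close> may have few real zeros or none; its complex zeros determine it up to a factor.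
\<close>

theorem irreducible_dvd_if_zeros:
  assumes "irreducible G" "vars_below 5 G" "vars_below 5 H"
    and "\<And>x. complex_eval G x = 0 \<Longrightarrow> complex_eval H x = 0"
  shows "G dvd H"
proof -
  interpret bk: comm_ring_hom poly5_to_mpol by (rule poly5_to_mpol_hom)
  have "mpol_to_poly5 G dvd mpol_to_poly5 H"
    by (rule nullstellensatz_poly5)
      (use assms in \<open>simp_all add: irreducible_mpol_to_poly5 poly5_eval_mpol_to_poly5 comm_ring_hom_of_real\<close>)
  from bk.hom_dvd[OF this] show ?thesis
    by (simp add: poly5_to_mpol_to_poly5 assms(2,3))
qed

section \<open>Resultants as products over roots\<close>

definition linear_factors :: "complex list \<Rightarrow> complex poly" where
  "linear_factors as = (\<Prod>a\<leftarrow>as. [:-a, 1:])"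

lemma linear_factors_simps [simp]:
  "linear_factors [] = 1" "linear_factors (a # as) = [:-a, 1:] * linear_factors as"
  by (simp_all add: linear_factors_def)

lemma linear_factors_nz [simp]: "linear_factors as \<noteq> 0"
  by (induction as) (simp_all del: mult_pCons_left)

lemma degree_linear_factors_list [simp]: "degree (linear_factors as) = length as"
  by (induction as) (simp_all add: degree_mult_eq del: mult_pCons_left)

lemma poly_linear_factors: "poly (linear_factors as) z = (\<Prod>a\<leftarrow>as. z - a)"
  by (induction as) (simp_all del: mult_pCons_left)

lemma exists_linear_factors:
  obtains as where "p = Polynomial.smult (lead_coeff p) (linear_factors as)" "length as = degree p"
proof -
  obtain as where as: "Polynomial.smult (coeff p (degree p)) (linear_factors as) = p" "length as = degree p"
    using fundamental_theorem_algebra_factorized[of p] unfolding linear_factors_def by blast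
  with that show ?thesis by metis
qed

lemma poly_zero_iff_mem_roots:
  assumes "p = Polynomial.smult c (linear_factors as)" "p \<noteq> 0"
  shows "poly p z = 0 \<longleftrightarrow> z \<in> set as"
  using assms by (auto simp: poly_linear_factors prod_list_zero_iff)

lemma prod_list_uminus: "(\<Prod>a\<leftarrow>xs. - f a) = (-1) ^ length xs * (\<Prod>a\<leftarrow>xs. f a :: complex)"
  by (induction xs) auto

lemma prod_list_smult: "(\<Prod>a\<leftarrow>xs. c * f a) = c ^ length xs * (\<Prod>a\<leftarrow>xs. f a :: complex)"
  by (induction xs) auto

lemma prod_list_swap:
  "(\<Prod>a\<leftarrow>as. \<Prod>b\<leftarrow>bs. f a b :: complex) = (\<Prod>b\<leftarrow>bs. \<Prod>a\<leftarrow>as. f a b)"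
proof (induction as)
  case Nil
  then show ?case by (induction bs) auto
next
  case (Cons a as)
  then show ?case by (simp add: prod_list_multf)
qed

text \<open>Both sides are the product of the differences of roots of \<open>f\<close> and of \<open>g\<close>, up to sign.\<close>

lemma prod_roots_swap:
  assumes "f = Polynomial.smult c (linear_factors as)" "g = Polynomial.smult d (linear_factors bs)"
  shows "c ^ length bs * (\<Prod>a\<leftarrow>as. poly g a)
    = (-1) ^ (length as * length bs) * (d ^ length as * (\<Prod>b\<leftarrow>bs. poly f b))"
proof -
  have "(\<Prod>a\<leftarrow>as. poly g a) = d ^ length as * (\<Prod>a\<leftarrow>as. \<Prod>b\<leftarrow>bs. a - b)"
    by (simp add: assms(2) poly_linear_factors prod_list_smult)
  moreover have "(\<Prod>b\<leftarrow>bs. poly f b) = c ^ length bs * (\<Prod>b\<leftarrow>bs. \<Prod>a\<leftarrow>as. b - a)"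
    by (simp add: assms(1) poly_linear_factors prod_list_smult)
  moreover have "(\<Prod>b\<leftarrow>bs. \<Prod>a\<leftarrow>as. b - a) = (\<Prod>b\<leftarrow>bs. (-1) ^ length as * (\<Prod>a\<leftarrow>as. a - b))"
    using prod_list_uminus[of "\<lambda>a. a - b" as for b] by simp
  moreover have "\<dots> = (-1) ^ (length as * length bs) * (\<Prod>a\<leftarrow>as. \<Prod>b\<leftarrow>bs. a - b)"
    by (simp add: prod_list_smult prod_list_swap[of _ as] power_mult)
  ultimately show ?thesis
    by (simp add: mult_ac power_mult_distrib[symmetric])
qed

text \<open>
  Poisson's formula. Both sides change in the same way when \<open>g\<close> is replaced by its remainder
  modulo \<open>f\<close> and when \<open>f\<close> and \<open>g\<close> are exchanged, so the Euclidean algorithm proves the formula.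
\<close>

theorem resultant_eq_prod_roots:
  assumes "f \<noteq> 0" "g \<noteq> 0" "f = Polynomial.smult (lead_coeff f) (linear_factors as)"
  shows "resultant f g = lead_coeff f ^ degree g * (\<Prod>a\<leftarrow>as. poly g a)"
  using assms
proof (induction "degree f + degree g" arbitrary: f g as rule: less_induct)
  case less
  have main: "resultant p h = lead_coeff p ^ degree h * (\<Prod>a\<leftarrow>cs. poly h a)"
    if "degree p + degree h = degree f + degree g" "degree p \<le> degree h" "p \<noteq> 0" "h \<noteq> 0"
      and p: "p = Polynomial.smult (lead_coeff p) (linear_factors cs)" for p h cs
  proof (cases "degree p = 0")
    case True
    then obtain c where "p = [:c:]" by (metis degree_eq_zeroE)
    moreover have "cs = []"
      using True p that(3) by (metis degree_linear_factors_list degree_smult_eq leading_coeff_0_iff length_0_conv)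
    ultimately show ?thesis by simp
  next
    case False
    define r where "r = h mod p"
    have hr: "h + (- (h div p)) * p = r"
      unfolding r_def by (simp add: minus_div_mult_eq_mod[symmetric])
    have len: "length cs = degree p"
      using p that(3) by (metis degree_linear_factors_list degree_smult_eq leading_coeff_0_iff)
    have root: "poly p a = 0" if "a \<in> set cs" for a
      using poly_zero_iff_mem_roots[OF p \<open>p \<noteq> 0\<close>] that by simp
    have prod_r: "(\<Prod>a\<leftarrow>cs. poly h a) = (\<Prod>a\<leftarrow>cs. poly r a)"
    proof -
      have "poly r a = poly h a" if "a \<in> set cs" for a
        using root[OF that] by (simp add: hr[symmetric])
      then show ?thesis by (metis (mono_tags, lifting) map_eq_conv)
    qed
    show ?thesis
    proof (cases "r = 0")
      case True
      then have "p dvd h" by (simp add: r_def dvd_eq_mod_eq_0)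
      then have "gcd p h = normalize p" by (simp add: gcd_proj1_iff)
      then have "resultant p h = 0"
        using False by (simp add: resultant_0_gcd)
      moreover have "(\<Prod>a\<leftarrow>cs. poly r a) = 0"
        using True False len by (cases cs) auto
      ultimately show ?thesis using prod_r by simp
    next
      case r: False
      have dr: "degree r < degree p"
        using False degree_mod_less'[of p h] r unfolding r_def by (cases "p = 0") auto
      have IH: "resultant p r = lead_coeff p ^ degree r * (\<Prod>a\<leftarrow>cs. poly r a)"
        by (rule less.hyps) (use dr that r p in auto)
      have "resultant h p = (-1) ^ (degree h * degree p) * lead_coeff p ^ (degree h - degree r) * resultant p r"
      proof (cases "degree r = 0")
        case True
        then obtain c where c: "r = [:c:]" by (metis degree_eq_zeroE)
        have pow: "c ^ (degree p - Suc 0) * c = c ^ degree p"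
          using \<open>degree p \<noteq> 0\<close> by (cases "degree p") auto
        have "subresultant 0 h p = Polynomial.smult ((-1) ^ (degree h * degree p) * lead_coeff p ^ degree h * c ^ (degree p - 1)) [:c:]"
          using BT_lemma_1_13[OF hr] that(2) dr True c by simp
        then have "resultant h p = (-1) ^ (degree h * degree p) * lead_coeff p ^ degree h * c ^ (degree p - 1) * c"
          by (simp flip: coeff_subresultant_0_0_resultant)
        moreover have "c ^ (degree p - 1) * c = resultant p r"
          using pow by (simp add: c)
        ultimately show ?thesis using True by (simp add: mult.assoc)
      next
        case False
        then have "subresultant 0 h p = Polynomial.smult ((-1) ^ (degree h * degree p) * lead_coeff p ^ (degree h - degree r)) (subresultant 0 p r)"
          using BT_lemma_1_12[OF hr, of 0] that(2) dr by simp
        then show ?thesis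
          by (simp flip: coeff_subresultant_0_0_resultant)
      qed
      then have "resultant p h = lead_coeff p ^ (degree h - degree r) * resultant p r"
        by (subst resultant_swap) (simp add: mult.commute[of "degree p"] flip: power_mult_distrib mult.assoc)
      then show ?thesis
        using IH prod_r dr that(2) by (simp flip: power_add mult.assoc)
    qed
  qed
  show ?case
  proof (cases "degree f \<le> degree g")
    case True
    then show ?thesis using main less.prems by blast
  next
    case False
    obtain bs where bs: "g = Polynomial.smult (lead_coeff g) (linear_factors bs)" "length bs = degree g"
      by (rule exists_linear_factors)
    have len: "length as = degree f"
      using less.prems by (metis degree_linear_factors_list degree_smult_eq leading_coeff_0_iff)
    have "resultant g f = lead_coeff g ^ degree f * (\<Prod>b\<leftarrow>bs. poly f b)"
      by (rule main) (use False less.prems bs in auto)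
    then show ?thesis
      using prod_roots_swap[OF less.prems(3) bs(1)] bs(2) len
      by (subst resultant_swap) simp
  qed
qed

section \<open>Polynomial functions on lines\<close>

definition polyfun :: "(complex \<Rightarrow> complex) \<Rightarrow> bool" where
  "polyfun \<phi> \<longleftrightarrow> (\<exists>p. \<forall>z. \<phi> z = poly p z)"

lemma polyfun_poly [intro]: "polyfun (poly p)"
  by (auto simp: polyfun_def)

lemma polyfun_zero_or_finite:
  assumes "polyfun \<phi>" "\<phi> z \<noteq> 0"
  shows "finite {z. \<phi> z = 0}"
proof -
  obtain p where p: "\<And>z. \<phi> z = poly p z" using assms(1) by (auto simp: polyfun_def)
  with assms(2) have "p \<noteq> 0" by auto
  then show ?thesis by (simp add: p poly_roots_finite)
qed

lemma polyfun_diff: "polyfun \<phi> \<Longrightarrow> polyfun \<psi> \<Longrightarrow> polyfun (\<lambda>z. \<phi> z - \<psi> z)"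
  unfolding polyfun_def by (metis poly_diff)

lemma polyfun_mult: "polyfun \<phi> \<Longrightarrow> polyfun \<psi> \<Longrightarrow> polyfun (\<lambda>z. \<phi> z * \<psi> z)"
  unfolding polyfun_def by (metis poly_mult)

lemma polyfun_const: "polyfun (\<lambda>z. c)"
  unfolding polyfun_def by (rule exI[of _ "[:c:]"]) simp

lemma polyfun_affine: "polyfun (\<lambda>z. c + z * d)"
  unfolding polyfun_def by (rule exI[of _ "[:c, d:]"]) simp

lemma polyfun_power: "polyfun \<phi> \<Longrightarrow> polyfun (\<lambda>z. \<phi> z ^ n)"
  unfolding polyfun_def by (metis poly_power)

lemma polyfun_prod_list: "(\<And>a. a \<in> set xs \<Longrightarrow> polyfun (f a)) \<Longrightarrow> polyfun (\<lambda>z. \<Prod>a\<leftarrow>xs. f a z)"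
  by (induction xs) (auto intro: polyfun_const polyfun_mult)

lemma polyfun_eqI:
  assumes "polyfun \<phi>" "polyfun \<psi>" "finite {z. \<phi> z \<noteq> \<psi> z}"
  shows "\<phi> z = \<psi> z"
proof (rule ccontr)
  assume "\<phi> z \<noteq> \<psi> z"
  then have "finite {z. \<phi> z - \<psi> z = 0}"
    by (intro polyfun_zero_or_finite[OF polyfun_diff[OF assms(1,2)], of z]) simp
  then have "finite ({z. \<phi> z = \<psi> z} \<union> {z. \<phi> z \<noteq> \<psi> z})"
    using assms(3) by simp
  moreover have "{z. \<phi> z = \<psi> z} \<union> {z. \<phi> z \<noteq> \<psi> z} = UNIV" by auto
  ultimately show False
    using infinite_UNIV_char_0[where 'a = complex] by metis
qed

section \<open>The resultant of a pencil of pairs of polynomials\<close>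

lemma polyfun_resultant_sub:
  "polyfun (\<lambda>z. resultant_sub m n (f + Polynomial.smult z f') (g + Polynomial.smult z g'))"
proof -
  let ?h = "map_poly (\<lambda>c. [:c:]) :: complex poly \<Rightarrow> complex poly poly"
  let ?T = "[:0, 1:] :: complex poly"
  have "resultant_sub m n (f + Polynomial.smult z f') (g + Polynomial.smult z g')
      = poly (resultant_sub m n (?h f + Polynomial.smult ?T (?h f')) (?h g + Polynomial.smult ?T (?h g'))) z" for z
  proof -
    have hom: "comm_ring_hom (\<lambda>p :: complex poly. poly p z)" by unfold_locales auto
    have *: "map_poly (\<lambda>p. poly p z) (?h f + Polynomial.smult ?T (?h f')) = f + Polynomial.smult z f'" for f f'
      by (rule poly_eqI) (simp add: coeff_map_poly)
    show ?thesis
      unfolding resultant_sub_def comm_ring_hom.hom_det[OF hom, symmetric] sylvester_mat_sub_map[of "\<lambda>p. poly p z", OF poly_0] * ..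
  qed
  then show ?thesis by (auto simp: polyfun_def)
qed

lemma resultant_sub_exact:
  "degree f = m \<Longrightarrow> degree g = n \<Longrightarrow> resultant_sub m n f g = resultant f g"
  by (simp add: resultant_sub)

lemma degree_perturb:
  assumes "degree (f :: complex poly) \<le> n"
  shows "finite {z. degree (f + Polynomial.smult z (monom 1 n)) \<noteq> n}"
proof -
  have "degree (f + Polynomial.smult z (monom 1 n)) = n" if "z \<noteq> - coeff f n" for z
  proof (rule antisym)
    show "degree (f + Polynomial.smult z (monom 1 n)) \<le> n"
      using assms by (intro degree_add_le) (auto simp: degree_monom_le intro: order_trans[OF degree_smult_le])
    have "coeff (f + Polynomial.smult z (monom 1 n)) n \<noteq> 0"
      using that by (simp add: add_eq_0_iff)
    then show "n \<le> degree (f + Polynomial.smult z (monom 1 n))"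
      by (rule le_degree)
  qed
  then have "{z. degree (f + Polynomial.smult z (monom 1 n)) \<noteq> n} \<subseteq> {- coeff f n}" by auto
  then show ?thesis by (rule finite_subset) simp
qed

text \<open>
  Adding \<open>z X ^ n\<close> makes a formal degree \<open>n\<close> exact for all but one \<open>z\<close>, and both sides of the
  identities below are polynomials in \<open>z\<close>; so the case of exact degrees suffices.
\<close>

lemma resultant_sub_swap:
  assumes "degree f \<le> m" "degree g \<le> n"
  shows "resultant_sub m n f g = (-1) ^ (m * n) * resultant_sub n m (g :: complex poly) f"
proof -
  let ?f = "\<lambda>z. f + Polynomial.smult z (monom 1 m)" and ?g = "\<lambda>z. g + Polynomial.smult z (monom 1 n)"
  have "resultant_sub m n (?f 0) (?g 0) = (-1) ^ (m * n) * resultant_sub n m (?g 0) (?f 0)"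
  proof (rule polyfun_eqI[of "\<lambda>z. resultant_sub m n (?f z) (?g z)"])
    have "{z. resultant_sub m n (?f z) (?g z) \<noteq> (-1) ^ (m * n) * resultant_sub n m (?g z) (?f z)}
        \<subseteq> {z. degree (?f z) \<noteq> m} \<union> {z. degree (?g z) \<noteq> n}"
      using resultant_swap[of "?f z" "?g z" for z] by (force simp: resultant_sub_exact)
    then show "finite {z. resultant_sub m n (?f z) (?g z) \<noteq> (-1) ^ (m * n) * resultant_sub n m (?g z) (?f z)}"
      by (rule finite_subset) (simp add: degree_perturb assms)
  qed (intro polyfun_mult polyfun_const polyfun_resultant_sub)+
  then show ?thesis by simp
qed

lemma resultant_sub_eq_prod_roots:
  assumes "f \<noteq> 0" "degree f = m" "degree g \<le> n" "f = Polynomial.smult (lead_coeff f) (linear_factors as)"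
  shows "resultant_sub m n f g = lead_coeff f ^ n * (\<Prod>a\<leftarrow>as. poly g a)"
proof -
  let ?g = "\<lambda>z. g + Polynomial.smult z (monom 1 n)"
  have "resultant_sub m n (f + Polynomial.smult 0 0) (?g 0) = lead_coeff f ^ n * (\<Prod>a\<leftarrow>as. poly (?g 0) a)"
  proof (rule polyfun_eqI[of "\<lambda>z. resultant_sub m n (f + Polynomial.smult z 0) (?g z)"])
    have "{z. resultant_sub m n (f + Polynomial.smult z 0) (?g z) \<noteq> lead_coeff f ^ n * (\<Prod>a\<leftarrow>as. poly (?g z) a)}
        \<subseteq> {z. degree (?g z) \<noteq> n} \<union> {z. ?g z = 0}"
      using resultant_eq_prod_roots[OF assms(1) _ assms(4)] assms(2) by (auto simp: resultant_sub_exact)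
    moreover have "z = - coeff g n" if "?g z = 0" for z
    proof -
      have "coeff (?g z) n = 0" unfolding that by simp
      then show ?thesis by (simp add: add_eq_0_iff)
    qed
    then have "{z. ?g z = 0} \<subseteq> {- coeff g n}" by auto
    then have "finite {z. ?g z = 0}" by (rule finite_subset) simp
    ultimately show "finite {z. resultant_sub m n (f + Polynomial.smult z 0) (?g z)
        \<noteq> lead_coeff f ^ n * (\<Prod>a\<leftarrow>as. poly (?g z) a)}"
      using degree_perturb[OF assms(3)] by (auto intro: finite_subset)
    have "polyfun (\<lambda>z. poly g a + z * a ^ n)" for a
      by (rule polyfun_affine)
    then show "polyfun (\<lambda>z. lead_coeff f ^ n * (\<Prod>a\<leftarrow>as. poly (?g z) a))"
      by (intro polyfun_mult polyfun_const polyfun_prod_list) (simp add: poly_monom)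
  qed (rule polyfun_resultant_sub)
  then show ?thesis by simp
qed

lemma resultant_sub_eq_0_iff:
  assumes "degree f \<le> m" "degree g \<le> n" "coeff f m \<noteq> 0 \<or> coeff g n \<noteq> 0"
  shows "resultant_sub m n f g = 0 \<longleftrightarrow> (\<exists>z::complex. poly f z = 0 \<and> poly g z = 0)"
proof -
  have *: "resultant_sub m n f g = 0 \<longleftrightarrow> (\<exists>z::complex. poly f z = 0 \<and> poly g z = 0)"
    if "degree f \<le> m" "degree g \<le> n" "coeff f m \<noteq> 0" for f g m n
  proof -
    have df: "degree f = m" using that(1,3) by (metis le_antisym le_degree)
    have f0: "f \<noteq> 0" using that(3) by auto
    obtain as where as: "f = Polynomial.smult (lead_coeff f) (linear_factors as)"
      by (metis exists_linear_factors)
    show ?thesis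
      using resultant_sub_eq_prod_roots[OF f0 df that(2) as] f0 poly_zero_iff_mem_roots[OF as f0]
      by (auto simp: prod_list_zero_iff)
  qed
  show ?thesis
  proof (cases "coeff f m = 0")
    case True
    with assms have "resultant_sub n m g f = 0 \<longleftrightarrow> (\<exists>z. poly g z = 0 \<and> poly f z = 0)"
      by (intro *) auto
    then show ?thesis
      using resultant_sub_swap[OF assms(1,2)] by auto
  qed (use * assms in blast)
qed

text \<open>
  A common root \<open>t\<close> of \<open>f1 + s g1\<close> and \<open>f2 + s g2\<close> is a root of \<open>q = f1 g2 - f2 g1\<close>, which does
  not involve \<open>s\<close>, and satisfies \<open>f1 t + s g1 t = 0\<close>. To get the multiplicities right, the
  products over the roots of \<open>A = f1 + s g1\<close> are exchanged for products over the roots of \<open>g1\<close> and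
  of \<open>q\<close>, using \<open>q = A g2 - B g1\<close> with \<open>B = f2 + s g2\<close>.
\<close>

theorem resultant_pencil:
  fixes f1 f2 g1 g2 :: "complex poly"
  defines "q \<equiv> f1 * g2 - f2 * g1"
  assumes deg: "degree f1 \<le> m" "degree f2 \<le> n" "degree g1 \<le> m" "degree g2 \<le> n"
    and g1: "coeff g1 m \<noteq> 0" and q: "coeff q (m + n) \<noteq> 0" "q = Polynomial.smult (lead_coeff q) (linear_factors ts)"
    and coprime: "\<And>z. poly f1 z = 0 \<Longrightarrow> poly g1 z \<noteq> 0"
  shows "\<exists>C. C \<noteq> 0 \<and>
    (\<forall>s. resultant_sub m n (f1 + Polynomial.smult s g1) (f2 + Polynomial.smult s g2) = C * (\<Prod>t\<leftarrow>ts. poly f1 t + s * poly g1 t))"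
proof -
  have dg1: "degree g1 = m" using deg g1 by (metis le_antisym le_degree)
  have "g1 \<noteq> 0" using g1 by auto
  have "degree q \<le> m + n"
    unfolding q_def using deg
    by (intro degree_diff_le order_trans[OF degree_mult_le]) auto
  then have dq: "degree q = m + n" using q(1) by (metis le_antisym le_degree)
  have "q \<noteq> 0" using q(1) by auto
  have lts: "length ts = m + n"
    using q(2) \<open>q \<noteq> 0\<close> dq by (metis degree_linear_factors_list degree_smult_eq leading_coeff_0_iff)
  obtain bs where bs: "g1 = Polynomial.smult (lead_coeff g1) (linear_factors bs)" "length bs = m"
    using dg1 by (metis exists_linear_factors)
  \<comment> \<open>Up to a power of the leading coefficient of \<open>A\<close>, this is the product of \<open>g1\<close> over the roots of \<open>A\<close>.\<close>
  define K where "K = (-1) ^ (m * m) * (lead_coeff g1 ^ m * (\<Prod>b\<leftarrow>bs. poly f1 b))"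
  have "K \<noteq> 0"
    using \<open>g1 \<noteq> 0\<close> coprime poly_zero_iff_mem_roots[OF bs(1) \<open>g1 \<noteq> 0\<close>]
    by (auto simp: K_def prod_list_zero_iff)
  define L where "L = (-1) ^ m * ((-1) ^ (m * (m + n)) * lead_coeff q ^ m)"
  have "L \<noteq> 0" using \<open>q \<noteq> 0\<close> by (simp add: L_def)
  let ?P = "\<lambda>s. \<Prod>t\<leftarrow>ts. poly f1 t + s * poly g1 t"
  let ?R = "\<lambda>s. resultant_sub m n (f1 + Polynomial.smult s g1) (f2 + Polynomial.smult s g2)"
  have main: "?R s * K = L * ?P s" if s: "s \<noteq> - (coeff f1 m / coeff g1 m)" for s
  proof -
    define A where "A = f1 + Polynomial.smult s g1"
    define B where "B = f2 + Polynomial.smult s g2"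
    have "coeff A m \<noteq> 0"
      using s g1 by (auto simp: A_def field_simps add_eq_0_iff)
    moreover have "degree A \<le> m" "degree B \<le> n"
      unfolding A_def B_def using deg
      by (auto intro!: degree_add_le intro: order_trans[OF degree_smult_le])
    ultimately have A: "degree A = m" "A \<noteq> 0" and B: "degree B \<le> n"
      by (auto intro: le_antisym le_degree)
    obtain as where as: "A = Polynomial.smult (lead_coeff A) (linear_factors as)" "length as = m"
      using A by (metis exists_linear_factors)
    define c where "c = lead_coeff A"
    have q_eq: "q = A * g2 - B * g1"
      by (simp add: q_def A_def B_def algebra_simps)
    have "poly q a = - (poly B a * poly g1 a)" if "a \<in> set as" for a
      using poly_zero_iff_mem_roots[OF as(1) A(2), of a] that by (simp add: q_eq)
    then have "(\<Prod>a\<leftarrow>as. poly q a) = (\<Prod>a\<leftarrow>as. - (poly B a * poly g1 a))"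
      by (metis (mono_tags, lifting) map_eq_conv)
    then have prod_q: "(\<Prod>a\<leftarrow>as. poly q a) = (-1) ^ m * ((\<Prod>a\<leftarrow>as. poly B a) * (\<Prod>a\<leftarrow>as. poly g1 a))"
      by (simp add: prod_list_uminus prod_list_multf as(2))
    have "poly A b = poly f1 b" if "b \<in> set bs" for b
      using poly_zero_iff_mem_roots[OF bs(1) \<open>g1 \<noteq> 0\<close>, of b] that by (simp add: A_def)
    then have "(\<Prod>b\<leftarrow>bs. poly A b) = (\<Prod>b\<leftarrow>bs. poly f1 b)"
      by (metis (mono_tags, lifting) map_eq_conv)
    then have K: "c ^ m * (\<Prod>a\<leftarrow>as. poly g1 a) = K"
      using prod_roots_swap[OF as(1) bs(1)] by (simp add: c_def K_def as(2) bs(2))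
    have P: "c ^ (m + n) * (\<Prod>a\<leftarrow>as. poly q a) = (-1) ^ (m * (m + n)) * (lead_coeff q ^ m * ?P s)"
      using prod_roots_swap[OF as(1) q(2)] by (simp add: c_def as(2) lts A_def)
    have "?R s = c ^ n * (\<Prod>a\<leftarrow>as. poly B a)"
      using resultant_sub_eq_prod_roots[OF A(2,1) B as(1)] by (simp add: A_def B_def c_def)
    then have "?R s * K = (c ^ n * c ^ m) * ((\<Prod>a\<leftarrow>as. poly B a) * (\<Prod>a\<leftarrow>as. poly g1 a))"
      by (simp add: K[symmetric] mult_ac)
    also have "\<dots> = (-1) ^ m * (c ^ (m + n) * (\<Prod>a\<leftarrow>as. poly q a))"
    proof -
      have sgn: "(-1) ^ m * (-1) ^ m = (1 :: complex)"
        by (simp flip: power_mult_distrib)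
      have "(-1) ^ m * (c ^ (m + n) * (\<Prod>a\<leftarrow>as. poly q a))
          = ((-1) ^ m * (-1) ^ m) * ((c ^ n * c ^ m) * ((\<Prod>a\<leftarrow>as. poly B a) * (\<Prod>a\<leftarrow>as. poly g1 a)))"
        unfolding prod_q power_add by (simp only: mult_ac)
      then show ?thesis unfolding sgn by simp
    qed
    also have "\<dots> = L * ?P s"
      unfolding P L_def by (simp only: mult_ac)
    finally show ?thesis .
  qed
  have "?R s * K = L * ?P s" for s
  proof (rule polyfun_eqI[of "\<lambda>s. ?R s * K"])
    have "{s. ?R s * K \<noteq> L * ?P s} \<subseteq> {- (coeff f1 m / coeff g1 m)}"
      using main by blast
    then show "finite {s. ?R s * K \<noteq> L * ?P s}"
      by (rule finite_subset) simp
  qed (intro polyfun_mult polyfun_const polyfun_resultant_sub polyfun_prod_list polyfun_affine)+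
  then have "?R s = L / K * ?P s" for s
    using \<open>K \<noteq> 0\<close> by (simp add: field_simps)
  then show ?thesis
    using \<open>K \<noteq> 0\<close> \<open>L \<noteq> 0\<close> by (intro exI[of _ "L / K"]) simp
qed

lemma distinct_simple_roots:
  assumes "\<And>t. t \<in> set ts \<Longrightarrow> P t \<Longrightarrow> poly (pderiv (linear_factors ts)) t \<noteq> 0"
  shows "distinct (filter P ts)"
  using assms
proof (induction ts)
  case (Cons a as)
  have pd: "poly (pderiv (linear_factors (a # as))) t
      = poly (linear_factors as) t + (t - a) * poly (pderiv (linear_factors as)) t" for t
    unfolding linear_factors_simps pderiv_mult poly_add poly_mult
    by (simp add: pderiv_pCons algebra_simps)
  have root: "poly (linear_factors as) t = 0 \<longleftrightarrow> t \<in> set as" for t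
    by (rule poly_zero_iff_mem_roots[of _ 1]) auto
  have "distinct (filter P as)"
    using Cons.prems pd root by (intro Cons.IH) (metis add_0 list.set_intros(2) mult_zero_right)
  moreover have "a \<notin> set as" if "P a"
    using Cons.prems[of a] that pd[of a] root[of a] by auto
  ultimately show ?case by auto
qed simp

text \<open>
  In the product over the roots \<open>t\<close> of \<open>q\<close>, the factor \<open>f1 t + s g1 t\<close> vanishes at \<open>s = 0\<close>, and then
  to first order, exactly if \<open>t\<close> is a common root of \<open>f1\<close> and \<open>f2\<close>. Simplicity makes the list of
  these roots distinct, so that counting factors counts common roots.
\<close>

lemma resultant_pencil_order:
  fixes f1 f2 g1 g2 :: "complex poly"
  defines "q \<equiv> f1 * g2 - f2 * g1"
  assumes deg: "degree f1 \<le> m" "degree f2 \<le> n" "degree g1 \<le> m" "degree g2 \<le> n"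
    and g1: "coeff g1 m \<noteq> 0" and q: "coeff q (m + n) \<noteq> 0"
    and coprime: "\<And>z. poly f1 z = 0 \<Longrightarrow> poly g1 z \<noteq> 0"
    and simple: "\<And>t. poly f1 t = 0 \<Longrightarrow> poly f2 t = 0 \<Longrightarrow> poly (pderiv q) t \<noteq> 0"
  shows "\<exists>\<psi>. polyfun \<psi> \<and> \<psi> 0 \<noteq> 0 \<and>
    (\<forall>s. resultant_sub m n (f1 + Polynomial.smult s g1) (f2 + Polynomial.smult s g2)
       = s ^ card {t. poly f1 t = 0 \<and> poly f2 t = 0} * \<psi> s)"
proof -
  obtain ts where ts: "q = Polynomial.smult (lead_coeff q) (linear_factors ts)"
    using exists_linear_factors by metis
  have "q \<noteq> 0" using q by auto
  obtain C where C: "C \<noteq> 0" and R: "\<And>s. resultant_sub m n (f1 + Polynomial.smult s g1) (f2 + Polynomial.smult s g2)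
      = C * (\<Prod>t\<leftarrow>ts. poly f1 t + s * poly g1 t)"
    using resultant_pencil[OF deg g1 q[unfolded q_def] ts[unfolded q_def] coprime] by auto
  let ?P = "\<lambda>t. poly f1 t = 0"
  let ?h = "\<lambda>s t. if ?P t then poly g1 t else poly f1 t + s * poly g1 t"
  have split: "(\<Prod>t\<leftarrow>us. poly f1 t + s * poly g1 t) = s ^ length (filter ?P us) * (\<Prod>t\<leftarrow>us. ?h s t)" for s us
    by (induction us) auto
  have root: "poly q t = 0 \<longleftrightarrow> t \<in> set ts" for t
    by (rule poly_zero_iff_mem_roots[OF ts \<open>q \<noteq> 0\<close>])
  have set: "set (filter ?P ts) = {t. poly f1 t = 0 \<and> poly f2 t = 0}"
    using coprime by (auto simp: root[symmetric] q_def)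
  have "distinct (filter ?P ts)"
  proof (rule distinct_simple_roots)
    fix t assume "t \<in> set ts" "?P t"
    then have "poly (pderiv q) t \<noteq> 0"
      using set simple by auto
    then show "poly (pderiv (linear_factors ts)) t \<noteq> 0"
      by (subst (asm) ts) (simp add: pderiv_smult)
  qed
  then have len: "length (filter ?P ts) = card {t. poly f1 t = 0 \<and> poly f2 t = 0}"
    using distinct_card set by fastforce
  have "polyfun (\<lambda>s. ?h s t)" for t
    by (cases "?P t") (auto intro: polyfun_const polyfun_affine)
  then have "polyfun (\<lambda>s. C * (\<Prod>t\<leftarrow>ts. ?h s t))"
    by (intro polyfun_mult polyfun_const polyfun_prod_list)
  moreover have "C * (\<Prod>t\<leftarrow>ts. ?h 0 t) \<noteq> 0"
    using C coprime by (auto simp: prod_list_zero_iff)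
  ultimately show ?thesis
    by (intro exI[of _ "\<lambda>s. C * (\<Prod>t\<leftarrow>ts. ?h s t)"]) (simp add: R split len)
qed

section \<open>Linear algebra of pairs of vectors\<close>

definition dot5 :: "(nat \<Rightarrow> 'a::comm_ring_1) \<Rightarrow> (nat \<Rightarrow> 'a) \<Rightarrow> 'a" where
  "dot5 a x = (\<Sum>i<5. a i * x i)"

definition plucker_coord :: "(nat \<Rightarrow> 'a::comm_ring_1) \<Rightarrow> (nat \<Rightarrow> 'a) \<Rightarrow> nat \<Rightarrow> nat \<Rightarrow> 'a" where
  "plucker_coord a b i j = a i * b j - a j * b i"

definition perp :: "(nat \<Rightarrow> 'a::comm_ring_1) \<Rightarrow> (nat \<Rightarrow> 'a) \<Rightarrow> (nat \<Rightarrow> 'a) set" where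
  "perp a b = {x. dot5 a x = 0 \<and> dot5 b x = 0}"

definition indep5 :: "(nat \<Rightarrow> 'a::comm_ring_1) \<Rightarrow> (nat \<Rightarrow> 'a) \<Rightarrow> bool" where
  "indep5 a b \<longleftrightarrow> (\<exists>i<5. \<exists>j<5. plucker_coord a b i j \<noteq> 0)"

abbreviation unit5 :: "nat \<Rightarrow> nat \<Rightarrow> 'a::zero_neq_one" where
  "unit5 i \<equiv> (\<lambda>k. if k = i then 1 else 0)"

lemma dot5_add_smult: "dot5 a (\<lambda>i. u i + z * v i) = dot5 a u + z * dot5 a v"
  by (simp add: dot5_def distrib_left sum.distrib sum_distrib_left mult_ac)

lemma dot5_unit: "i < 5 \<Longrightarrow> dot5 a (unit5 i) = a i"
  by (simp add: dot5_def if_distrib[of "\<lambda>x. a _ * x"] cong: if_cong)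

lemma dot5_lin: "(\<And>k. k < 5 \<Longrightarrow> c k = \<alpha> * a k + \<beta> * b k) \<Longrightarrow> dot5 c x = \<alpha> * dot5 a x + \<beta> * dot5 b x"
  by (simp add: dot5_def distrib_left sum.distrib sum_distrib_left algebra_simps)

lemma plucker_coord_contract:
  "(\<Sum>k<5. x k * plucker_coord a b k l) = dot5 a x * b l - dot5 b x * a l"
  by (simp add: dot5_def plucker_coord_def sum_distrib_right sum_distrib_left sum_subtractf algebra_simps)

text \<open>
  \<open>project5 a b i j\<close> maps every vector into the common kernel of \<open>a\<close> and \<open>b\<close>, and it multiplies the
  elements of the kernel by the Pluecker coordinate \<open>[i,j]\<close>. Its entries are polynomials in those of
  \<open>a\<close> and \<open>b\<close>, so it moves points along a family of kernels.
\<close>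

definition project5 :: "(nat \<Rightarrow> 'a::comm_ring_1) \<Rightarrow> (nat \<Rightarrow> 'a) \<Rightarrow> nat \<Rightarrow> nat \<Rightarrow> (nat \<Rightarrow> 'a) \<Rightarrow> nat \<Rightarrow> 'a" where
  "project5 a b i j x = (\<lambda>k. plucker_coord a b i j * x k
     + (dot5 b x * a j - dot5 a x * b j) * unit5 i k + (dot5 a x * b i - dot5 b x * a i) * unit5 j k)"

lemma dot5_project5:
  assumes "i < 5" "j < 5"
  shows "dot5 c (project5 a b i j x) = plucker_coord a b i j * dot5 c x
     + (dot5 b x * a j - dot5 a x * b j) * c i + (dot5 a x * b i - dot5 b x * a i) * c j"
proof -
  have "dot5 c (project5 a b i j x) = dot5 c (\<lambda>k. (0 + plucker_coord a b i j * x k)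
     + (dot5 b x * a j - dot5 a x * b j) * unit5 i k + (dot5 a x * b i - dot5 b x * a i) * unit5 j k)"
    by (simp add: project5_def)
  also have "\<dots> = plucker_coord a b i j * dot5 c x
     + (dot5 b x * a j - dot5 a x * b j) * c i + (dot5 a x * b i - dot5 b x * a i) * c j"
    unfolding dot5_add_smult dot5_unit[OF assms(1)] dot5_unit[OF assms(2)] by (simp add: dot5_def)
  finally show ?thesis .
qed

lemma project5_in_perp:
  assumes "i < 5" "j < 5"
  shows "project5 a b i j x \<in> perp a b"
  unfolding perp_def by (simp add: dot5_project5[OF assms] plucker_coord_def algebra_simps)

lemma project5_perp:
  assumes "x \<in> perp a b"
  shows "project5 a b i j x = (\<lambda>k. plucker_coord a b i j * x k)"
  using assms by (simp add: project5_def perp_def)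

lemma span_if_perp:
  fixes a b c :: "nat \<Rightarrow> 'a::field"
  assumes "indep5 a b" "\<And>x. x \<in> perp a b \<Longrightarrow> dot5 c x = 0"
  shows "\<exists>\<alpha> \<beta>. \<forall>k<5. c k = \<alpha> * a k + \<beta> * b k"
proof -
  obtain i j where ij: "i < 5" "j < 5" "plucker_coord a b i j \<noteq> 0"
    using assms(1) by (auto simp: indep5_def)
  let ?p = "plucker_coord a b i j"
  have "c k = (b j * c i - b i * c j) / ?p * a k + (a i * c j - a j * c i) / ?p * b k" if "k < 5" for k
  proof -
    have "dot5 c (project5 a b i j (unit5 k)) = 0"
      by (rule assms(2)) (rule project5_in_perp[OF ij(1,2)])
    then have eq: "?p * c k = (b j * c i - b i * c j) * a k + (a i * c j - a j * c i) * b k"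
      unfolding dot5_project5[OF ij(1,2)] dot5_unit[OF that] by (simp add: algebra_simps)
    have "c k = ((b j * c i - b i * c j) * a k + (a i * c j - a j * c i) * b k) / ?p"
      by (subst nonzero_eq_divide_eq[OF ij(3)]) (simp only: mult.commute[of "c k"] eq)
    then show ?thesis by (simp add: add_divide_distrib)
  qed
  then show ?thesis by blast
qed

lemma plucker_coord_lin:
  fixes a b :: "nat \<Rightarrow> 'a::comm_ring_1"
  assumes "\<And>k. k < 5 \<Longrightarrow> a' k = \<alpha> * a k + \<beta> * b k" "\<And>k. k < 5 \<Longrightarrow> b' k = \<gamma> * a k + \<delta> * b k"
    and "k < 5" "l < 5"
  shows "plucker_coord a' b' k l = (\<alpha> * \<delta> - \<beta> * \<gamma>) * plucker_coord a b k l"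
  using assms by (simp add: plucker_coord_def algebra_simps)

lemma perp_subset_if_proportional:
  fixes a b a' b' :: "nat \<Rightarrow> 'a::field"
  assumes "indep5 a' b'"
    and prp: "\<And>k l. k < 5 \<Longrightarrow> l < 5 \<Longrightarrow> plucker_coord a' b' k l = \<delta> * plucker_coord a b k l"
  shows "perp a b \<subseteq> perp a' b'"
proof
  fix x assume x: "x \<in> perp a b"
  obtain i j where ij: "i < 5" "j < 5" "plucker_coord a' b' i j \<noteq> 0"
    using assms(1) by (auto simp: indep5_def)
  have *: "dot5 a' x * b' l = dot5 b' x * a' l" if "l < 5" for l
  proof -
    have "dot5 a' x * b' l - dot5 b' x * a' l = (\<Sum>k<5. x k * plucker_coord a' b' k l)"
      by (simp add: plucker_coord_contract)
    also have "\<dots> = \<delta> * (\<Sum>k<5. x k * plucker_coord a b k l)"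
      using that by (simp add: prp sum_distrib_left mult_ac)
    also have "\<dots> = 0"
      using x by (simp add: plucker_coord_contract perp_def)
    finally show ?thesis by simp
  qed
  have "dot5 a' x * plucker_coord a' b' i j = a' i * (dot5 a' x * b' j) - a' j * (dot5 a' x * b' i)"
    by (simp add: plucker_coord_def algebra_simps)
  also have "\<dots> = 0" using *[OF ij(1)] *[OF ij(2)] by (simp add: algebra_simps)
  finally have "dot5 a' x = 0" using ij(3) by simp
  moreover have "dot5 b' x * plucker_coord a' b' i j = b' j * (dot5 b' x * a' i) - b' i * (dot5 b' x * a' j)"
    by (simp add: plucker_coord_def algebra_simps)
  then have "dot5 b' x * plucker_coord a' b' i j = 0"
    unfolding *[OF ij(1), symmetric] *[OF ij(2), symmetric] by (simp add: algebra_simps)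
  then have "dot5 b' x = 0" using ij(3) by simp
  ultimately show "x \<in> perp a' b'" by (simp add: perp_def)
qed

lemma proportional_if_perp_subset:
  fixes a b a' b' :: "nat \<Rightarrow> 'a::field"
  assumes "indep5 a b" "indep5 a' b'" "perp a b \<subseteq> perp a' b'"
  shows "\<exists>\<delta>. \<delta> \<noteq> 0 \<and> (\<forall>k<5. \<forall>l<5. plucker_coord a' b' k l = \<delta> * plucker_coord a b k l)"
proof -
  obtain \<alpha> \<beta> where a': "\<And>k. k < 5 \<Longrightarrow> a' k = \<alpha> * a k + \<beta> * b k"
    using span_if_perp[OF assms(1), of a'] assms(3) by (auto simp: perp_def)
  obtain \<gamma> \<delta> where b': "\<And>k. k < 5 \<Longrightarrow> b' k = \<gamma> * a k + \<delta> * b k"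
    using span_if_perp[OF assms(1), of b'] assms(3) by (auto simp: perp_def)
  note p = plucker_coord_lin[of a' \<alpha> a \<beta> b b' \<gamma> \<delta>, OF a' b']
  have "\<alpha> * \<delta> - \<beta> * \<gamma> \<noteq> 0"
    using assms(2) p by (auto simp: indep5_def)
  with p show ?thesis by blast
qed

lemma perp_eq_if_subset:
  fixes a b a' b' :: "nat \<Rightarrow> 'a::field"
  assumes "indep5 a b" "indep5 a' b'" "perp a b \<subseteq> perp a' b'"
  shows "perp a b = perp a' b'"
proof -
  obtain \<delta> where "\<delta> \<noteq> 0" "\<And>k l. k < 5 \<Longrightarrow> l < 5 \<Longrightarrow> plucker_coord a' b' k l = \<delta> * plucker_coord a b k l"
    using proportional_if_perp_subset[OF assms] by blast
  then have "perp a' b' \<subseteq> perp a b"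
    by (intro perp_subset_if_proportional[OF assms(1), where \<delta> = "inverse \<delta>"]) simp
  with assms(3) show ?thesis by blast
qed

section \<open>Generic points of a linear space\<close>

text \<open>
  The functions that are polynomial on every line contain all polynomial functions and are closed
  under products. If two of them do not vanish identically on a space \<open>V\<close>, some point of \<open>V\<close>
  is a zero of neither: it lies on the line through a nonzero of the one and a nonzero of the other.
\<close>

definition linewise_poly :: "((nat \<Rightarrow> complex) \<Rightarrow> complex) \<Rightarrow> bool" where
  "linewise_poly \<Phi> \<longleftrightarrow> (\<forall>u v. polyfun (\<lambda>z. \<Phi> (\<lambda>i. u i + z * v i)))"

definition line_closed :: "(nat \<Rightarrow> complex) set \<Rightarrow> bool" where
  "line_closed V \<longleftrightarrow> (\<forall>u\<in>V. \<forall>v\<in>V. \<forall>z. (\<lambda>i. u i + z * v i) \<in> V)"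

lemma linewise_polyD: "linewise_poly \<Phi> \<Longrightarrow> polyfun (\<lambda>z. \<Phi> (\<lambda>i. u i + z * v i))"
  by (simp add: linewise_poly_def)

lemma linewise_poly_dot5: "linewise_poly (dot5 a)"
  by (simp add: linewise_poly_def dot5_add_smult polyfun_affine)

lemma linewise_poly_mult: "linewise_poly \<Phi> \<Longrightarrow> linewise_poly \<Psi> \<Longrightarrow> linewise_poly (\<lambda>x. \<Phi> x * \<Psi> x)"
  by (simp add: linewise_poly_def polyfun_mult)

lemma linewise_poly_const: "linewise_poly (\<lambda>x. c)"
  by (simp add: linewise_poly_def polyfun_const)

lemma linewise_poly_prod:
  assumes "finite I" "\<And>i. i \<in> I \<Longrightarrow> linewise_poly (\<Phi> i)"
  shows "linewise_poly (\<lambda>x. \<Prod>i\<in>I. \<Phi> i x)"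
  using assms by (induction I rule: finite_induct) (auto intro: linewise_poly_const linewise_poly_mult)

lemma line_closed_perp: "line_closed (perp a b)"
  by (simp add: line_closed_def perp_def dot5_add_smult)

lemma line_closed_UNIV: "line_closed UNIV"
  by (simp add: line_closed_def)

lemma generic_point_two:
  assumes V: "line_closed V" and lin: "linewise_poly \<Phi>" "linewise_poly \<Psi>"
    and u: "u \<in> V" "\<Phi> u \<noteq> 0" and v: "v \<in> V" "\<Psi> v \<noteq> 0"
  shows "\<exists>x\<in>V. \<Phi> x \<noteq> 0 \<and> \<Psi> x \<noteq> 0"
proof -
  define w where "w = (\<lambda>i. v i + (-1) * u i)"
  have "w \<in> V" using V u v unfolding w_def line_closed_def by blast
  let ?x = "\<lambda>z i. u i + z * w i"
  have x: "?x z \<in> V" for z using V u(1) \<open>w \<in> V\<close> by (simp add: line_closed_def)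
  have "finite {z. \<Phi> (?x z) = 0}"
    using u by (intro polyfun_zero_or_finite[of _ 0] linewise_polyD lin) simp
  moreover have "finite {z. \<Psi> (?x z) = 0}"
    using v by (intro polyfun_zero_or_finite[of _ 1] linewise_polyD lin) (simp add: w_def)
  ultimately have "finite ({z. \<Phi> (?x z) = 0} \<union> {z. \<Psi> (?x z) = 0})" by simp
  then obtain z where "z \<notin> {z. \<Phi> (?x z) = 0} \<union> {z. \<Psi> (?x z) = 0}"
    using ex_new_if_finite[OF infinite_UNIV_char_0[where 'a = complex]] by blast
  with x show ?thesis by auto
qed

lemma generic_point:
  assumes V: "line_closed V" "v \<in> V" and "finite I"
    and "\<And>\<Phi>. \<Phi> \<in> I \<Longrightarrow> linewise_poly \<Phi> \<and> (\<exists>x\<in>V. \<Phi> x \<noteq> 0)"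
  shows "\<exists>x\<in>V. \<forall>\<Phi>\<in>I. \<Phi> x \<noteq> 0"
proof -
  have "\<exists>x\<in>V. (\<Prod>\<Phi>\<in>I. \<Phi> x) \<noteq> 0"
    using \<open>finite I\<close> assms(4)
  proof (induction I rule: finite_induct)
    case (insert \<Phi> I)
    have "linewise_poly (\<lambda>x. \<Prod>\<Phi>\<in>I. \<Phi> x)"
      by (rule linewise_poly_prod) (use insert in auto)
    moreover have "\<exists>x\<in>V. (\<Prod>\<Phi>\<in>I. \<Phi> x) \<noteq> 0"
      using insert by auto
    ultimately have "\<exists>x\<in>V. \<Phi> x \<noteq> 0 \<and> (\<Prod>\<Phi>\<in>I. \<Phi> x) \<noteq> 0"
      using insert.prems[of \<Phi>] generic_point_two[OF V(1), of \<Phi>] by blast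
    then show ?case using insert.hyps by auto
  qed (use V in auto)
  then show ?thesis using \<open>finite I\<close> by (auto simp: prod_zero_iff)
qed

text \<open>
  The restriction of \<open>F\<close> to the line through \<open>x\<close> in the direction \<open>a\<close>. Its linear coefficient is the
  derivative of \<open>F\<close> at \<open>x\<close> in that direction.
\<close>

definition line_poly :: "real mpol \<Rightarrow> (nat \<Rightarrow> complex) \<Rightarrow> (nat \<Rightarrow> complex) \<Rightarrow> complex poly" where
  "line_poly F x a = mpol_subst (\<lambda>r. [:of_real r:]) (\<lambda>i. [:x i, a i:]) F"

lemma const_of_real_hom: "comm_ring_hom (\<lambda>r. [:of_real r:] :: complex poly)"
  by (rule comm_ring_hom_comp[OF const_poly_hom comm_ring_hom_of_real])

lemma comm_ring_hom_poly: "comm_ring_hom (\<lambda>p::'a::comm_ring_1 poly. poly p z)"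
  by unfold_locales auto

lemma poly_line_poly: "poly (line_poly F x a) s = complex_eval F (\<lambda>i. x i + s * a i)"
  unfolding line_poly_def hom_mpol_subst[OF comm_ring_hom_poly const_of_real_hom] by simp

lemma linewise_poly_complex_eval: "linewise_poly (complex_eval F)"
  unfolding linewise_poly_def polyfun_def by (metis poly_line_poly)

lemma linewise_poly_derivative: "linewise_poly (\<lambda>a. coeff (line_poly F x a) 1)"
  unfolding linewise_poly_def
proof (intro allI)
  fix u v :: "nat \<Rightarrow> complex"
  define G where "G = mpol_subst (\<lambda>r. [:[:of_real r:]:]) (\<lambda>i. [:[:x i:], [:u i, v i:]:]) F"
  have hom2: "comm_ring_hom (\<lambda>r. [:[:of_real r:]:] :: complex poly poly)"
    by (rule comm_ring_hom_comp[OF const_poly_hom const_of_real_hom])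
  have "map_poly (\<lambda>p. poly p z) G = line_poly F x (\<lambda>i. u i + z * v i)" for z
  proof -
    interpret comm_ring_hom "\<lambda>p. poly p z :: complex" by (rule comm_ring_hom_poly)
    interpret m: map_poly_comm_ring_hom "\<lambda>p. poly p z :: complex" ..
    show ?thesis
      unfolding G_def line_poly_def hom_mpol_subst[OF m.comm_ring_hom_axioms hom2]
      by (simp add: poly_hom.map_poly_pCons_hom)
  qed
  then have "coeff (line_poly F x (\<lambda>i. u i + z * v i)) 1 = poly (coeff G 1) z" for z
    by (metis coeff_map_poly poly_0)
  then show "polyfun (\<lambda>z. coeff (line_poly F x (\<lambda>i. u i + z * v i)) 1)"
    by auto
qed

section \<open>Partial derivatives\<close>

definition partial :: "nat \<Rightarrow> 'k::comm_ring_1 mpol \<Rightarrow> 'k mpol" where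
  "partial i F = (\<Sum>a\<in>Poly_Mapping.keys F.
     Poly_Mapping.single (a - Poly_Mapping.single i 1) (Poly_Mapping.lookup F a * of_nat (Poly_Mapping.lookup a i)))"

lemma lookup_partial:
  "Poly_Mapping.lookup (partial i F) b
     = Poly_Mapping.lookup F (b + Poly_Mapping.single i 1) * of_nat (Suc (Poly_Mapping.lookup b i))"
proof -
  let ?e = "Poly_Mapping.single i 1 :: nat \<Rightarrow>\<^sub>0 nat"
  let ?c = "Poly_Mapping.lookup F (b + ?e) * of_nat (Suc (Poly_Mapping.lookup b i))"
  have "Poly_Mapping.lookup (Poly_Mapping.single (a - ?e) (Poly_Mapping.lookup F a * of_nat (Poly_Mapping.lookup a i))) b
      = (if a = b + ?e then ?c else 0)" for a
  proof (cases "Poly_Mapping.lookup a i = 0")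
    case True
    then have "a \<noteq> b + ?e" by (auto simp: lookup_add)
    with True show ?thesis by simp
  next
    case False
    then have "a - ?e + ?e = a"
      by (intro poly_mapping_eqI) (auto simp: lookup_add lookup_minus lookup_single when_def)
    then have "a - ?e = b \<longleftrightarrow> a = b + ?e"
      by (metis add_diff_cancel_right')
    then show ?thesis
      by (auto simp: lookup_single when_def lookup_add)
  qed
  then have "Poly_Mapping.lookup (partial i F) b
      = (\<Sum>a\<in>Poly_Mapping.keys F. if a = b + ?e then ?c else 0)"
    unfolding partial_def lookup_sum by (simp only:)
  also have "\<dots> = ?c"
    by (simp add: in_keys_iff)
  finally show ?thesis .
qed

lemma partial_add: "partial i (F + G) = partial i F + partial i G"
  by (rule poly_mapping_eqI) (simp add: lookup_partial lookup_add distrib_right)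

lemma partial_single:
  "partial i (Poly_Mapping.single a r)
    = Poly_Mapping.single (a - Poly_Mapping.single i 1) (r * of_nat (Poly_Mapping.lookup a i))"
  by (cases "r = 0") (simp_all add: partial_def)

lemma coeff_linear_power: "coeff ([:v, 1:] ^ n) 1 = of_nat n * v ^ (n - 1)" for v :: "'b::idom"
proof -
  have "coeff ([:v, 1:] ^ n) 1 = poly (pderiv ([:v, 1:] ^ n)) 0"
    by (simp add: poly_0_coeff_0 coeff_pderiv)
  also have "\<dots> = of_nat n * v ^ (n - 1)"
    by (cases n) (simp_all add: pderiv_power_Suc pderiv_pCons del: power_Suc of_nat_Suc)
  finally show ?thesis .
qed

lemma coeff_line_poly_unit: "coeff (line_poly F x (unit5 i)) 1 = complex_eval (partial i F) x"
proof -
  interpret k: comm_ring_hom "\<lambda>r. [:of_real r:] :: complex poly" by (rule const_of_real_hom)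
  show ?thesis
  proof (induction F rule: mpol_induct)
    case zero
    then show ?case by (simp add: line_poly_def partial_def)
  next
    case (add a r F)
    let ?S = "insert i (Poly_Mapping.keys a)" and ?e = "Poly_Mapping.single i 1 :: nat \<Rightarrow>\<^sub>0 nat"
    let ?T = "?S - {i}" and ?n = "Poly_Mapping.lookup a i"
    let ?c = "\<Prod>l\<in>?T. x l ^ Poly_Mapping.lookup a l"
    have "monomial_at (\<lambda>l. [:x l, unit5 i l:]) a = (\<Prod>l\<in>?S. [:x l, unit5 i l:] ^ Poly_Mapping.lookup a l)"
      by (rule monomial_at_superset) auto
    also have "\<dots> = [:x i, 1:] ^ ?n * (\<Prod>l\<in>?T. [:x l, unit5 i l:] ^ Poly_Mapping.lookup a l)"
      by (subst prod.remove[of _ i]) auto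
    also have "(\<Prod>l\<in>?T. [:x l, unit5 i l:] ^ Poly_Mapping.lookup a l) = (\<Prod>l\<in>?T. [:x l ^ Poly_Mapping.lookup a l:])"
      by (rule prod.cong) (auto simp: poly_const_pow)
    also have "\<dots> = [:?c:]"
      by (rule coeff_lift_hom.hom_prod[symmetric])
    finally have mon: "monomial_at (\<lambda>l. [:x l, unit5 i l:]) a = Polynomial.smult ?c ([:x i, 1:] ^ ?n)"
      by simp
    have "monomial_at x (a - ?e) = (\<Prod>l\<in>?S. x l ^ Poly_Mapping.lookup (a - ?e) l)"
      by (rule monomial_at_superset) (auto simp: in_keys_iff lookup_minus)
    also have "\<dots> = x i ^ (?n - 1) * (\<Prod>l\<in>?T. x l ^ Poly_Mapping.lookup (a - ?e) l)"
      by (subst prod.remove[of _ i]) (auto simp: lookup_minus)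
    also have "(\<Prod>l\<in>?T. x l ^ Poly_Mapping.lookup (a - ?e) l) = ?c"
      by (rule prod.cong) (auto simp: lookup_minus lookup_single when_def)
    finally have mon': "monomial_at x (a - ?e) = x i ^ (?n - 1) * ?c" .
    have "coeff (line_poly (Poly_Mapping.single a r) x (unit5 i)) 1 = of_real r * (?c * (of_nat ?n * x i ^ (?n - 1)))"
      unfolding line_poly_def k.mpol_subst_single mon by (simp add: coeff_linear_power[unfolded One_nat_def pCons_one])
    also have "\<dots> = complex_eval (partial i (Poly_Mapping.single a r)) x"
      unfolding partial_single comm_ring_hom.mpol_subst_single[OF comm_ring_hom_of_real] mon' by simp
    finally show ?case
      using add.IH by (simp add: line_poly_def k.mpol_subst_add comm_ring_hom.mpol_subst_add[OF comm_ring_hom_of_real] partial_add)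
  qed
qed

lemma partial_form:
  assumes "form_of_degree m n F"
  shows "form_of_degree m (n - 1) (partial i F)"
  unfolding form_of_degree_def
proof
  let ?e = "Poly_Mapping.single i 1 :: nat \<Rightarrow>\<^sub>0 nat"
  fix b assume "b \<in> Poly_Mapping.keys (partial i F)"
  then have "b + ?e \<in> Poly_Mapping.keys F"
    by (auto simp: in_keys_iff lookup_partial)
  then have *: "Poly_Mapping.keys (b + ?e) \<subseteq> {..<m}" "monom_degree (b + ?e) = n"
    using assms by (auto simp: form_of_degree_def)
  have "Poly_Mapping.keys b \<subseteq> Poly_Mapping.keys (b + ?e)"
    by (auto simp: in_keys_iff lookup_add)
  moreover have "monom_degree (b + ?e) = monom_degree b + 1"
    by (simp only: monom_degree_eq_weight weight_add) (simp add: weight_def)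
  ultimately show "Poly_Mapping.keys b \<subseteq> {..<m} \<and> monom_degree b = n - 1"
    using * by auto
qed

text \<open>
  In characteristic zero a form of positive degree has a nonzero partial derivative, and this is a
  form of smaller degree.
\<close>

lemma exists_partial_not_dvd:
  fixes F :: "'k::{idom,ring_char_0} mpol"
  assumes F: "form_of_degree m n F" "n > 0" "F \<noteq> 0"
  shows "\<exists>i<m. \<not> F dvd partial i F"
proof -
  obtain a where a: "a \<in> Poly_Mapping.keys F"
    using F(3) keys_eq_empty[of F] by blast
  then have deg: "monom_degree a = n" and vars: "Poly_Mapping.keys a \<subseteq> {..<m}"
    using F(1) by (auto simp: form_of_degree_def)
  have "Poly_Mapping.keys a \<noteq> {}"
    using deg F(2) by (auto simp: monom_degree_def)
  then obtain i where i: "i \<in> Poly_Mapping.keys a" by blast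
  let ?e = "Poly_Mapping.single i 1 :: nat \<Rightarrow>\<^sub>0 nat"
  have "a - ?e + ?e = a"
    using i by (intro poly_mapping_eqI) (auto simp: lookup_add lookup_minus lookup_single when_def in_keys_iff)
  then have "Poly_Mapping.lookup (partial i F) (a - ?e) = Poly_Mapping.lookup F a * of_nat (Suc (Poly_Mapping.lookup (a - ?e) i))"
    by (simp add: lookup_partial)
  then have nz: "partial i F \<noteq> 0"
    using a by (auto simp: in_keys_iff simp del: of_nat_Suc)
  have "\<not> F dvd partial i F"
  proof
    assume "F dvd partial i F"
    then obtain H where H: "partial i F = F * H" by (elim dvdE)
    have P: "form_of_degree m (n - 1) (F * H)" using partial_form[OF F(1)] H by metis
    have "F * H \<noteq> 0" using nz H by simp
    then obtain k where "form_of_degree m k H"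
      using form_of_degree_factor[of m "n - 1" H F] P by (auto simp: mult.commute)
    then have "n + k = n - 1"
      using form_of_degree_unique[OF form_of_degree_mult[OF F(1)] P] \<open>F * H \<noteq> 0\<close> by blast
    then show False using F(2) by simp
  qed
  with i vars show ?thesis by auto
qed

section \<open>One-parameter families of planes\<close>

abbreviation at_param :: "(nat \<Rightarrow> complex poly) \<Rightarrow> complex \<Rightarrow> nat \<Rightarrow> complex" where
  "at_param a t \<equiv> (\<lambda>i. poly (a i) t)"

abbreviation top_coeffs :: "(nat \<Rightarrow> complex poly) \<Rightarrow> nat \<Rightarrow> nat \<Rightarrow> complex" where
  "top_coeffs a m \<equiv> (\<lambda>i. coeff (a i) m)"

definition pair_with :: "(nat \<Rightarrow> complex poly) \<Rightarrow> (nat \<Rightarrow> complex) \<Rightarrow> complex poly" where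
  "pair_with a x = (\<Sum>i<5. Polynomial.smult (x i) (a i))"

lemma poly_pair_with: "poly (pair_with a x) t = dot5 (at_param a t) x"
  by (simp add: pair_with_def dot5_def poly_sum mult.commute)

lemma coeff_pair_with: "coeff (pair_with a x) m = dot5 (top_coeffs a m) x"
  by (simp add: pair_with_def dot5_def coeff_sum mult.commute)

lemma pderiv_pair_with: "pderiv (pair_with a x) = pair_with (\<lambda>i. pderiv (a i)) x"
  by (simp add: pair_with_def pderiv_sum pderiv_smult)

lemma degree_pair_with: "(\<And>i. i < 5 \<Longrightarrow> degree (a i) \<le> m) \<Longrightarrow> degree (pair_with a x) \<le> m"
  unfolding pair_with_def by (intro degree_sum_le) (auto intro: order_trans[OF degree_smult_le])

lemma pair_with_line: "pair_with a (\<lambda>i. u i + z * v i) = pair_with a u + Polynomial.smult z (pair_with a v)"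
  by (rule poly_eqI) (simp add: coeff_pair_with dot5_add_smult)

lemma pair_with_eqI: "(\<And>t. poly (pair_with a x) t = poly p t) \<Longrightarrow> pair_with a x = p"
  by (simp add: fun_eq_iff flip: poly_eq_poly_eq_iff)

text \<open>
  The points \<open>project5 (at_param a t) (at_param b t) i j y\<close> form a rational curve that meets every
  kernel of the family and passes through a given point of one of them. A polynomial that vanishes
  on infinitely many kernels vanishes along this curve.
\<close>

lemma vanishes_on_all_kernels:
  assumes "infinite T" "\<And>t y. t \<in> T \<Longrightarrow> y \<in> perp (at_param a t) (at_param b t) \<Longrightarrow> complex_eval G y = 0"
    and t0: "indep5 (at_param a t0) (at_param b t0)" and x: "x \<in> perp (at_param a t0) (at_param b t0)"
  shows "complex_eval G x = 0"
proof -
  obtain i j where ij: "i < 5" "j < 5" and nz: "plucker_coord (at_param a t0) (at_param b t0) i j \<noteq> 0"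
    using t0 by (auto simp: indep5_def)
  define p0 where "p0 = plucker_coord (at_param a t0) (at_param b t0) i j"
  define y where "y = (\<lambda>k. 0 + inverse p0 * x k)"
  have y: "y \<in> perp (at_param a t0) (at_param b t0)"
    using x unfolding y_def perp_def by (simp only: mem_Collect_eq dot5_add_smult) (simp add: dot5_def)
  define P where "P = mpol_subst (\<lambda>r. [:complex_of_real r:]) (project5 a b i j (\<lambda>k. [:y k:])) G"
  have P: "poly P t = complex_eval G (project5 (at_param a t) (at_param b t) i j y)" for t
  proof -
    have "poly (project5 a b i j (\<lambda>k. [:y k:]) k) t = project5 (at_param a t) (at_param b t) i j y k" for k
      by (simp add: project5_def plucker_coord_def dot5_def poly_sum mult.commute[of "y _"])
    then show ?thesis
      unfolding P_def hom_mpol_subst[OF comm_ring_hom_poly const_of_real_hom] by simp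
  qed
  have "T \<subseteq> {t. poly P t = 0}"
    using assms(2)[OF _ project5_in_perp[OF ij]] by (auto simp: P)
  then have "P = 0"
    using assms(1) poly_roots_finite finite_subset by blast
  then have "complex_eval G (project5 (at_param a t0) (at_param b t0) i j y) = 0"
    using P by (metis poly_0)
  moreover have "project5 (at_param a t0) (at_param b t0) i j y = x"
    unfolding project5_perp[OF y] using nz by (simp add: y_def p0_def fun_eq_iff)
  ultimately show ?thesis by simp
qed

text \<open>
  Reversing the coefficients with respect to the formal degree moves the parameter infinity to \<open>0\<close>.
\<close>

definition reverse_poly :: "nat \<Rightarrow> complex poly \<Rightarrow> complex poly" where
  "reverse_poly m p = (\<Sum>k\<le>m. monom (coeff p (m - k)) k)"

lemma poly_reverse_poly_0: "poly (reverse_poly m p) 0 = coeff p m"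
  by (simp add: reverse_poly_def poly_sum poly_monom power_0_left if_distrib[of "\<lambda>x. _ * x"] cong: if_cong)

lemma poly_reverse_poly:
  assumes "degree p \<le> m" "s \<noteq> 0"
  shows "poly (reverse_poly m p) s = s ^ m * poly p (inverse s)"
proof -
  have "poly p (inverse s) = (\<Sum>k\<le>m. coeff p k * inverse s ^ k)"
    unfolding poly_altdef using assms(1)
    by (intro sum.mono_neutral_left) (auto simp: coeff_eq_0)
  also have "s ^ m * \<dots> = (\<Sum>k\<le>m. coeff p k * s ^ (m - k))"
    unfolding sum_distrib_left
  proof (rule sum.cong)
    fix k assume "k \<in> {..m}"
    then have "s ^ m = s ^ (m - k) * s ^ k" by (simp flip: power_add)
    then show "s ^ m * (coeff p k * inverse s ^ k) = coeff p k * s ^ (m - k)"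
      using assms(2) by (simp add: power_inverse)
  qed simp
  also have "\<dots> = (\<Sum>k\<le>m. coeff p (m - k) * s ^ k)"
    by (rule sum.reindex_bij_witness[of _ "\<lambda>k. m - k" "\<lambda>k. m - k"]) auto
  finally show ?thesis by (simp add: reverse_poly_def poly_sum poly_monom)
qed

text \<open>
  Two generators that are independent at every parameter, including infinity with respect to the
  formal degrees \<open>m\<close> and \<open>n\<close>: their common kernels \<open>L t\<close> form a family of planes over the whole
  projective line.
\<close>

locale plane_family =
  fixes a b :: "nat \<Rightarrow> complex poly" and m n :: nat
  assumes degree_a: "i < 5 \<Longrightarrow> degree (a i) \<le> m" and degree_b: "i < 5 \<Longrightarrow> degree (b i) \<le> n"
    and indep: "indep5 (at_param a t) (at_param b t)"
    and indep_top: "indep5 (top_coeffs a m) (top_coeffs b n)"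
begin

definition L :: "complex \<Rightarrow> (nat \<Rightarrow> complex) set" where
  "L t = perp (at_param a t) (at_param b t)"

definition L_inf :: "(nat \<Rightarrow> complex) set" where
  "L_inf = perp (top_coeffs a m) (top_coeffs b n)"

definition res_at :: "(nat \<Rightarrow> complex) \<Rightarrow> complex" where
  "res_at y = resultant_sub m n (pair_with a y) (pair_with b y)"

lemma mem_L: "x \<in> L t \<longleftrightarrow> poly (pair_with a x) t = 0 \<and> poly (pair_with b x) t = 0"
  by (simp add: L_def perp_def poly_pair_with)

lemma mem_L_inf: "x \<in> L_inf \<longleftrightarrow> coeff (pair_with a x) m = 0 \<and> coeff (pair_with b x) n = 0"
  by (simp add: L_inf_def perp_def coeff_pair_with)

lemmas degree_pair_a = degree_pair_with[OF degree_a]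
lemmas degree_pair_b = degree_pair_with[OF degree_b]

lemma res_at_zero_iff: "y \<notin> L_inf \<Longrightarrow> res_at y = 0 \<longleftrightarrow> (\<exists>t. y \<in> L t)"
  unfolding res_at_def mem_L mem_L_inf
  by (intro resultant_sub_eq_0_iff degree_pair_a degree_pair_b) auto

lemma L_subset_imp_eq: "L t \<subseteq> L s \<Longrightarrow> L t = L s"
  unfolding L_def by (rule perp_eq_if_subset[OF indep indep])

lemma L_subset_inf_imp_eq: "L t \<subseteq> L_inf \<Longrightarrow> L t = L_inf"
  unfolding L_def L_inf_def by (rule perp_eq_if_subset[OF indep indep_top])

lemma vanishes_on_family:
  assumes "infinite T" "\<And>t y. t \<in> T \<Longrightarrow> y \<in> L t \<Longrightarrow> complex_eval G y = 0"
  shows "x \<in> L s \<Longrightarrow> complex_eval G x = 0" "x \<in> L_inf \<Longrightarrow> complex_eval G x = 0"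
proof -
  show "complex_eval G x = 0" if "x \<in> L s"
    using vanishes_on_all_kernels[of T a b G s x] assms indep that unfolding L_def by blast
  assume x: "x \<in> L_inf"
  let ?a = "\<lambda>i. reverse_poly m (a i)" and ?b = "\<lambda>i. reverse_poly n (b i)"
  let ?T = "inverse ` (T - {0})"
  have "infinite ?T"
    using assms(1) by (subst finite_image_iff) (auto simp: inj_on_def)
  moreover have "complex_eval G y = 0"
    if s: "s \<in> ?T" and y: "y \<in> perp (at_param ?a s) (at_param ?b s)" for s y
  proof -
    obtain t where t: "t \<in> T" "t \<noteq> 0" "s = inverse t" using s by blast
    have "dot5 (at_param ?a s) y = s ^ m * dot5 (at_param a t) y"
      using t degree_a by (simp add: dot5_def poly_reverse_poly sum_distrib_left mult.assoc)
    moreover have "dot5 (at_param ?b s) y = s ^ n * dot5 (at_param b t) y"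
      using t degree_b by (simp add: dot5_def poly_reverse_poly sum_distrib_left mult.assoc)
    ultimately have "y \<in> L t" using y t by (simp add: perp_def L_def)
    with assms(2) t show ?thesis by blast
  qed
  moreover have "indep5 (at_param ?a 0) (at_param ?b 0)"
    using indep_top by (simp add: poly_reverse_poly_0)
  moreover have "x \<in> perp (at_param ?a 0) (at_param ?b 0)"
    using x by (simp add: L_inf_def poly_reverse_poly_0)
  ultimately show "complex_eval G x = 0"
    by (rule vanishes_on_all_kernels)
qed

end

section \<open>Counting the planes through a point\<close>

text \<open>
  After cancelling the common factor, each of the two polynomials divides its own derivative and is
  therefore constant.
\<close>

lemma proportional_if_wronskian_zero:
  fixes f g :: "complex poly"
  assumes "f \<noteq> 0" "f * pderiv g = pderiv f * g"
  shows "\<exists>\<kappa>. g = Polynomial.smult \<kappa> f"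
proof -
  obtain f1 g1 where fg: "f = f1 * gcd f g" "g = g1 * gcd f g" and cop: "coprime f1 g1"
    using gcd_coprime_exists[of f g] assms(1) by (metis gcd_eq_0_iff)
  define h where "h = gcd f g"
  have f: "f = f1 * h" and g: "g = g1 * h" using fg by (simp_all add: h_def)
  have "h \<noteq> 0" "f1 \<noteq> 0" using f assms(1) by auto
  have "h * h * (f1 * pderiv g1) = h * h * (pderiv f1 * g1)"
    using assms(2) by (simp add: f g pderiv_mult algebra_simps)
  then have eq: "f1 * pderiv g1 = pderiv f1 * g1" using \<open>h \<noteq> 0\<close> by simp
  have const: "degree p = 0" if "p dvd pderiv p" for p :: "complex poly"
    using that not_dvd_pderiv by blast
  have "f1 dvd pderiv f1"
    using eq cop by (metis coprime_dvd_mult_left_iff dvd_triv_left)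
  then obtain c where c: "f1 = [:c:]" using const degree_eq_zeroE by blast
  have "g1 dvd pderiv g1"
    using eq cop by (metis coprime_commute coprime_dvd_mult_right_iff dvd_triv_right)
  then obtain d where d: "g1 = [:d:]" using const degree_eq_zeroE by blast
  have "c \<noteq> 0" using c \<open>f1 \<noteq> 0\<close> by auto
  then have "g = Polynomial.smult (d / c) f" by (simp add: f g c d)
  then show ?thesis by blast
qed

lemma coeff_mult_top:
  fixes p q :: "'a::comm_semiring_0 poly"
  assumes "degree p \<le> m" "degree q \<le> n"
  shows "coeff (p * q) (m + n) = coeff p m * coeff q n"
proof (cases "degree p = m \<and> degree q = n")
  case True
  then show ?thesis using coeff_mult_degree_sum by blast
next
  case False
  then have "degree (p * q) < m + n"
    using assms degree_mult_le[of p q] by linarith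
  moreover have "coeff p m = 0 \<or> coeff q n = 0"
    using False assms by (metis coeff_eq_0 le_neq_implies_less)
  ultimately show ?thesis by (auto simp: coeff_eq_0)
qed

text \<open>
  One of \<open>f1\<close> and \<open>f2\<close> may be zero; the resultant is symmetric enough to use the other one.
\<close>

lemma resultant_pencil_order_sym:
  fixes f1 f2 g1 g2 :: "complex poly"
  defines "q \<equiv> f1 * g2 - f2 * g1"
  assumes deg: "degree f1 \<le> m" "degree f2 \<le> n" "degree g1 \<le> m" "degree g2 \<le> n"
    and g: "coeff g1 m \<noteq> 0" "coeff g2 n \<noteq> 0" and q: "coeff q (m + n) \<noteq> 0"
    and coprime: "\<And>z. f1 \<noteq> 0 \<Longrightarrow> poly f1 z = 0 \<Longrightarrow> poly g1 z \<noteq> 0"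
      "\<And>z. f2 \<noteq> 0 \<Longrightarrow> poly f2 z = 0 \<Longrightarrow> poly g2 z \<noteq> 0"
    and simple: "\<And>t. poly f1 t = 0 \<Longrightarrow> poly f2 t = 0 \<Longrightarrow> poly (pderiv q) t \<noteq> 0"
  shows "\<exists>\<psi>. polyfun \<psi> \<and> \<psi> 0 \<noteq> 0 \<and>
    (\<forall>s. resultant_sub m n (f1 + Polynomial.smult s g1) (f2 + Polynomial.smult s g2)
       = s ^ card {t. poly f1 t = 0 \<and> poly f2 t = 0} * \<psi> s)"
proof (cases "f1 = 0")
  case False
  with coprime(1) show ?thesis
    using resultant_pencil_order[OF deg g(1) q[unfolded q_def] _ simple[unfolded q_def]] by blast
next
  case True
  have "f2 \<noteq> 0" using q True by (auto simp: q_def)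
  have "- q = f2 * g1 - f1 * g2" by (simp add: q_def)
  have "\<exists>\<psi>. polyfun \<psi> \<and> \<psi> 0 \<noteq> 0 \<and>
    (\<forall>s. resultant_sub n m (f2 + Polynomial.smult s g2) (f1 + Polynomial.smult s g1)
       = s ^ card {t. poly f2 t = 0 \<and> poly f1 t = 0} * \<psi> s)"
    using q simple coprime(2) \<open>f2 \<noteq> 0\<close>
    by (intro resultant_pencil_order[OF deg(2,1,4,3) g(2)])
      (auto simp: add.commute[of n] pderiv_minus simp flip: \<open>- q = f2 * g1 - f1 * g2\<close>)
  then obtain \<psi> where \<psi>: "polyfun \<psi>" "\<psi> 0 \<noteq> 0"
    "\<And>s. resultant_sub n m (f2 + Polynomial.smult s g2) (f1 + Polynomial.smult s g1)
       = s ^ card {t. poly f2 t = 0 \<and> poly f1 t = 0} * \<psi> s"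
    by blast
  have deg': "degree (f1 + Polynomial.smult s g1) \<le> m" "degree (f2 + Polynomial.smult s g2) \<le> n" for s
    using deg by (auto intro!: degree_add_le intro: order_trans[OF degree_smult_le])
  have "resultant_sub m n (f1 + Polynomial.smult s g1) (f2 + Polynomial.smult s g2)
       = s ^ card {t. poly f1 t = 0 \<and> poly f2 t = 0} * ((-1) ^ (m * n) * \<psi> s)" for s
    unfolding resultant_sub_swap[OF deg'] \<psi>(3) by (simp add: conj_commute)
  moreover have "polyfun (\<lambda>s. (-1) ^ (m * n) * \<psi> s)"
    by (intro polyfun_mult polyfun_const \<psi>(1))
  ultimately show ?thesis
    using \<psi>(2) by (intro exI[of _ "\<lambda>s. (-1) ^ (m * n) * \<psi> s"]) auto
qed

lemma order_unique:
  assumes "polyfun \<phi>" "polyfun \<psi>" "\<phi> 0 \<noteq> 0" "\<psi> 0 \<noteq> 0" "\<And>s. s ^ j * \<phi> s = s ^ k * \<psi> s"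
  shows "j = k"
proof -
  have "\<not> j < k" if "polyfun \<phi>" "polyfun \<psi>" "\<phi> 0 \<noteq> 0" "\<And>s. s ^ j * \<phi> s = s ^ k * \<psi> s"
    for j k and \<phi> \<psi> :: "complex \<Rightarrow> complex"
  proof
    assume "j < k"
    then have k: "k = j + (k - j)" by simp
    have "\<phi> 0 = 0 ^ (k - j) * \<psi> 0"
    proof (rule polyfun_eqI[of \<phi>])
      have "\<phi> s = s ^ (k - j) * \<psi> s" if "s \<noteq> 0" for s
        using \<open>s ^ j * \<phi> s = s ^ k * \<psi> s\<close> that by (subst (asm) k) (simp add: power_add)
      then have "{s. \<phi> s \<noteq> s ^ (k - j) * \<psi> s} \<subseteq> {0}" by auto
      then show "finite {s. \<phi> s \<noteq> s ^ (k - j) * \<psi> s}" by (rule finite_subset) simp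
      have "polyfun (\<lambda>s. s ^ (k - j))"
        using polyfun_power[OF polyfun_affine[of 0 1]] by simp
      then show "polyfun (\<lambda>s. s ^ (k - j) * \<psi> s)"
        by (rule polyfun_mult) fact
    qed fact
    then show False using \<open>j < k\<close> that(3) by simp
  qed
  from this[OF assms(1,2,3,5)] this[OF assms(2,1,4) assms(5)[symmetric]] show ?thesis by simp
qed

text \<open>
  If \<open>V\<close> is not contained in the kernel of \<open>p\<close> and \<open>q\<close>, this is one of the two functionals that does
  not vanish identically on \<open>V\<close>; it turns avoiding the kernel into a generic condition.
\<close>

definition nonvanishing_on :: "(nat \<Rightarrow> complex) set \<Rightarrow> (nat \<Rightarrow> complex) \<Rightarrow> (nat \<Rightarrow> complex) \<Rightarrow> (nat \<Rightarrow> complex) \<Rightarrow> complex" where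
  "nonvanishing_on V p q = (if \<exists>x\<in>V. dot5 p x \<noteq> 0 then dot5 p else dot5 q)"

lemma nonvanishing_on:
  assumes "\<not> V \<subseteq> perp p q"
  shows "linewise_poly (nonvanishing_on V p q) \<and> (\<exists>x\<in>V. nonvanishing_on V p q x \<noteq> 0)"
  using assms unfolding nonvanishing_on_def perp_def by (auto intro: linewise_poly_dot5)

lemma nonvanishing_onD: "nonvanishing_on V p q x \<noteq> 0 \<Longrightarrow> x \<notin> perp p q"
  unfolding nonvanishing_on_def perp_def by (auto split: if_splits)

text \<open>
  The planes are the annihilators of the tangent lines of a curve \<open>c\<close>: at the points \<open>x\<close> of \<open>L t\<close>,
  regarded as hyperplanes, the curve is tangent to \<open>x\<close> at \<open>t\<close>, and outside the finite set \<open>Q\<close> these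
  are all the tangent hyperplanes. This excludes families of planes that cover one hyperplane several
  times, for which the exponent of the implicit equation is not the degree of the Pluecker map.
\<close>

locale osculating_family = plane_family +
  fixes c :: "nat \<Rightarrow> complex poly" and Q :: "complex set"
  assumes double_root: "x \<in> L t \<Longrightarrow> poly (pair_with c x) t = 0 \<and> poly (pderiv (pair_with c x)) t = 0"
    and in_plane: "t \<notin> Q \<Longrightarrow> poly (pair_with c x) t = 0 \<Longrightarrow> poly (pderiv (pair_with c x)) t = 0 \<Longrightarrow> x \<in> L t"
    and finite_Q: "finite Q"
    and finite_fibre: "finite {t. L t = L s}"
    and finite_fibre_inf: "finite {t. L t = L_inf}"
begin

text \<open>
  Otherwise the curve and its tangents would stay in the span of the generators at \<open>t\<close>, and almost
  all planes would coincide with \<open>L t\<close>.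
\<close>

lemma curve_not_in_dual: "\<exists>s. \<exists>x\<in>L t. dot5 (at_param c s) x \<noteq> 0"
proof (rule ccontr)
  assume "\<not> (\<exists>s. \<exists>x\<in>L t. dot5 (at_param c s) x \<noteq> 0)"
  then have "pair_with c x = 0" if "x \<in> L t" for x
    using that by (intro pair_with_eqI) (simp add: poly_pair_with)
  then have "L t \<subseteq> L s" if "s \<notin> Q" for s
    using in_plane[OF that] by auto
  then have "- Q \<subseteq> {s. L s = L t}"
    using L_subset_imp_eq by blast
  then have "finite (- Q)"
    using finite_fibre finite_subset by blast
  then have "finite (Q \<union> - Q)" using finite_Q by simp
  then show False
    using infinite_UNIV_char_0[where 'a = complex] by (simp add: Compl_partition)
qed

text \<open>
  A point \<open>x\<close> of \<open>L s\<close> lies on \<open>L t\<close> only if \<open>pair_with c x\<close> has a double root at \<open>t\<close>. As in Bertini's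
  theorem, double roots of the members of the pencil \<open>f + z g\<close> occur only at common roots of
  \<open>f\<close> and \<open>g\<close> or at roots of the Wronskian. These are finitely many \<open>t\<close>, and for each of them with
  \<open>L t \<noteq> L s\<close> a general member of the pencil avoids \<open>L t\<close>.
\<close>

lemma exists_point_on_one_plane:
  assumes s: "L s \<noteq> L_inf" and I: "finite I"
    "\<And>\<Phi>. \<Phi> \<in> I \<Longrightarrow> linewise_poly \<Phi> \<and> (\<exists>x\<in>L s. \<Phi> x \<noteq> 0)"
  shows "\<exists>x\<in>L s. x \<notin> L_inf \<and> {t. x \<in> L t} = {t. L t = L s} \<and> (\<forall>\<Phi>\<in>I. \<Phi> x \<noteq> 0)"
proof -
  let ?\<Theta> = "{t. L t = L s}"
  have V: "line_closed (L s)" by (simp add: L_def line_closed_perp)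
  have zero: "(\<lambda>_. 0) \<in> L s" by (simp add: L_def perp_def dot5_def)
  have sub: "\<not> L s \<subseteq> perp (at_param a t) (at_param b t)" if "t \<notin> ?\<Theta>" for t
    using L_subset_imp_eq[of s t] that L_def[of t] by auto
  obtain s' where s': "\<exists>x\<in>L s. dot5 (at_param c s') x \<noteq> 0"
    using curve_not_in_dual by blast
  let ?\<Phi>inf = "nonvanishing_on (L s) (top_coeffs a m) (top_coeffs b n)"
  let ?I = "insert ?\<Phi>inf (insert (dot5 (at_param c s')) I)"
  have I': "finite ?I" "\<And>\<Phi>. \<Phi> \<in> ?I \<Longrightarrow> linewise_poly \<Phi> \<and> (\<exists>x\<in>L s. \<Phi> x \<noteq> 0)"
    using I s' nonvanishing_on[of "L s" "top_coeffs a m" "top_coeffs b n"] L_subset_inf_imp_eq[of s] s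
    by (auto simp: linewise_poly_dot5 L_inf_def)
  obtain u where u: "u \<in> L s" "\<forall>\<Phi>\<in>?I. \<Phi> u \<noteq> 0"
    using generic_point[OF V zero I'] by blast
  define f where "f = pair_with c u"
  have "poly f s' \<noteq> 0" using u by (simp add: f_def poly_pair_with)
  then have "f \<noteq> 0" by auto
  define Z where "Z = {t. poly f t = 0}"
  have "finite Z" unfolding Z_def using \<open>f \<noteq> 0\<close> by (rule poly_roots_finite)
  let ?J = "(\<lambda>t. nonvanishing_on (L s) (at_param a t) (at_param b t)) ` (Z - ?\<Theta>)"
  have "\<exists>v\<in>L s. \<forall>\<Phi>\<in>?J. \<Phi> v \<noteq> 0"
    using \<open>finite Z\<close> nonvanishing_on[OF sub]
    by (intro generic_point[OF V zero]) auto
  then obtain v where v0: "v \<in> L s" "\<forall>\<Phi>\<in>?J. \<Phi> v \<noteq> 0" by blast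
  have "v \<notin> L t" if "t \<in> Z - ?\<Theta>" for t
    using nonvanishing_onD[of "L s" "at_param a t" "at_param b t" v] v0(2) that L_def[of t] by blast
  note v = v0(1) this
  define g where "g = pair_with c v"
  define W where "W = f * pderiv g - pderiv f * g"
  let ?x = "\<lambda>z i. u i + z * v i"
  have xL: "?x z \<in> L s" for z using V u v by (simp add: line_closed_def)
  have pair_x: "pair_with c (?x z) = f + Polynomial.smult z g" for z
    by (simp add: f_def g_def pair_with_line)
  \<comment> \<open>If the Wronskian vanishes identically, all members of the pencil are multiples of \<open>f\<close>.\<close>
  define Y where "Y = Z \<union> (if W = 0 then {} else {t. poly W t = 0})"
  have "finite Y" using \<open>finite Z\<close> by (simp add: Y_def poly_roots_finite)
  define E where "E = {z. f + Polynomial.smult z g = 0}"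
  have "finite E"
  proof (cases "E = {}")
    case False
    then obtain z0 where z0: "f + Polynomial.smult z0 g = 0" by (auto simp: E_def)
    have "z = z0" if "f + Polynomial.smult z g = 0" for z
    proof -
      have "Polynomial.smult (z - z0) g = (f + Polynomial.smult z g) - (f + Polynomial.smult z0 g)"
        by (simp add: smult_diff_left)
      then have "Polynomial.smult (z - z0) g = 0" using that z0 by simp
      moreover have "g \<noteq> 0" using z0 \<open>f \<noteq> 0\<close> by auto
      ultimately show ?thesis by simp
    qed
    then have "E \<subseteq> {z0}" by (auto simp: E_def)
    then show ?thesis by (rule finite_subset) simp
  qed simp
  have inY: "t \<in> Y" if "z \<notin> E" "?x z \<in> L t" for z t
  proof -
    have 1: "poly f t + z * poly g t = 0" "poly (pderiv f) t + z * poly (pderiv g) t = 0"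
      using double_root[OF that(2)] unfolding pair_x by (simp_all add: pderiv_add pderiv_smult)
    show ?thesis
    proof (cases "W = 0")
      case True
      then obtain \<kappa> where \<kappa>: "g = Polynomial.smult \<kappa> f"
        using proportional_if_wronskian_zero[OF \<open>f \<noteq> 0\<close>, of g] by (auto simp: W_def)
      have "f + Polynomial.smult z g = Polynomial.smult (1 + z * \<kappa>) f"
        by (simp add: \<kappa> smult_add_left)
      then have "1 + z * \<kappa> \<noteq> 0" using that(1) by (auto simp: E_def)
      moreover have "(1 + z * \<kappa>) * poly f t = 0" using 1(1) by (simp add: \<kappa> algebra_simps)
      ultimately show ?thesis by (simp add: Y_def Z_def)
    next
      case False
      have f: "poly f t = - z * poly g t" "poly (pderiv f) t = - z * poly (pderiv g) t"
        using 1 by (simp_all add: add_eq_0_iff)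
      have "poly W t = 0" by (simp add: W_def f)
      then show ?thesis using False by (simp add: Y_def)
    qed
  qed
  have finite_bad: "finite {z. ?x z \<in> L t}" if "t \<notin> ?\<Theta>" for t
  proof (cases "u \<in> L t")
    case True
    then have "poly f t = 0" using double_root by (auto simp: f_def)
    then have "v \<notin> L t" using v(2) that by (auto simp: Z_def)
    with True have "{z. ?x z \<in> L t} \<subseteq> {0}"
      by (auto simp: L_def perp_def dot5_add_smult)
    then show ?thesis by (rule finite_subset) simp
  next
    case False
    then obtain w where w: "dot5 w u \<noteq> 0" "\<And>x. x \<in> L t \<Longrightarrow> dot5 w x = 0"
      by (auto simp: L_def perp_def)
    have "finite {z. dot5 w (?x z) = 0}"
      using w(1) by (intro polyfun_zero_or_finite[of _ 0] linewise_polyD linewise_poly_dot5) simp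
    then show ?thesis by (rule rev_finite_subset) (use w(2) in auto)
  qed
  have "finite {z. \<Phi> (?x z) = 0}" if "\<Phi> \<in> ?I" for \<Phi>
    using u(2) I'(2) that by (intro polyfun_zero_or_finite[of _ 0] linewise_polyD) auto
  then have 1: "finite (\<Union>\<Phi>\<in>?I. {z. \<Phi> (?x z) = 0})"
    using I'(1) by blast
  have 2: "finite (\<Union>t\<in>Y - ?\<Theta>. {z. ?x z \<in> L t})"
    using \<open>finite Y\<close> finite_bad by blast
  define bad where "bad = E \<union> (\<Union>t\<in>Y - ?\<Theta>. {z. ?x z \<in> L t}) \<union> (\<Union>\<Phi>\<in>?I. {z. \<Phi> (?x z) = 0})"
  have "finite bad" unfolding bad_def using \<open>finite E\<close> 1 2 by blast
  then obtain z where "z \<notin> bad"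
    using ex_new_if_finite[OF infinite_UNIV_char_0[where 'a = complex]] by blast
  then have z: "z \<notin> E" "\<And>t. t \<in> Y - ?\<Theta> \<Longrightarrow> ?x z \<notin> L t" "\<And>\<Phi>. \<Phi> \<in> ?I \<Longrightarrow> \<Phi> (?x z) \<noteq> 0"
    unfolding bad_def by blast+
  have "t \<in> ?\<Theta>" if "?x z \<in> L t" for t
    using z(2)[of t] inY[OF z(1) that] that by blast
  then have "{t. ?x z \<in> L t} = ?\<Theta>"
    using xL[of z] by blast
  moreover have "?\<Phi>inf (?x z) \<noteq> 0"
    by (rule z(3)) blast
  then have "?x z \<notin> L_inf"
    unfolding L_inf_def by (rule nonvanishing_onD)
  moreover have "\<forall>\<Phi>\<in>I. \<Phi> (?x z) \<noteq> 0"
    using z(3) by blast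
  ultimately show ?thesis
    using xL[of z] by blast
qed

end

lemma indep5_combination_nonzero:
  assumes "indep5 a b" "p \<noteq> 0 \<or> r \<noteq> (0::complex)"
  shows "\<exists>w. dot5 (\<lambda>k. p * b k - r * a k) w \<noteq> 0"
proof (rule ccontr)
  assume "\<not> (\<exists>w. dot5 (\<lambda>k. p * b k - r * a k) w \<noteq> 0)"
  then have zero: "dot5 (\<lambda>k. p * b k - r * a k) (unit5 k) = 0" for k by blast
  have eq: "p * b k = r * a k" if "k < 5" for k
    using zero[of k] that by (simp add: dot5_unit)
  obtain i j where ij: "i < 5" "j < 5" "plucker_coord a b i j \<noteq> 0"
    using assms(1) by (auto simp: indep5_def)
  have "p * plucker_coord a b i j = a i * (p * b j) - a j * (p * b i)"
    by (simp add: plucker_coord_def algebra_simps)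
  also have "\<dots> = 0" by (simp add: eq ij)
  finally have "p = 0" using ij(3) by simp
  have "r * plucker_coord a b i j = (r * a i) * b j - (r * a j) * b i"
    by (simp add: plucker_coord_def algebra_simps)
  also have "\<dots> = 0" by (simp add: eq[symmetric] ij)
  finally have "r = 0" using ij(3) by simp
  with \<open>p = 0\<close> assms(2) show False by simp
qed

lemma indep5_nonzero:
  assumes "indep5 a (b :: nat \<Rightarrow> complex)"
  shows "\<exists>w. dot5 a w \<noteq> 0" "\<exists>w. dot5 b w \<noteq> 0"
  using indep5_combination_nonzero[OF assms, of 0 "-1"] indep5_combination_nonzero[OF assms, of 1 0]
  by simp_all

lemma dot5_combination: "dot5 (\<lambda>k. p * b k - r * a k) w = p * dot5 b w - r * dot5 a (w :: nat \<Rightarrow> complex)"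
  using dot5_lin[of "\<lambda>k. p * b k - r * a k" "- r" a p b w] by simp

context plane_family
begin

text \<open>
  The first five conditions on the direction \<open>w\<close> are those of the theorem on pencils, for the line
  from \<open>x\<close> in the direction \<open>w\<close>. Each of them is the nonvanishing of linear functionals that are not
  zero because the generators are independent.
\<close>

lemma exists_direction:
  assumes x: "x \<notin> L_inf" and I: "finite I" "\<And>\<Phi>. \<Phi> \<in> I \<Longrightarrow> linewise_poly \<Phi> \<and> (\<exists>w. \<Phi> w \<noteq> 0)"
  shows "\<exists>w. coeff (pair_with a w) m \<noteq> 0 \<and> coeff (pair_with b w) n \<noteq> 0
    \<and> coeff (pair_with a x * pair_with b w - pair_with b x * pair_with a w) (m + n) \<noteq> 0
    \<and> (\<forall>z. pair_with a x \<noteq> 0 \<longrightarrow> poly (pair_with a x) z = 0 \<longrightarrow> poly (pair_with a w) z \<noteq> 0)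
    \<and> (\<forall>z. pair_with b x \<noteq> 0 \<longrightarrow> poly (pair_with b x) z = 0 \<longrightarrow> poly (pair_with b w) z \<noteq> 0)
    \<and> (\<forall>\<Phi>\<in>I. \<Phi> w \<noteq> 0)"
proof -
  let ?A = "top_coeffs a m" and ?B = "top_coeffs b n"
  define p where "p = dot5 ?A x"
  define r where "r = dot5 ?B x"
  have "p \<noteq> 0 \<or> r \<noteq> 0" using x by (auto simp: L_inf_def perp_def p_def r_def)
  let ?\<Phi> = "dot5 (\<lambda>k. p * ?B k - r * ?A k)"
  let ?Za = "if pair_with a x = 0 then {} else {z. poly (pair_with a x) z = 0}"
  let ?Zb = "if pair_with b x = 0 then {} else {z. poly (pair_with b x) z = 0}"
  let ?J = "{dot5 ?A, dot5 ?B, ?\<Phi>} \<union> (\<lambda>z. dot5 (at_param a z)) ` ?Za \<union> (\<lambda>z. dot5 (at_param b z)) ` ?Zb \<union> I"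
  have "finite ?J"
    using I(1) by (auto simp: poly_roots_finite)
  moreover have "linewise_poly \<Psi> \<and> (\<exists>w\<in>UNIV. \<Psi> w \<noteq> 0)" if "\<Psi> \<in> ?J" for \<Psi>
  proof -
    consider "\<Psi> = dot5 ?A" | "\<Psi> = dot5 ?B" | "\<Psi> = ?\<Phi>" | z where "\<Psi> = dot5 (at_param a z)"
      | z where "\<Psi> = dot5 (at_param b z)" | "\<Psi> \<in> I"
      using \<open>\<Psi> \<in> ?J\<close> by blast
    then show ?thesis
    proof cases
      case 3
      then show ?thesis
        using indep5_combination_nonzero[OF indep_top \<open>p \<noteq> 0 \<or> r \<noteq> 0\<close>] linewise_poly_dot5 by simp
    qed (use indep5_nonzero[OF indep_top] indep5_nonzero[OF indep] I(2) linewise_poly_dot5 in simp_all)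
  qed
  ultimately obtain w where w: "\<forall>\<Psi>\<in>?J. \<Psi> w \<noteq> 0"
    using generic_point[OF line_closed_UNIV UNIV_I, of ?J] by blast
  have "coeff (pair_with a w) m \<noteq> 0" "coeff (pair_with b w) n \<noteq> 0"
    using w by (simp_all add: coeff_pair_with)
  moreover have "coeff (pair_with a x * pair_with b w) (m + n) = p * dot5 ?B w"
    by (simp add: coeff_mult_top[OF degree_pair_a degree_pair_b] coeff_pair_with p_def)
  moreover have "coeff (pair_with b x * pair_with a w) (n + m) = r * dot5 ?A w"
    by (simp add: coeff_mult_top[OF degree_pair_b degree_pair_a] coeff_pair_with r_def)
  moreover have "p * dot5 ?B w - r * dot5 ?A w \<noteq> 0"
    using w by (simp add: dot5_combination)
  moreover have "\<forall>z. pair_with a x \<noteq> 0 \<longrightarrow> poly (pair_with a x) z = 0 \<longrightarrow> poly (pair_with a w) z \<noteq> 0"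
    using w by (simp add: poly_pair_with)
  moreover have "\<forall>z. pair_with b x \<noteq> 0 \<longrightarrow> poly (pair_with b x) z = 0 \<longrightarrow> poly (pair_with b w) z \<noteq> 0"
    using w by (simp add: poly_pair_with)
  ultimately show ?thesis
    using w by (intro exI[of _ w]) (simp add: add.commute[of n m])
qed

lemma res_at_line: "res_at (\<lambda>i. x i + s * w i) = resultant_sub m n
    (pair_with a x + Polynomial.smult s (pair_with a w)) (pair_with b x + Polynomial.smult s (pair_with b w))"
  by (simp add: res_at_def pair_with_line)

text \<open>
  On a suitable line no factor of the product formula vanishes identically, because the two
  polynomials of the first generator have no common root.
\<close>

lemma res_at_nonzero: "\<exists>y. res_at y \<noteq> 0"
proof -
  obtain x where x: "dot5 (top_coeffs a m) x \<noteq> 0"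
    using indep5_nonzero[OF indep_top] by blast
  then have "x \<notin> L_inf" by (simp add: L_inf_def perp_def)
  have "coeff (pair_with a x) m \<noteq> 0" using x by (simp add: coeff_pair_with)
  then have "pair_with a x \<noteq> 0" by auto
  obtain w where w: "coeff (pair_with a w) m \<noteq> 0"
    "coeff (pair_with a x * pair_with b w - pair_with b x * pair_with a w) (m + n) \<noteq> 0"
    "\<And>z. poly (pair_with a x) z = 0 \<Longrightarrow> poly (pair_with a w) z \<noteq> 0"
    using exists_direction[OF \<open>x \<notin> L_inf\<close>, of "{}"] \<open>pair_with a x \<noteq> 0\<close> by auto
  obtain ts where ts: "pair_with a x * pair_with b w - pair_with b x * pair_with a w
      = Polynomial.smult (lead_coeff (pair_with a x * pair_with b w - pair_with b x * pair_with a w)) (linear_factors ts)"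
    using exists_linear_factors by metis
  obtain C where C: "C \<noteq> 0" "\<And>s. res_at (\<lambda>i. x i + s * w i)
      = C * (\<Prod>t\<leftarrow>ts. poly (pair_with a x) t + s * poly (pair_with a w) t)"
    using resultant_pencil[OF degree_pair_a degree_pair_b degree_pair_a degree_pair_b w(1,2) ts w(3)]
    unfolding res_at_line by auto
  have "finite {s. poly (pair_with a x) t + s * poly (pair_with a w) t = 0}" for t
  proof (cases "poly (pair_with a w) t = 0")
    case True
    then have "poly (pair_with a x) t \<noteq> 0" using w(3) by blast
    then show ?thesis using True by simp
  next
    case False
    then have "{s. poly (pair_with a x) t + s * poly (pair_with a w) t = 0} \<subseteq> {- poly (pair_with a x) t / poly (pair_with a w) t}"
      by (auto simp: field_simps add_eq_0_iff)
    then show ?thesis by (rule finite_subset) simp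
  qed
  then have "finite (\<Union>t\<in>set ts. {s. poly (pair_with a x) t + s * poly (pair_with a w) t = 0})" by blast
  then obtain s where s: "s \<notin> (\<Union>t\<in>set ts. {s. poly (pair_with a x) t + s * poly (pair_with a w) t = 0})"
    using ex_new_if_finite[OF infinite_UNIV_char_0[where 'a = complex]] by blast
  then have "res_at (\<lambda>i. x i + s * w i) \<noteq> 0"
    unfolding C(2) using C(1) by (auto simp: prod_list_zero_iff)
  then show ?thesis by blast
qed

lemma res_at_zero:
  assumes "x \<in> L t" "x \<notin> L_inf"
  shows "res_at x = 0"
  using assms res_at_zero_iff by blast

end

lemma form_of_degree_vars_below: "form_of_degree m n F \<Longrightarrow> vars_below m F"
  by (simp add: form_of_degree_def vars_below_def)

context osculating_family
begin

text \<open>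
  Let \<open>x\<close> be a general point of the plane \<open>L s\<close>, so that it lies on no other plane of the family. On
  a general line through \<open>x\<close> the power \<open>F ^ j\<close> vanishes at \<open>x\<close> to the order \<open>j\<close>, because \<open>x\<close> is a
  smooth point of \<open>F = 0\<close>. The resultant vanishes there to the order given by the number of
  parameters \<open>t\<close> with \<open>L t = L s\<close>, because these are simple roots of the polynomial \<open>q\<close> of the
  pencil unless the family is stationary at \<open>t\<close>.
\<close>

theorem card_fibre:
  assumes F: "irreducible F" "form_of_degree 5 N F"
    and R: "\<And>y. res_at y = \<kappa> * complex_eval F y ^ j" "\<kappa> \<noteq> 0"
    and crit: "finite {t. L t \<subseteq> perp (at_param (\<lambda>i. pderiv (a i)) t) (at_param (\<lambda>i. pderiv (b i)) t)}"
  shows "\<exists>T0. finite T0 \<and> (\<forall>s. s \<notin> T0 \<longrightarrow> finite {t. L t = L s} \<and> card {t. L t = L s} = j) \<and> j > 0"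
proof -
  let ?a' = "\<lambda>i. pderiv (a i)" and ?b' = "\<lambda>i. pderiv (b i)"
  have j: "j > 0"
  proof -
    obtain t where "t \<notin> {t. L t = L_inf}"
      using ex_new_if_finite[OF infinite_UNIV_char_0[where 'a = complex] finite_fibre_inf] by blast
    then obtain y where "y \<in> L t" "y \<notin> L_inf"
      using L_subset_inf_imp_eq by blast
    then have "\<kappa> * complex_eval F y ^ j = 0" using res_at_zero R(1) by metis
    then show ?thesis using R(2) by (cases "j = 0") auto
  qed
  have N: "N > 0" by (rule irreducible_form_degree_pos[OF F])
  have "F \<noteq> 0" using F(1) by auto
  obtain i where i: "i < 5" "\<not> F dvd partial i F"
    using exists_partial_not_dvd[OF F(2) N \<open>F \<noteq> 0\<close>] by blast
  let ?S = "{t. \<forall>x\<in>L t. complex_eval (partial i F) x = 0}"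
  have "finite ?S"
  proof (rule ccontr)
    assume inf: "infinite ?S"
    have "complex_eval (partial i F) y = 0" if "complex_eval F y = 0" for y
    proof -
      have "res_at y = 0" using that R(1) j by simp
      then consider "y \<in> L_inf" | t where "y \<in> L t" using res_at_zero_iff by blast
      then show ?thesis
        using vanishes_on_family[OF inf] by cases blast+
    qed
    then have "F dvd partial i F"
      using F form_of_degree_vars_below partial_form[OF F(2)] by (intro irreducible_dvd_if_zeros) blast+
    with i show False by blast
  qed
  let ?crit = "{t. L t \<subseteq> perp (at_param ?a' t) (at_param ?b' t)}"
  \<comment> \<open>Excluded are the plane at infinity, the planes at which the family is stationary, and those on
    which the chosen partial derivative of \<open>F\<close> vanishes identically.\<close>
  define T0 where "T0 = {t. L t = L_inf} \<union> (\<Union>s\<in>?crit. {t. L t = L s}) \<union> ?S"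
  have "finite T0"
    unfolding T0_def using finite_fibre_inf finite_fibre crit \<open>finite ?S\<close> by blast
  moreover have "card {t. L t = L s} = j" if s: "s \<notin> T0" for s
  proof -
    let ?\<Theta> = "{t. L t = L s}"
    have s_inf: "L s \<noteq> L_inf" and s_S: "s \<notin> ?S" using s by (auto simp: T0_def)
    have s_crit: "\<not> L s \<subseteq> perp (at_param ?a' t) (at_param ?b' t)" if "t \<in> ?\<Theta>" for t
      using s that unfolding T0_def by auto
    let ?f = "\<lambda>t. nonvanishing_on (L s) (at_param ?a' t) (at_param ?b' t)"
    have "\<exists>x\<in>L s. x \<notin> L_inf \<and> {t. x \<in> L t} = ?\<Theta> \<and> (\<forall>\<Phi>\<in>insert (complex_eval (partial i F)) (?f ` ?\<Theta>). \<Phi> x \<noteq> 0)"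
    proof (rule exists_point_on_one_plane[OF s_inf])
      show "finite (insert (complex_eval (partial i F)) (?f ` ?\<Theta>))"
        using finite_fibre by simp
      fix \<Phi> assume "\<Phi> \<in> insert (complex_eval (partial i F)) (?f ` ?\<Theta>)"
      then consider "\<Phi> = complex_eval (partial i F)" | t where "t \<in> ?\<Theta>" "\<Phi> = ?f t" by blast
      then show "linewise_poly \<Phi> \<and> (\<exists>x\<in>L s. \<Phi> x \<noteq> 0)"
      proof cases
        case 1
        then show ?thesis using s_S linewise_poly_complex_eval by auto
      next
        case 2
        then show ?thesis using nonvanishing_on[OF s_crit] by blast
      qed
    qed
    then obtain x where x: "x \<in> L s" "x \<notin> L_inf" "{t. x \<in> L t} = ?\<Theta>"
      and x_gen: "\<forall>\<Phi>\<in>insert (complex_eval (partial i F)) (?f ` ?\<Theta>). \<Phi> x \<noteq> 0"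
      by (elim bexE conjE)
    have xF: "complex_eval (partial i F) x \<noteq> 0"
      by (rule bspec[OF x_gen]) (rule insertI1)
    have xf: "?f t x \<noteq> 0" if "t \<in> ?\<Theta>" for t
      by (rule bspec[OF x_gen]) (rule insertI2, rule imageI, rule that)
    define p where "p t = dot5 (at_param ?a' t) x" for t
    define r where "r t = dot5 (at_param ?b' t) x" for t
    have pr: "p t \<noteq> 0 \<or> r t \<noteq> 0" if "t \<in> ?\<Theta>" for t
      using nonvanishing_onD[OF xf[OF that]] by (auto simp: perp_def p_def r_def)
    let ?g = "\<lambda>t. dot5 (\<lambda>k. p t * poly (b k) t - r t * poly (a k) t)"
    let ?I = "insert (\<lambda>w. coeff (line_poly F x w) 1) (?g ` ?\<Theta>)"
    have "\<exists>w. coeff (pair_with a w) m \<noteq> 0 \<and> coeff (pair_with b w) n \<noteq> 0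
      \<and> coeff (pair_with a x * pair_with b w - pair_with b x * pair_with a w) (m + n) \<noteq> 0
      \<and> (\<forall>z. pair_with a x \<noteq> 0 \<longrightarrow> poly (pair_with a x) z = 0 \<longrightarrow> poly (pair_with a w) z \<noteq> 0)
      \<and> (\<forall>z. pair_with b x \<noteq> 0 \<longrightarrow> poly (pair_with b x) z = 0 \<longrightarrow> poly (pair_with b w) z \<noteq> 0)
      \<and> (\<forall>\<Phi>\<in>?I. \<Phi> w \<noteq> 0)"
    proof (rule exists_direction[OF x(2)])
      show "finite ?I" using finite_fibre by simp
      fix \<Phi> assume "\<Phi> \<in> ?I"
      then consider "\<Phi> = (\<lambda>w. coeff (line_poly F x w) 1)" | t where "t \<in> ?\<Theta>" "\<Phi> = ?g t" by blast
      then show "linewise_poly \<Phi> \<and> (\<exists>w. \<Phi> w \<noteq> 0)"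
      proof cases
        case 1
        have "\<Phi> (unit5 i) \<noteq> 0" unfolding 1 using coeff_line_poly_unit xF by simp
        then show ?thesis using 1 linewise_poly_derivative by blast
      next
        case 2
        then show ?thesis
          using indep5_combination_nonzero[OF indep pr[OF 2(1)]] linewise_poly_dot5 by blast
      qed
    qed
    then obtain w where w: "coeff (pair_with a w) m \<noteq> 0" "coeff (pair_with b w) n \<noteq> 0"
      "coeff (pair_with a x * pair_with b w - pair_with b x * pair_with a w) (m + n) \<noteq> 0"
      "\<And>z. pair_with a x \<noteq> 0 \<Longrightarrow> poly (pair_with a x) z = 0 \<Longrightarrow> poly (pair_with a w) z \<noteq> 0"
      "\<And>z. pair_with b x \<noteq> 0 \<Longrightarrow> poly (pair_with b x) z = 0 \<Longrightarrow> poly (pair_with b w) z \<noteq> 0"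
      and w_gen: "\<forall>\<Phi>\<in>?I. \<Phi> w \<noteq> 0"
      by (elim exE conjE) simp
    have wF: "coeff (line_poly F x w) 1 \<noteq> 0"
      by (rule bspec[OF w_gen]) (rule insertI1)
    have wg: "?g t w \<noteq> 0" if "t \<in> ?\<Theta>" for t
      by (rule bspec[OF w_gen]) (rule insertI2, rule imageI, rule that)
    have simple: "poly (pderiv (pair_with a x * pair_with b w - pair_with b x * pair_with a w)) t \<noteq> 0"
      if "poly (pair_with a x) t = 0" "poly (pair_with b x) t = 0" for t
    proof -
      have "t \<in> ?\<Theta>" using x(3) that by (auto simp: mem_L)
      then have nz: "p t * dot5 (at_param b t) w - r t * dot5 (at_param a t) w \<noteq> 0"
        using wg[of t] unfolding dot5_combination by blast
      have "poly (pderiv (pair_with a x * pair_with b w - pair_with b x * pair_with a w)) t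
          = p t * dot5 (at_param b t) w - r t * dot5 (at_param a t) w"
        using that by (simp add: pderiv_diff pderiv_mult pderiv_pair_with poly_pair_with p_def r_def)
      then show ?thesis using nz by simp
    qed
    obtain \<psi> where \<psi>: "polyfun \<psi>" "\<psi> 0 \<noteq> 0"
      and res: "\<And>s'. res_at (\<lambda>i. x i + s' * w i) = s' ^ card {t. x \<in> L t} * \<psi> s'"
      using resultant_pencil_order_sym[OF degree_pair_a degree_pair_b degree_pair_a degree_pair_b w simple]
      unfolding res_at_line mem_L by blast
    have "complex_eval F x = 0"
    proof -
      have "\<kappa> * complex_eval F x ^ j = 0" using res_at_zero[OF x(1,2)] R(1) by metis
      then show ?thesis using R(2) by simp
    qed
    then have "poly (line_poly F x w) 0 = 0" by (simp add: poly_line_poly)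
    then obtain \<chi> where \<chi>: "line_poly F x w = pCons 0 \<chi>"
      by (metis pCons_cases poly_0_coeff_0 coeff_pCons_0)
    have "poly \<chi> 0 \<noteq> 0" using wF by (simp add: \<chi> poly_0_coeff_0)
    have Fline: "complex_eval F (\<lambda>i. x i + s' * w i) = s' * poly \<chi> s'" for s'
      using poly_line_poly[of F x w s'] by (simp add: \<chi>)
    have "j = card {t. x \<in> L t}"
    proof (rule order_unique)
      show "polyfun (\<lambda>s'. \<kappa> * poly \<chi> s' ^ j)"
        by (intro polyfun_mult polyfun_const polyfun_power polyfun_poly)
      show "\<kappa> * poly \<chi> 0 ^ j \<noteq> 0" using R(2) \<open>poly \<chi> 0 \<noteq> 0\<close> by simp
      show "s' ^ j * (\<kappa> * poly \<chi> s' ^ j) = s' ^ card {t. x \<in> L t} * \<psi> s'" for s'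
        using res[of s'] unfolding R(1) Fline by (simp add: power_mult_distrib mult_ac)
    qed (fact \<psi>)+
    then show ?thesis using x(3) by simp
  qed
  ultimately show ?thesis using j finite_fibre by blast
qed

end

section \<open>The resultant of the moving planes as a form\<close>

abbreviation real_poly :: "real poly \<Rightarrow> complex poly" where
  "real_poly \<equiv> map_poly of_real"

lemma form_of_degree_add:
  assumes "form_of_degree m n F" "form_of_degree m n G"
  shows "form_of_degree m n (F + G)"
  using assms Poly_Mapping.keys_add[of F G] unfolding form_of_degree_def by blast

lemma form_of_degree_zero: "form_of_degree m n 0"
  by (simp add: form_of_degree_def)

lemma form_of_degree_sum:
  "(\<And>i. i \<in> I \<Longrightarrow> form_of_degree m n (F i)) \<Longrightarrow> form_of_degree m n (\<Sum>i\<in>I. F i)"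
  by (induction I rule: infinite_finite_induct) (auto intro: form_of_degree_add form_of_degree_zero)

lemma form_of_degree_prod:
  "finite I \<Longrightarrow> (\<And>i. i \<in> I \<Longrightarrow> form_of_degree m 1 (F i)) \<Longrightarrow> form_of_degree m (card I) (\<Prod>i\<in>I. F i)"
proof (induction I rule: finite_induct)
  case (insert i I)
  then show ?case using form_of_degree_mult[of m 1 "F i" "card I"] by simp
qed (simp add: form_of_degree_one)

lemma form_of_degree_var: "i < m \<Longrightarrow> form_of_degree m 1 (mpol_var i :: 'k::comm_ring_1 mpol)"
  by (simp add: form_of_degree_def mpol_var_def monom_degree_def)

lemma det_form:
  fixes M :: "'k::comm_ring_1 mpol mat"
  assumes "M \<in> carrier_mat n n" "\<And>i j. i < n \<Longrightarrow> j < n \<Longrightarrow> form_of_degree m 1 (M $$ (i, j))"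
  shows "form_of_degree m n (det M)"
proof -
  have "form_of_degree m (0 + n) (signof p * (\<Prod>i = 0..<n. M $$ (i, p i)))"
    if p: "p permutes {0..<n}" for p
  proof (rule form_of_degree_mult)
    have "form_of_degree m 0 (mpol_const (if sign p = 1 then 1 else - 1 :: 'k))"
      by (rule form_of_degree_const)
    moreover have "mpol_const (if sign p = 1 then 1 else - 1 :: 'k) = signof p"
      by (auto simp: sign_def mpol_const_def single_uminus)
    ultimately show "form_of_degree m 0 (signof p :: 'k mpol)" by simp
    have "form_of_degree m (card {0..<n}) (\<Prod>i = 0..<n. M $$ (i, p i))"
      using p by (intro form_of_degree_prod assms) auto
    then show "form_of_degree m n (\<Prod>i = 0..<n. M $$ (i, p i))" by simp
  qed
  then show ?thesis
    unfolding det_def'[OF assms(1)] by (intro form_of_degree_sum) simp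
qed

lemma coeff_dot_vars:
  assumes "dim_vec D = 5"
  shows "coeff (dot_vars D) k = (\<Sum>i<5. mpol_const (coeff (vec_index D i) k) * mpol_var i)"
  using assms
  by (simp add: dot_vars_def scalar_prod_def coeff_sum coeff_map_poly mpol_const_def atLeast0LessThan mult.commute)

lemma coeff_dot_vars_form: "dim_vec D = 5 \<Longrightarrow> form_of_degree 5 1 (coeff (dot_vars D) k)"
  unfolding coeff_dot_vars
  using form_of_degree_mult[OF form_of_degree_const form_of_degree_var] by (intro form_of_degree_sum) auto

lemma subst_coeff_dot_vars:
  assumes "dim_vec D = 5" "comm_ring_hom h"
  shows "mpol_subst h x (coeff (dot_vars D) k) = dot5 (\<lambda>i. h (coeff (vec_index D i) k)) x"
proof -
  interpret h: comm_ring_hom h by fact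
  interpret s: comm_ring_hom "mpol_subst h x" by (rule h.mpol_subst_hom)
  show ?thesis by (simp add: coeff_dot_vars[OF assms(1)] s.hom_sum s.hom_mult dot5_def)
qed

lemma le_vec_degree: "i < dim_vec D \<Longrightarrow> degree (vec_index D i) \<le> vec_degree D"
  unfolding vec_degree_def by (intro Max_ge) (auto simp: vec_set_def)

lemma vec_degree_le: "dim_vec D > 0 \<Longrightarrow> (\<And>i. i < dim_vec D \<Longrightarrow> degree (vec_index D i) \<le> d) \<Longrightarrow> vec_degree D \<le> d"
  unfolding vec_degree_def by (subst Max_le_iff) (auto simp: vec_set_def)

text \<open>
  This makes the resultant of \<open>dot_vars\<close> the one for the formal degrees \<open>vec_degree\<close>, which is
  needed to specialize it at points where a leading coefficient vanishes.
\<close>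

lemma degree_dot_vars:
  assumes "dim_vec D = 5"
  shows "degree (dot_vars D) = vec_degree (D :: real poly vec)"
proof (rule antisym)
  show "degree (dot_vars D) \<le> vec_degree D"
  proof (rule degree_le, intro allI impI)
    fix k assume "vec_degree D < k"
    then have "coeff (vec_index D i) k = 0" if "i < 5" for i
      using le_vec_degree[of i D] assms that by (intro coeff_eq_0) simp
    then show "coeff (dot_vars D) k = 0"
      by (simp add: coeff_dot_vars[OF assms] mpol_const_def)
  qed
  show "vec_degree D \<le> degree (dot_vars D)"
  proof (rule vec_degree_le)
    fix i assume "i < dim_vec D"
    then have i: "i < 5" using assms by simp
    show "degree (vec_index D i) \<le> degree (dot_vars D)"
    proof (rule degree_le, intro allI impI)
      fix k assume "degree (dot_vars D) < k"
      then have "mpol_subst (\<lambda>r. r) (unit5 i) (coeff (dot_vars D) k) = 0"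
        by (simp add: coeff_eq_0 mpol_subst_def)
      then show "coeff (vec_index D i) k = 0"
        unfolding subst_coeff_dot_vars[OF assms comm_ring_hom_id] dot5_unit[OF i] .
    qed
  qed (use assms in simp)
qed

lemma map_poly_dot_vars:
  assumes "dim_vec D = 5"
  shows "map_poly (\<lambda>G. complex_eval G y) (dot_vars D) = pair_with (\<lambda>i. real_poly (vec_index D i)) y"
proof (rule poly_eqI)
  fix k
  have "complex_eval 0 y = 0" by (simp add: mpol_subst_def)
  then show "coeff (map_poly (\<lambda>G. complex_eval G y) (dot_vars D)) k
      = coeff (pair_with (\<lambda>i. real_poly (vec_index D i)) y) k"
    by (simp add: coeff_map_poly subst_coeff_dot_vars[OF assms comm_ring_hom_of_real] coeff_pair_with)
qed

lemma complex_eval_resultant: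
  assumes "dim_vec D1 = 5" "dim_vec D2 = 5"
  shows "complex_eval (resultant (dot_vars D1) (dot_vars D2)) y = resultant_sub (vec_degree D1) (vec_degree D2)
     (pair_with (\<lambda>i. real_poly (vec_index D1 i)) y) (pair_with (\<lambda>i. real_poly (vec_index D2 i)) y)"
proof -
  have hom: "comm_ring_hom (\<lambda>G. complex_eval G y)"
    by (rule comm_ring_hom.mpol_subst_hom[OF comm_ring_hom_of_real])
  have 0: "complex_eval 0 y = 0" by (simp add: mpol_subst_def)
  show ?thesis
    unfolding resultant_sub[of "dot_vars D1"] resultant_sub_def comm_ring_hom.hom_det[OF hom, symmetric]
      sylvester_mat_sub_map[of "\<lambda>G. complex_eval G y", OF 0] map_poly_dot_vars[OF assms(1)]
      map_poly_dot_vars[OF assms(2)] degree_dot_vars[OF assms(1)] degree_dot_vars[OF assms(2)] ..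
qed

lemma resultant_form:
  assumes "dim_vec D1 = 5" "dim_vec D2 = 5"
  shows "form_of_degree 5 (vec_degree D1 + vec_degree D2) (resultant (dot_vars D1) (dot_vars (D2 :: real poly vec)))"
  unfolding resultant_sub degree_dot_vars[OF assms(1)] degree_dot_vars[OF assms(2)] resultant_sub_def
proof (rule det_form[OF sylvester_mat_sub_carrier])
  fix i j assume "i < vec_degree D1 + vec_degree D2" "j < vec_degree D1 + vec_degree D2"
  then show "form_of_degree 5 1 (sylvester_mat_sub (vec_degree D1) (vec_degree D2) (dot_vars D1) (dot_vars D2) $$ (i, j))"
    using coeff_dot_vars_form[OF assms(1)] coeff_dot_vars_form[OF assms(2)]
    by (simp add: sylvester_mat_sub_index form_of_degree_zero)
qed

section \<open>The resultant is a power of the implicit equation\<close>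

text \<open>
  Factors of forms are forms, so descending on the degree finds an irreducible factor with any
  property that passes from a product to one of its factors and that nonzero constants lack. It is
  used for being no unit and for vanishing on all planes of a family.
\<close>

lemma exists_irreducible_factor:
  fixes T :: "'k::field mpol"
  assumes "form_of_degree m d T" "T \<noteq> 0" "P T"
    and "\<And>c. c \<noteq> 0 \<Longrightarrow> \<not> P (mpol_const c)" "\<And>G H. P (G * H) \<Longrightarrow> P G \<or> P H"
  shows "\<exists>F. irreducible F \<and> F dvd T \<and> P F"
  using assms(1-3)
proof (induction d arbitrary: T rule: less_induct)
  case (less d)
  show ?case
  proof (cases "irreducible T")
    case True
    then show ?thesis using less.prems by auto
  next
    case False
    have "d \<noteq> 0"
    proof
      assume "d = 0"
      then obtain c where "c \<noteq> 0" "T = mpol_const c"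
        using form_degree_0_cases less.prems(1,2) by blast
      then show False using assms(4) less.prems(3) by blast
    qed
    then have "\<not> T dvd 1" using form_unit_iff[OF less.prems(1,2)] by blast
    then obtain G H where GH: "T = G * H" "\<not> G dvd 1" "\<not> H dvd 1"
      using False less.prems(2) unfolding irreducible_def by blast
    have nz: "G * H \<noteq> 0" "G \<noteq> 0" "H \<noteq> 0" using less.prems(2) GH(1) by auto
    obtain k l where kl: "form_of_degree m k G" "form_of_degree m l H" "k + l = d"
      using form_of_degree_factors[OF less.prems(1)[unfolded GH(1)] nz(1)] by blast
    have "k \<noteq> 0" "l \<noteq> 0"
      using form_unit_iff[OF kl(1) nz(2)] form_unit_iff[OF kl(2) nz(3)] GH(2,3) by blast+
    then have "k < d" "l < d" using kl(3) by auto
    from assms(5) less.prems(3) GH(1) consider "P G" | "P H" by blast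
    then show ?thesis
    proof cases
      case 1
      then show ?thesis
        using less.IH[OF \<open>k < d\<close> kl(1) nz(2)] GH(1) dvd_mult2 by blast
    next
      case 2
      then show ?thesis
        using less.IH[OF \<open>l < d\<close> kl(2) nz(3)] GH(1) dvd_mult by blast
    qed
  qed
qed

text \<open>
  Every irreducible factor of \<open>R\<close> divides \<open>F\<close>, because the zeros of the factor are zeros of \<open>R\<close>,
  and is therefore associated to \<open>F\<close>.
\<close>

lemma power_of_irreducible:
  assumes F: "irreducible F" "form_of_degree 5 N F"
    and R: "\<And>y. complex_eval R y = 0 \<Longrightarrow> complex_eval F y = 0"
    and T: "form_of_degree 5 d T" "T \<noteq> 0" "T dvd R"
  shows "\<exists>c j. c \<noteq> 0 \<and> T = mpol_const c * F ^ j"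
  using T
proof (induction d arbitrary: T rule: less_induct)
  case (less d)
  show ?case
  proof (cases "d = 0")
    case True
    then obtain c where "c \<noteq> 0" "T = mpol_const c"
      using form_degree_0_cases less.prems(1,2) by blast
    then show ?thesis by (intro exI[of _ c] exI[of _ 0]) simp
  next
    case False
    then have "\<not> T dvd 1" using form_unit_iff[OF less.prems(1,2)] by blast
    then obtain G where G: "irreducible G" "G dvd T"
      using exists_irreducible_factor[OF less.prems(1,2), of "\<lambda>X. \<not> X dvd 1"] mpol_const_unit
      by (metis mult_dvd_mono mult_1_left)
    obtain H where H: "T = G * H" using G(2) by (elim dvdE)
    obtain g where g: "form_of_degree 5 g G"
      using form_of_degree_factor less.prems(1,2) H by blast
    have "complex_eval F y = 0" if "complex_eval G y = 0" for y
    proof -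
      obtain K where "R = G * K" using G(2) less.prems(3) by (meson dvdE dvd_trans)
      then have "complex_eval R y = 0"
        using that comm_ring_hom.mpol_subst_mult[OF comm_ring_hom_of_real] by simp
      then show ?thesis by (rule R)
    qed
    then have "G dvd F"
      using G(1) g F(2) form_of_degree_vars_below by (intro irreducible_dvd_if_zeros) blast+
    then obtain K where K: "F = G * K" by (elim dvdE)
    then have "K dvd 1"
      using F(1) G(1) irreducibleD irreducible_not_unit by metis
    then have "F dvd G" unfolding K by (metis mult_dvd_mono dvd_refl mult_1_right)
    then have "F dvd T" using G(2) dvd_trans by blast
    then obtain T' where T': "T = F * T'" by (elim dvdE)
    have nz: "F * T' \<noteq> 0" "F \<noteq> 0" "T' \<noteq> 0" using less.prems(2) T' by auto
    obtain k d' where d': "form_of_degree 5 k F" "form_of_degree 5 d' T'" "k + d' = d"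
      using form_of_degree_factors[OF less.prems(1)[unfolded T'] nz(1)] by blast
    have "d' < d" using irreducible_form_degree_pos[OF F(1) d'(1)] d'(3) by simp
    moreover have "T' dvd R" using less.prems(3) T' by (metis dvd_mult_right)
    ultimately obtain c j where "c \<noteq> 0" "T' = mpol_const c * F ^ j"
      using less.IH[OF _ d'(2) nz(3)] by blast
    then show ?thesis
      by (intro exI[of _ c] exI[of _ "Suc j"]) (simp add: T' mult_ac)
  qed
qed

context plane_family
begin

lemma L_line: "u \<in> L t \<Longrightarrow> v \<in> L t \<Longrightarrow> (\<lambda>i. u i + z * v i) \<in> L t"
  by (simp add: L_def perp_def dot5_add_smult)

definition vanishes_on_planes :: "real mpol \<Rightarrow> bool" where
  "vanishes_on_planes G \<longleftrightarrow> (\<forall>t. \<forall>y\<in>L t. complex_eval G y = 0)"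

lemma vanishes_on_planes_inf: "vanishes_on_planes G \<Longrightarrow> y \<in> L_inf \<Longrightarrow> complex_eval G y = 0"
  using vanishes_on_family(2)[of UNIV] infinite_UNIV_char_0[where 'a = complex]
  by (auto simp: vanishes_on_planes_def)

text \<open>
  The ideal of the family is prime: on each plane one of the two factors vanishes, so one of them
  vanishes on infinitely many planes, hence on all.
\<close>

lemma vanishes_on_planes_mult:
  assumes "vanishes_on_planes (G * H)"
  shows "vanishes_on_planes G \<or> vanishes_on_planes H"
proof -
  let ?T = "\<lambda>G. {t. \<forall>y\<in>L t. complex_eval G y = 0}"
  have "t \<in> ?T G \<union> ?T H" for t
  proof (rule ccontr)
    assume "t \<notin> ?T G \<union> ?T H"
    then obtain u v where "u \<in> L t" "complex_eval G u \<noteq> 0" "v \<in> L t" "complex_eval H v \<noteq> 0" by blast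
    then obtain x where "x \<in> L t" "complex_eval G x \<noteq> 0" "complex_eval H x \<noteq> 0"
      using generic_point_two[OF line_closed_perp linewise_poly_complex_eval linewise_poly_complex_eval]
      unfolding L_def by blast
    then show False
      using assms comm_ring_hom.mpol_subst_mult[OF comm_ring_hom_of_real] by (auto simp: vanishes_on_planes_def)
  qed
  then have UN: "?T G \<union> ?T H = UNIV" by blast
  have "infinite (?T G \<union> ?T H)"
    unfolding UN by (rule infinite_UNIV_char_0)
  then have "infinite (?T G) \<or> infinite (?T H)"
    unfolding finite_Un by blast
  moreover have "vanishes_on_planes K" if "infinite (?T K)" for K
    unfolding vanishes_on_planes_def using vanishes_on_family(1)[OF that] by blast
  ultimately show ?thesis by blast
qed

text \<open>
  At a point of \<open>L t\<close> outside \<open>L_inf\<close> the two polynomials have the common root \<open>t\<close> and one of them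
  has its formal degree. The other points of \<open>L t\<close> are limits along lines.
\<close>

lemma vanishes_on_planes_if_res_at:
  assumes "\<And>y. complex_eval R y = res_at y" "finite {t. L t = L_inf}"
  shows "vanishes_on_planes R"
proof -
  have "complex_eval R y = 0" if t: "L t \<noteq> L_inf" and y: "y \<in> L t" for t y
  proof -
    obtain v where v: "v \<in> L t" "v \<notin> L_inf" using L_subset_inf_imp_eq t by blast
    then obtain w where w: "dot5 w v \<noteq> 0" "\<And>x. x \<in> L_inf \<Longrightarrow> dot5 w x = 0"
      by (auto simp: L_inf_def perp_def)
    let ?x = "\<lambda>z i. v i + z * (y i + (-1) * v i)"
    have xL: "?x z \<in> L t" for z
      by (intro L_line v y)
    have "complex_eval R (?x 1) = 0"
    proof (rule polyfun_eqI[of "\<lambda>z. complex_eval R (?x z)"])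
      show "polyfun (\<lambda>z. complex_eval R (?x z))"
        by (rule linewise_polyD[OF linewise_poly_complex_eval])
      have "finite {z. dot5 w (?x z) = 0}"
        using w(1) by (intro polyfun_zero_or_finite[of _ 0] linewise_polyD linewise_poly_dot5) simp
      moreover have "{z. complex_eval R (?x z) \<noteq> 0} \<subseteq> {z. dot5 w (?x z) = 0}"
        using w(2) res_at_zero[OF xL] assms(1) by auto
      ultimately show "finite {z. complex_eval R (?x z) \<noteq> 0}" by (rule rev_finite_subset)
    qed (rule polyfun_const)
    then show ?thesis by simp
  qed
  moreover have "infinite (- {t. L t = L_inf})"
    unfolding finite_compl[OF assms(2)] by (rule infinite_UNIV_char_0)
  ultimately show ?thesis
    unfolding vanishes_on_planes_def
    using vanishes_on_family(1)[of "- {t. L t = L_inf}" R] by blast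
qed

end

section \<open>Mu-bases\<close>

lemma quasi_module_iff:
  fixes A B C :: "'a::idom vec"
  assumes "A \<in> carrier_vec m" "B \<in> carrier_vec m"
  shows "C \<in> quasi_module m A B \<longleftrightarrow> C \<in> carrier_vec m \<and> (\<exists>\<alpha> \<beta>. \<forall>k<m.
     to_fract (vec_index C k) = \<alpha> * to_fract (vec_index A k) + \<beta> * to_fract (vec_index B k))"
proof -
  have "map_vec to_fract C = \<alpha> \<cdot>\<^sub>v map_vec to_fract A + \<beta> \<cdot>\<^sub>v map_vec to_fract B \<longleftrightarrow>
     (\<forall>k<m. to_fract (vec_index C k) = \<alpha> * to_fract (vec_index A k) + \<beta> * to_fract (vec_index B k))"
    if "C \<in> carrier_vec m" for \<alpha> \<beta>
    using that assms by (auto simp: vec_eq_iff)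
  then show ?thesis
    unfolding quasi_module_def mem_Collect_eq by (intro conj_cong refl) simp
qed

lemma lin_indep_pair_iff:
  fixes A B :: "'a::idom vec"
  shows "lin_indep_pair m A B \<longleftrightarrow> A \<in> carrier_vec m \<and> B \<in> carrier_vec m \<and>
     (\<forall>\<alpha> \<beta>. (\<forall>k<m. \<alpha> * vec_index A k + \<beta> * vec_index B k = 0) \<longrightarrow> \<alpha> = 0 \<and> \<beta> = 0)"
proof -
  have "\<alpha> \<cdot>\<^sub>v A + \<beta> \<cdot>\<^sub>v B = 0\<^sub>v m \<longleftrightarrow> (\<forall>k<m. \<alpha> * vec_index A k + \<beta> * vec_index B k = 0)"
    if "A \<in> carrier_vec m" "B \<in> carrier_vec m" for \<alpha> \<beta>
    using that by (auto simp: vec_eq_iff)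
  then show ?thesis
    unfolding lin_indep_pair_def by (intro conj_cong refl) simp
qed

abbreviation plucker_vec :: "'a::comm_ring_1 vec \<Rightarrow> 'a vec \<Rightarrow> nat \<Rightarrow> nat \<Rightarrow> 'a" where
  "plucker_vec A B \<equiv> plucker_coord (vec_index A) (vec_index B)"

text \<open>
  Cramer's rule without denominators: it survives evaluation at any parameter and shows that the
  elements of the module stay in the span of the generators there.
\<close>

lemma quasi_module_cramer:
  fixes A B C :: "'a::idom vec"
  assumes "A \<in> carrier_vec m" "B \<in> carrier_vec m" "C \<in> quasi_module m A B"
    and "i < m" "j < m" "k < m"
  shows "plucker_vec A B i j * vec_index C k
    = plucker_vec C B i j * vec_index A k
    + plucker_vec A C i j * vec_index B k"
proof -
  obtain \<alpha> \<beta> where C: "\<And>k. k < m \<Longrightarrow>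
      to_fract (vec_index C k) = \<alpha> * to_fract (vec_index A k) + \<beta> * to_fract (vec_index B k)"
    using assms(3) unfolding quasi_module_iff[OF assms(1,2)] by blast
  have "to_fract (plucker_vec A B i j * vec_index C k)
    = to_fract (plucker_vec C B i j * vec_index A k
    + plucker_vec A C i j * vec_index B k)"
    by (simp add: plucker_coord_def to_fract_hom.hom_minus to_fract_hom.hom_mult to_fract_hom.hom_add C assms(4-6))
      (simp add: algebra_simps)
  then show ?thesis by (simp only: to_fract_eq_iff)
qed

lemma quasi_module_plucker_proportional:
  fixes A B C C' :: "'a::idom vec"
  assumes "A \<in> carrier_vec m" "B \<in> carrier_vec m" "C \<in> quasi_module m A B" "C' \<in> quasi_module m A B"
    and "i < m" "j < m" "k < m" "l < m"
  shows "plucker_vec C C' i j * plucker_vec A B k l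
    = plucker_vec C C' k l * plucker_vec A B i j"
proof -
  obtain \<alpha> \<beta> where C: "\<And>k. k < m \<Longrightarrow>
      to_fract (vec_index C k) = \<alpha> * to_fract (vec_index A k) + \<beta> * to_fract (vec_index B k)"
    using assms(3) unfolding quasi_module_iff[OF assms(1,2)] by blast
  obtain \<gamma> \<delta> where C': "\<And>k. k < m \<Longrightarrow>
      to_fract (vec_index C' k) = \<gamma> * to_fract (vec_index A k) + \<delta> * to_fract (vec_index B k)"
    using assms(4) unfolding quasi_module_iff[OF assms(1,2)] by blast
  have "to_fract (plucker_vec C C' i j)
      = (\<alpha> * \<delta> - \<beta> * \<gamma>) * to_fract (plucker_vec A B i j)"
    if "i < m" "j < m" for i j
    by (simp add: plucker_coord_def to_fract_hom.hom_minus to_fract_hom.hom_mult C C' that)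
      (simp add: algebra_simps)
  then have "to_fract (plucker_vec C C' i j * plucker_vec A B k l)
    = to_fract (plucker_vec C C' k l * plucker_vec A B i j)"
    by (simp add: to_fract_hom.hom_mult assms(5-8))
  then show ?thesis by (simp only: to_fract_eq_iff)
qed

lemma self_in_quasi_module:
  fixes A B :: "'a::idom vec"
  assumes "A \<in> carrier_vec m" "B \<in> carrier_vec m"
  shows "A \<in> quasi_module m A B" "B \<in> quasi_module m A B"
proof -
  show "A \<in> quasi_module m A B"
    unfolding quasi_module_iff[OF assms] 
    by (rule conjI, rule assms, rule exI[of _ 1], rule exI[of _ 0]) simp
  show "B \<in> quasi_module m A B"
    unfolding quasi_module_iff[OF assms]
    by (rule conjI, rule assms, rule exI[of _ 0], rule exI[of _ 1]) simp
qed

lemma quasi_module_swap: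
  fixes A B :: "'a::idom vec"
  assumes "A \<in> carrier_vec m" "B \<in> carrier_vec m"
  shows "quasi_module m B A = quasi_module m A B"
  unfolding set_eq_iff quasi_module_iff[OF assms] quasi_module_iff[OF assms(2,1)]
  by (subst (2) ex_comm) (simp add: add.commute)

lemma quasi_generators_swap:
  fixes A B :: "'a::idom vec"
  assumes "quasi_generators m M A B"
  shows "quasi_generators m M B A"
proof -
  have carrier: "A \<in> carrier_vec m" "B \<in> carrier_vec m" and M: "quasi_module m A B = M"
    and ind: "\<And>\<alpha> \<beta>. \<forall>k<m. \<alpha> * vec_index A k + \<beta> * vec_index B k = 0 \<Longrightarrow> \<alpha> = 0 \<and> \<beta> = 0"
    using assms unfolding quasi_generators_def lin_indep_pair_iff by blast+
  have "\<alpha> = 0 \<and> \<beta> = 0" if "\<forall>k<m. \<alpha> * vec_index B k + \<beta> * vec_index A k = 0" for \<alpha> \<beta>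
    using ind[of \<beta> \<alpha>] that by (simp add: add.commute)
  then show ?thesis
    using carrier M quasi_module_swap[OF carrier] unfolding quasi_generators_def lin_indep_pair_iff by blast
qed

text \<open>
  The exchange step for lowering degrees: a generator is replaced by a combination divided by \<open>p\<close>.
\<close>

lemma quasi_generators_exchange:
  fixes A B C :: "'a::idom vec"
  assumes AB: "quasi_generators m M A B" and C: "C \<in> carrier_vec m" and "p \<noteq> 0" "s \<noteq> 0"
    and eq: "\<And>k. k < m \<Longrightarrow> p * vec_index C k = r * vec_index A k + s * vec_index B k"
  shows "quasi_generators m M A C"
proof -
  have carrier: "A \<in> carrier_vec m" "B \<in> carrier_vec m"
    using AB by (auto simp: quasi_generators_def lin_indep_pair_def)
  let ?f = to_fract
  have nz: "?f p \<noteq> 0" "?f s \<noteq> 0" using assms by simp_all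
  have feq: "?f p * ?f (vec_index C k) = ?f r * ?f (vec_index A k) + ?f s * ?f (vec_index B k)" if "k < m" for k
    using arg_cong[OF eq[OF that], of ?f] by (simp add: to_fract_hom.hom_mult to_fract_hom.hom_add)
  have C_eq: "?f (vec_index C k) = ?f r / ?f p * ?f (vec_index A k) + ?f s / ?f p * ?f (vec_index B k)" if "k < m" for k
    using feq[OF that] nz by (simp add: field_simps)
  have B_eq: "?f (vec_index B k) = ?f p / ?f s * ?f (vec_index C k) - ?f r / ?f s * ?f (vec_index A k)" if "k < m" for k
    using feq[OF that] nz by (simp add: field_simps)
  have "quasi_module m A C = quasi_module m A B"
  proof (rule Set.set_eqI)
    fix X
    show "X \<in> quasi_module m A C \<longleftrightarrow> X \<in> quasi_module m A B"
      unfolding quasi_module_iff[OF carrier] quasi_module_iff[OF carrier(1) C]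
    proof (intro conj_cong refl iffI)
      assume "\<exists>\<alpha> \<beta>. \<forall>k<m. ?f (vec_index X k) = \<alpha> * ?f (vec_index A k) + \<beta> * ?f (vec_index C k)"
      then obtain \<alpha> \<beta> where "\<And>k. k < m \<Longrightarrow> ?f (vec_index X k) = \<alpha> * ?f (vec_index A k) + \<beta> * ?f (vec_index C k)"
        by blast
      then have "?f (vec_index X k) = (\<alpha> + \<beta> * (?f r / ?f p)) * ?f (vec_index A k) + (\<beta> * (?f s / ?f p)) * ?f (vec_index B k)"
        if "k < m" for k
        using C_eq[OF that] that by (simp add: algebra_simps)
      then show "\<exists>\<alpha> \<beta>. \<forall>k<m. ?f (vec_index X k) = \<alpha> * ?f (vec_index A k) + \<beta> * ?f (vec_index B k)"
        by blast
    next
      assume "\<exists>\<alpha> \<beta>. \<forall>k<m. ?f (vec_index X k) = \<alpha> * ?f (vec_index A k) + \<beta> * ?f (vec_index B k)"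
      then obtain \<alpha> \<beta> where X: "\<And>k. k < m \<Longrightarrow> ?f (vec_index X k) = \<alpha> * ?f (vec_index A k) + \<beta> * ?f (vec_index B k)"
        by blast
      then have "?f (vec_index X k) = (\<alpha> - \<beta> * (?f r / ?f s)) * ?f (vec_index A k) + (\<beta> * (?f p / ?f s)) * ?f (vec_index C k)"
        if "k < m" for k
      proof -
        have "?f (vec_index X k) = \<alpha> * ?f (vec_index A k)
            + \<beta> * (?f p / ?f s * ?f (vec_index C k) - ?f r / ?f s * ?f (vec_index A k))"
          by (simp only: X[OF that] B_eq[OF that])
        then show ?thesis by (simp add: algebra_simps)
      qed
      then show "\<exists>\<alpha> \<beta>. \<forall>k<m. ?f (vec_index X k) = \<alpha> * ?f (vec_index A k) + \<beta> * ?f (vec_index C k)"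
        by blast
    qed
  qed
  moreover have "\<alpha> = 0 \<and> \<beta> = 0" if zero: "\<forall>k<m. \<alpha> * vec_index A k + \<beta> * vec_index C k = 0" for \<alpha> \<beta>
  proof -
    have "(p * \<alpha> + \<beta> * r) * vec_index A k + (\<beta> * s) * vec_index B k = 0" if "k < m" for k
    proof -
      have "(p * \<alpha> + \<beta> * r) * vec_index A k + (\<beta> * s) * vec_index B k
          = p * (\<alpha> * vec_index A k) + \<beta> * (r * vec_index A k + s * vec_index B k)"
        by (simp add: algebra_simps)
      also have "\<dots> = p * (\<alpha> * vec_index A k + \<beta> * vec_index C k)"
        unfolding eq[OF that, symmetric] by (simp add: algebra_simps)
      finally show ?thesis using zero that by simp
    qed
    then have "p * \<alpha> + \<beta> * r = 0" "\<beta> * s = 0"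
      using AB unfolding quasi_generators_def lin_indep_pair_iff by blast+
    then show ?thesis using assms(3,4) by simp
  qed
  then have "lin_indep_pair m A C"
    unfolding lin_indep_pair_iff using carrier(1) C by blast
  ultimately show ?thesis
    using AB by (simp add: quasi_generators_def)
qed

text \<open>
  Replacing the Pluecker coordinates in \<open>wedge\<close> by an arbitrary array lets evaluation and scaling act
  on the array.
\<close>

definition wedge_vec :: "(nat \<Rightarrow> nat \<Rightarrow> 'a) \<Rightarrow> 'a vec" where
  "wedge_vec f = vec_of_list [f i j. i \<leftarrow> [0..<5], j \<leftarrow> [Suc i..<5]]"

lemma wedge_eq_wedge_vec:
  "dim_vec A = 5 \<Longrightarrow> wedge A B = wedge_vec (plucker_vec A B)"
  by (simp add: wedge_def wedge_vec_def plucker_coord_def)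

lemma all_less_5: "(\<forall>j<5. P j) \<longleftrightarrow> P 0 \<and> P 1 \<and> P 2 \<and> P 3 \<and> P (4::nat)"
  by (auto simp: numeral_eq_Suc less_Suc_eq)

lemma wedge_list:
  "[f i j. i \<leftarrow> [0..<5], j \<leftarrow> [Suc i..<5]] =
    [f 0 1, f 0 2, f 0 3, f 0 4, f 1 2, f 1 3, f 1 4, f 2 3, f 2 4, f 3 (4::nat)]"
  by (simp add: upt_rec numeral_eq_Suc)

lemma all_pairs:
  "(\<forall>j<5. \<forall>i<j. P i j) \<longleftrightarrow> P 0 1 \<and> P 0 2 \<and> P 0 3 \<and> P 0 4 \<and> P 1 2 \<and> P 1 3 \<and> P 1 4 \<and> P 2 3 \<and> P 2 4 \<and> P 3 (4::nat)"
proof -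
  have "(\<forall>j<5. \<forall>i<j. P i j) \<longleftrightarrow> (\<forall>j<5. \<forall>i<5. i < j \<longrightarrow> P i j)" by fastforce
  then show ?thesis unfolding all_less_5 by auto
qed

lemma wedge_vec_eq_iff: "wedge_vec f = wedge_vec g \<longleftrightarrow> (\<forall>j<5. \<forall>i<j. f i j = g i j)"
  unfolding wedge_vec_def wedge_list all_pairs
  by (auto dest: arg_cong[of _ _ list_of_vec] simp: list_vec)

lemma map_vec_wedge_vec: "map_vec h (wedge_vec f) = wedge_vec (\<lambda>i j. h (f i j))"
  unfolding wedge_vec_def wedge_list vec_of_list_map[symmetric] by (simp only: list.map)

lemma set_wedge_vec: "set\<^sub>v (wedge_vec f) = {f i j | i j. i < j \<and> j < 5}"
proof -
  have "x \<in> {f i j | i j. i < j \<and> j < 5} \<longleftrightarrow> \<not> (\<forall>j<5. \<forall>i<j. f i j \<noteq> x)" for x by blast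
  then have "x \<in> {f i j | i j. i < j \<and> j < 5} \<longleftrightarrow> x \<in> set\<^sub>v (wedge_vec f)" for x
    unfolding all_pairs wedge_vec_def wedge_list by (auto simp: set_list_of_vec list_vec simp flip: set_list_of_vec)
  then show ?thesis by blast
qed

lemma zero_wedge_vec: "0\<^sub>v 10 = wedge_vec (\<lambda>i j. 0 :: 'b::zero)"
  unfolding wedge_vec_def wedge_list by (rule eq_vecI) (auto simp: less_Suc_eq numeral_eq_Suc)

lemma smult_wedge_vec: "\<gamma> \<cdot>\<^sub>v wedge_vec v = wedge_vec (\<lambda>i j. \<gamma> * v i j)" for \<gamma> :: "'b::ring"
proof -
  have "\<gamma> \<cdot>\<^sub>v wedge_vec v = map_vec (\<lambda>z. \<gamma> * z) (wedge_vec v)" by (rule eq_vecI) simp_all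
  then show ?thesis by (simp add: map_vec_wedge_vec)
qed

lemma plucker_coord_antisym: "plucker_coord a b i j = - plucker_coord a b j (i :: nat)"
  by (simp add: plucker_coord_def)

lemma plucker_coord_all:
  assumes "\<And>i j. i < j \<Longrightarrow> j < 5 \<Longrightarrow> P (plucker_coord a b i j)" "P 0" "\<And>z. P z \<Longrightarrow> P (- z)"
  shows "i < 5 \<Longrightarrow> j < 5 \<Longrightarrow> P (plucker_coord a b i j)"
proof (cases i j rule: linorder_cases)
  case greater
  assume "i < 5" "j < 5"
  with greater show ?thesis using assms(1,3) plucker_coord_antisym[of a b i j] by metis
qed (use assms(1,2) in \<open>simp_all add: plucker_coord_def\<close>)

lemma vec_degree_wedge_le_iff:
  fixes A B :: "'a::idom poly vec"
  assumes "dim_vec A = 5"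
  shows "vec_degree (wedge A B) \<le> d \<longleftrightarrow> (\<forall>i<5. \<forall>j<5. degree (plucker_vec A B i j) \<le> d)"
proof -
  let ?P = "plucker_vec A B"
  have "finite {?P i j | i j. i < j \<and> j < 5}"
    unfolding set_wedge_vec[symmetric] by (simp add: vec_set_def)
  moreover have "?P 0 1 \<in> {?P i j | i j. i < j \<and> j < 5}" by force
  ultimately have "vec_degree (wedge A B) \<le> d \<longleftrightarrow> (\<forall>i j. i < j \<longrightarrow> j < 5 \<longrightarrow> degree (?P i j) \<le> d)"
    unfolding vec_degree_def wedge_eq_wedge_vec[OF assms] set_wedge_vec by (subst Max_le_iff) auto
  also have "\<dots> \<longleftrightarrow> (\<forall>i<5. \<forall>j<5. degree (?P i j) \<le> d)"
    using plucker_coord_all[of "\<lambda>p. degree p \<le> d" "vec_index A" "vec_index B"] by (auto simp: dest: less_trans)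
  finally show ?thesis .
qed

lemma lin_indep_plucker_nonzero:
  fixes A B :: "'a::idom vec"
  assumes "lin_indep_pair 5 A B"
  shows "\<exists>i<5. \<exists>j<5. plucker_vec A B i j \<noteq> 0"
proof (rule ccontr)
  assume "\<not> ?thesis"
  then have zero: "plucker_vec A B i j = 0" if "i < 5" "j < 5" for i j
    using that by blast
  have ind: "\<And>\<alpha> \<beta>. (\<forall>k<5. \<alpha> * vec_index A k + \<beta> * vec_index B k = 0) \<Longrightarrow> \<alpha> = 0 \<and> \<beta> = 0"
    using assms unfolding lin_indep_pair_iff by blast
  have "vec_index A i = 0" if "i < 5" for i
    using ind[of "- vec_index B i" "vec_index A i"] zero[OF that] by (auto simp: plucker_coord_def algebra_simps)
  then show False using ind[of 1 0] by simp
qed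

lemma mu_basis_minimal:
  fixes A B :: "'a::idom poly vec"
  assumes "mu_basis 5 M D1 D2" "quasi_generators 5 M A B"
    and "\<And>i j. i < 5 \<Longrightarrow> j < 5 \<Longrightarrow> degree (plucker_vec A B i j) \<le> d"
  shows "vec_degree D1 + vec_degree D2 \<le> d"
proof -
  have "dim_vec A = 5"
    using assms(2) by (auto simp: quasi_generators_def lin_indep_pair_def)
  have "vec_degree D1 + vec_degree D2 = module_degree 5 M"
    using assms(1) by (simp add: mu_basis_def)
  also have "\<dots> \<le> vec_degree (wedge A B)"
    unfolding module_degree_def by (rule Least_le) (use assms(2) in blast)
  also have "\<dots> \<le> d"
    using vec_degree_wedge_le_iff[OF \<open>dim_vec A = 5\<close>] assms(3) by blast
  finally show ?thesis .
qed

lemma degree_plucker_coord_le: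
  assumes "dim_vec A = 5" "dim_vec B = 5" "i < 5" "j < 5"
  shows "degree (plucker_vec A B i j) \<le> vec_degree A + vec_degree (B :: 'a::idom poly vec)"
  unfolding plucker_coord_def using assms le_vec_degree[of _ A] le_vec_degree[of _ B]
  by (intro degree_diff_le order_trans[OF degree_mult_le] add_mono) auto

text \<open>
  If an irreducible \<open>p\<close> divided all Pluecker coordinates, the two generators would be dependent modulo
  \<open>p\<close>. Dividing a dependency with reduced coefficients by \<open>p\<close> gives a replacement for one of them, and
  the degree of the Pluecker coordinates drops below its minimum.
\<close>

lemma mu_basis_plucker_primitive:
  fixes D1 D2 :: "'a::field_gcd poly vec"
  assumes mu: "mu_basis 5 M D1 D2" and p: "irreducible p"
  shows "\<exists>i<5. \<exists>j<5. \<not> p dvd plucker_vec D1 D2 i j"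
proof (rule ccontr)
  assume "\<not> ?thesis"
  then have dvd: "p dvd plucker_vec D1 D2 i j" if "i < 5" "j < 5" for i j
    using that by blast
  let ?N = "vec_degree D1 + vec_degree D2"
  have gen: "quasi_generators 5 M D1 D2" using mu by (simp add: mu_basis_def)
  then have dims: "dim_vec D1 = 5" "dim_vec D2 = 5" and ind: "lin_indep_pair 5 D1 D2"
    by (auto simp: quasi_generators_def lin_indep_pair_def)
  have "p \<noteq> 0" using p by auto
  have "degree p > 0"
    using p by (metis \<open>p \<noteq> 0\<close> gr0I irreducible_not_unit is_unit_iff_degree)
  have reduce: False
    if "quasi_generators 5 M A B" "quasi_generators 5 M A C" "degree r < degree p" "r \<noteq> 0"
      and le: "\<And>i j. i < 5 \<Longrightarrow> j < 5 \<Longrightarrow> degree (plucker_vec A B i j) \<le> ?N"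
      and eq: "\<And>i j. i < 5 \<Longrightarrow> j < 5 \<Longrightarrow> p * plucker_vec A C i j
         = r * plucker_vec A B i j" for A B C r
  proof -
    have small: "degree (plucker_vec A C i j) \<le> ?N - 1"
      and pos: "plucker_vec A C i j \<noteq> 0 \<Longrightarrow> ?N > 0" if ij: "i < 5" "j < 5" for i j
    proof -
      let ?X = "plucker_vec A C i j" and ?Y = "plucker_vec A B i j"
      have "degree ?X < ?N" if "?X \<noteq> 0"
      proof -
        have "?Y \<noteq> 0" using eq[OF ij] that \<open>p \<noteq> 0\<close> by auto
        then have "degree p + degree ?X = degree r + degree ?Y"
          using arg_cong[OF eq[OF ij], of degree] that \<open>p \<noteq> 0\<close> \<open>r \<noteq> 0\<close> by (simp add: degree_mult_eq)
        then show ?thesis using le[OF ij] \<open>degree r < degree p\<close> by linarith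
      qed
      then show "degree ?X \<le> ?N - 1" "?X \<noteq> 0 \<Longrightarrow> ?N > 0"
        by (cases "?X = 0"; force)+
    qed
    have "lin_indep_pair 5 A C"
      using \<open>quasi_generators 5 M A C\<close> by (simp add: quasi_generators_def)
    from lin_indep_plucker_nonzero[OF this]
    obtain i j where "i < 5" "j < 5" "plucker_vec A C i j \<noteq> 0"
      by blast
    then have "?N > 0" by (rule pos)
    moreover have "?N \<le> ?N - 1"
      by (rule mu_basis_minimal[OF mu \<open>quasi_generators 5 M A C\<close> small])
    ultimately show False by linarith
  qed
  show False
  proof (cases "\<forall>k<5. p dvd vec_index D1 k")
    case True
    define C where "C = vec 5 (\<lambda>k. vec_index D1 k div p)"
    have C: "p * vec_index C k = vec_index D1 k" if "k < 5" for k
      using True that by (simp add: C_def)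
    have "quasi_generators 5 M D2 C"
      by (rule quasi_generators_exchange[OF quasi_generators_swap[OF gen], of C p 1 0])
        (use C \<open>p \<noteq> 0\<close> in \<open>auto simp: C_def\<close>)
    moreover have "p * plucker_vec D2 C i j = 1 * plucker_vec D2 D1 i j"
      if "i < 5" "j < 5" for i j
    proof -
      have "p * plucker_vec D2 C i j
          = vec_index D2 i * (p * vec_index C j) - vec_index D2 j * (p * vec_index C i)"
        by (simp add: plucker_coord_def algebra_simps)
      then show ?thesis unfolding C[OF that(1)] C[OF that(2)] by (simp add: plucker_coord_def)
    qed
    ultimately show False
      using degree_plucker_coord_le[OF dims(2,1)] \<open>degree p > 0\<close>
      by (intro reduce[OF quasi_generators_swap[OF gen], of C 1]) (auto simp: add.commute)
  next
    case False
    then obtain i where i: "i < 5" "\<not> p dvd vec_index D1 i" by blast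
    define r where "r = vec_index D1 i mod p"
    define s where "s = vec_index D2 i mod p"
    have "r \<noteq> 0" using i(2) by (simp add: r_def mod_eq_0_iff_dvd)
    then have "degree r < degree p" using degree_mod_less'[of p "vec_index D1 i"] \<open>p \<noteq> 0\<close> by (simp add: r_def)
    have "p dvd r * vec_index D2 k - s * vec_index D1 k" if "k < 5" for k
    proof -
      have 1: "p dvd (vec_index D1 i - r) * vec_index D2 k" "p dvd (vec_index D2 i - s) * vec_index D1 k"
        by (simp_all add: r_def s_def minus_mod_eq_mult_div)
      have 2: "p dvd vec_index D1 i * vec_index D2 k - vec_index D1 k * vec_index D2 i"
        using dvd[OF i(1) that] by (simp add: plucker_coord_def)
      have "r * vec_index D2 k - s * vec_index D1 k
          = (vec_index D1 i * vec_index D2 k - vec_index D1 k * vec_index D2 i)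
            - (vec_index D1 i - r) * vec_index D2 k + (vec_index D2 i - s) * vec_index D1 k"
        by (simp add: algebra_simps)
      also have "p dvd \<dots>" by (rule dvd_add[OF dvd_diff[OF 2 1(1)] 1(2)])
      finally show ?thesis .
    qed
    moreover define C where "C = vec 5 (\<lambda>k. (r * vec_index D2 k - s * vec_index D1 k) div p)"
    ultimately have C: "p * vec_index C k = - s * vec_index D1 k + r * vec_index D2 k" if "k < 5" for k
      using that by (simp add: C_def)
    have gen': "quasi_generators 5 M D1 C"
      by (rule quasi_generators_exchange[OF gen, of C p r "- s"])
        (use C \<open>p \<noteq> 0\<close> \<open>r \<noteq> 0\<close> in \<open>auto simp: C_def\<close>)
    have "p * plucker_vec D1 C i j = r * plucker_vec D1 D2 i j"
      if "i < 5" "j < 5" for i j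
    proof -
      have "p * plucker_vec D1 C i j
          = vec_index D1 i * (p * vec_index C j) - vec_index D1 j * (p * vec_index C i)"
        by (simp add: plucker_coord_def algebra_simps)
      then show ?thesis unfolding C[OF that(1)] C[OF that(2)] by (simp add: plucker_coord_def algebra_simps)
    qed
    then show False
      using degree_plucker_coord_le[OF dims] \<open>degree r < degree p\<close> \<open>r \<noteq> 0\<close>
      by (intro reduce[OF gen gen', of r]) auto
  qed
qed

text \<open>
  The degree of the Pluecker coordinates is at most the sum of the degrees of the generators, and for
  a mu-basis this sum is the minimum over all quasi-generators; so the leading vectors do not cancel.
\<close>

lemma mu_basis_top_nonzero:
  fixes D1 D2 :: "'a::idom poly vec"
  assumes mu: "mu_basis 5 M D1 D2"
  shows "\<exists>i<5. \<exists>j<5. coeff (plucker_vec D1 D2 i j) (vec_degree D1 + vec_degree D2) \<noteq> 0"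
proof (rule ccontr)
  assume neg: "\<not> ?thesis"
  let ?N = "vec_degree D1 + vec_degree D2" and ?P = "plucker_vec D1 D2"
  have gen: "quasi_generators 5 M D1 D2" using mu by (simp add: mu_basis_def)
  then have dims: "dim_vec D1 = 5" "dim_vec D2 = 5" and ind: "lin_indep_pair 5 D1 D2"
    by (auto simp: quasi_generators_def lin_indep_pair_def)
  have *: "?P i j = 0 \<or> degree (?P i j) < ?N" if "i < 5" "j < 5" for i j
  proof -
    have "coeff (?P i j) ?N = 0" using neg that by blast
    then have "degree (?P i j) \<noteq> ?N \<or> ?P i j = 0" by (metis leading_coeff_0_iff)
    then show ?thesis using degree_plucker_coord_le[OF dims that] by linarith
  qed
  obtain i j where "i < 5" "j < 5" "?P i j \<noteq> 0" using lin_indep_plucker_nonzero[OF ind] by blast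
  with *[of i j] have "?N > 0" by linarith
  moreover have "degree (?P i j) \<le> ?N - 1" if "i < 5" "j < 5" for i j
    using *[OF that] by auto
  then have "?N \<le> ?N - 1" by (rule mu_basis_minimal[OF mu gen])
  ultimately show False by linarith
qed

lemma real_poly_hom: "comm_ring_hom real_poly"
proof -
  interpret m: map_poly_comm_ring_hom "of_real :: real \<Rightarrow> complex" ..
  show ?thesis by unfold_locales
qed

lemma real_poly_mult: "real_poly (p * q) = real_poly p * real_poly q"
  and real_poly_add: "real_poly (p + q) = real_poly p + real_poly q"
  and real_poly_diff: "real_poly (p - q) = real_poly p - real_poly q"
proof -
  interpret comm_ring_hom real_poly by (rule real_poly_hom)
  show "real_poly (p * q) = real_poly p * real_poly q" "real_poly (p + q) = real_poly p + real_poly q"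
    "real_poly (p - q) = real_poly p - real_poly q"
    by (rule hom_mult hom_add hom_minus)+
qed

lemma real_poly_pderiv: "real_poly (pderiv p) = pderiv (real_poly p)"
  by (rule poly_eqI) (simp add: coeff_pderiv coeff_map_poly)

text \<open>
  A nonzero real polynomial of least degree among those with the root \<open>t\<close> divides all of them.
\<close>

lemma common_complex_root_imp_factor:
  fixes X :: "real poly set"
  assumes "p0 \<in> X" "p0 \<noteq> 0" "\<And>p. p \<in> X \<Longrightarrow> poly (real_poly p) t = 0"
  shows "\<exists>p. irreducible p \<and> (\<forall>q\<in>X. p dvd q)"
proof -
  let ?Q = "\<lambda>p. p \<noteq> 0 \<and> poly (real_poly p) t = 0"
  obtain p where p: "?Q p" "\<And>q. ?Q q \<Longrightarrow> degree p \<le> degree q"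
    using ex_has_least_nat[of ?Q p0 degree] assms by blast
  have dvd: "p dvd q" if "poly (real_poly q) t = 0" for q
  proof (rule ccontr)
    assume "\<not> p dvd q"
    then have nz: "q mod p \<noteq> 0" by (simp add: mod_eq_0_iff_dvd)
    have "real_poly q = real_poly (q div p) * real_poly p + real_poly (q mod p)"
      by (metis div_mult_mod_eq real_poly_mult real_poly_add)
    then have "poly (real_poly (q mod p)) t = 0"
      using that p(1) by simp
    then have "degree p \<le> degree (q mod p)" using p(2) nz by blast
    then show False using degree_mod_less'[of p q] p(1) nz by simp
  qed
  have "\<not> p dvd 1"
  proof
    assume "p dvd 1"
    then have "degree p = 0" using p(1) is_unit_iff_degree by blast
    then obtain c where c: "p = [:c:]" by (rule degree_eq_zeroE)
    then show False using p(1) by (simp add: poly_map_poly_const[OF comm_ring_hom_of_real])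
  qed
  then obtain r where r: "r dvd p" "prime r" using prime_divisor_exists[of p] p(1) by blast
  have "irreducible r" using r(2) prime_elem_imp_irreducible prime_imp_prime_elem by blast
  moreover have "r dvd q" if "q \<in> X" for q
    using dvd_trans[OF r(1) dvd[OF assms(3)[OF that]]] .
  ultimately show ?thesis by blast
qed

section \<open>The Pluecker map of a curve and its derivative\<close>

text \<open>
  The factor is a priori a fraction; its denominator divides all Pluecker coordinates of the mu-basis,
  which have no common factor.
\<close>

lemma plucker_multiple:
  fixes D1 D2 C C' :: "'a::field_gcd poly vec"
  assumes mu: "mu_basis 5 M D1 D2" and C: "C \<in> M" "C' \<in> M"
  shows "\<exists>h. \<forall>i<5. \<forall>j<5. plucker_vec C C' i j = h * plucker_vec D1 D2 i j"
proof -
  let ?P = "plucker_vec D1 D2" and ?Q = "plucker_vec C C'"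
  have gen: "quasi_generators 5 M D1 D2" using mu by (simp add: mu_basis_def)
  then have carrier: "D1 \<in> carrier_vec 5" "D2 \<in> carrier_vec 5" and ind: "lin_indep_pair 5 D1 D2"
    and M: "quasi_module 5 D1 D2 = M"
    by (auto simp: quasi_generators_def lin_indep_pair_def)
  have cross: "?Q i j * ?P k l = ?Q k l * ?P i j" if "i < 5" "j < 5" "k < 5" "l < 5" for i j k l
    using quasi_module_plucker_proportional[OF carrier, of C C'] C that unfolding M by blast
  obtain i j where ij: "i < 5" "j < 5" "?P i j \<noteq> 0" using lin_indep_plucker_nonzero[OF ind] by blast
  define g where "g = gcd (?Q i j) (?P i j)"
  obtain v u where vu: "?Q i j = v * g" "?P i j = u * g" "coprime v u"
    using gcd_coprime_exists[of "?Q i j" "?P i j"] ij(3) by (metis g_def gcd_eq_0_iff)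
  have "g \<noteq> 0" "u \<noteq> 0" using vu(2) ij(3) by auto
  have eq: "v * ?P k l = ?Q k l * u" if "k < 5" "l < 5" for k l
  proof -
    have "g * (v * ?P k l) = g * (?Q k l * u)"
      using cross[OF ij(1,2) that] by (simp add: vu(1,2) algebra_simps)
    then show ?thesis using \<open>g \<noteq> 0\<close> by simp
  qed
  have dvd: "u dvd ?P k l" if "k < 5" "l < 5" for k l
    using eq[OF that] vu(3) by (metis coprime_commute coprime_dvd_mult_right_iff dvd_triv_right)
  have "u dvd 1"
  proof (rule ccontr)
    assume "\<not> u dvd 1"
    then obtain p where p: "p dvd u" "prime p" using prime_divisor_exists[of u] \<open>u \<noteq> 0\<close> by blast
    then have "irreducible p" using prime_elem_imp_irreducible prime_imp_prime_elem by blast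
    then show False using mu_basis_plucker_primitive[OF mu] dvd p(1) dvd_trans by blast
  qed
  then obtain w where w: "u * w = 1" by (metis dvdE)
  have "?Q k l = (v * w) * ?P k l" if "k < 5" "l < 5" for k l
  proof -
    have "?Q k l = (?Q k l * u) * w" by (simp add: w mult.assoc)
    then show ?thesis unfolding eq[OF that, symmetric] by (simp add: mult_ac)
  qed
  then show ?thesis by blast
qed

lemma self_in_proj_point: "v \<in> proj_point v"
  unfolding proj_point_def by (auto intro!: exI[of _ 1])

lemma proj_point_eq_iff: "proj_point v = proj_point w \<longleftrightarrow> (\<exists>\<gamma>. \<gamma> \<noteq> 0 \<and> v = \<gamma> \<cdot>\<^sub>v w)" for v w :: "'k::field vec"
proof
  assume "proj_point v = proj_point w"
  then have "v \<in> proj_point w" using self_in_proj_point by metis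
  then show "\<exists>\<gamma>. \<gamma> \<noteq> 0 \<and> v = \<gamma> \<cdot>\<^sub>v w" by (auto simp: proj_point_def)
next
  assume "\<exists>\<gamma>. \<gamma> \<noteq> 0 \<and> v = \<gamma> \<cdot>\<^sub>v w"
  then obtain \<gamma> where \<gamma>: "\<gamma> \<noteq> 0" "v = \<gamma> \<cdot>\<^sub>v w" by blast
  show "proj_point v = proj_point w"
  proof (intro equalityI subsetI)
    fix x assume "x \<in> proj_point v"
    then obtain c where "c \<noteq> 0" "x = (c * \<gamma>) \<cdot>\<^sub>v w" by (auto simp: proj_point_def smult_smult_assoc \<gamma>(2))
    with \<gamma>(1) show "x \<in> proj_point w" unfolding proj_point_def by force
  next
    fix x assume "x \<in> proj_point w"
    then obtain c where "c \<noteq> 0" "x = c \<cdot>\<^sub>v w" by (auto simp: proj_point_def)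
    then have "x = (c / \<gamma>) \<cdot>\<^sub>v v" "c / \<gamma> \<noteq> 0"
      using \<gamma> by (simp_all add: smult_smult_assoc)
    then show "x \<in> proj_point v" unfolding proj_point_def by blast
  qed
qed

lemma complex_eval_real: "complex_eval G (\<lambda>i. of_real (x i)) = of_real (mpol_subst (\<lambda>r. r) x G)"
  using hom_mpol_subst[OF comm_ring_hom_of_real comm_ring_hom_id, of x G] by simp

lemma dot5_of_real: "dot5 (\<lambda>i. of_real (u i)) (\<lambda>i. of_real (x i)) = (of_real (dot5 u x) :: complex)"
  by (simp add: dot5_def)

lemma proj_eval_real_at:
  assumes "dim_vec C = 5" "x \<in> carrier_vec 5"
  shows "of_real (proj_eval C (Affine t) \<bullet> x)
    = dot5 (\<lambda>k. poly (real_poly (vec_index C k)) (of_real t)) (\<lambda>i. of_real (vec_index x i))"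
proof -
  have "proj_eval C (Affine t) \<bullet> x = dot5 (\<lambda>k. poly (vec_index C k) t) (vec_index x)"
    using assms by (simp add: scalar_prod_def dot5_def atLeast0LessThan)
  then show ?thesis
    by (simp add: dot5_def)
qed

lemma polyfun_zero_if_infinite: "polyfun \<phi> \<Longrightarrow> infinite {z. \<phi> z = 0} \<Longrightarrow> \<phi> z = 0"
  using polyfun_zero_or_finite by blast

lemma infinite_real: "infinite (range of_real :: complex set)"
  by (simp add: range_inj_infinite inj_on_def infinite_UNIV_char_0 finite_image_iff)

lemma mpol_eval_smult:
  assumes "form_of_degree 5 n G" "x \<in> carrier_vec 5"
  shows "mpol_eval G (r \<cdot>\<^sub>v x) = r ^ n * mpol_eval (G :: real mpol) x"
proof -
  have "(\<Prod>i\<in>Poly_Mapping.keys e. vec_index (r \<cdot>\<^sub>v x) i ^ Poly_Mapping.lookup e i) = r ^ n * monomial_at (vec_index x) e"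
    if "e \<in> Poly_Mapping.keys G" for e
  proof -
    have e: "Poly_Mapping.keys e \<subseteq> {..<5}" "monom_degree e = n"
      using assms(1) that by (auto simp: form_of_degree_def)
    have "(\<Prod>i\<in>Poly_Mapping.keys e. vec_index (r \<cdot>\<^sub>v x) i ^ Poly_Mapping.lookup e i)
        = (\<Prod>i\<in>Poly_Mapping.keys e. r ^ Poly_Mapping.lookup e i * vec_index x i ^ Poly_Mapping.lookup e i)"
      using e(1) assms(2) by (intro prod.cong) (auto simp: power_mult_distrib)
    also have "\<dots> = r ^ n * monomial_at (vec_index x) e"
      by (simp add: prod.distrib monom_degree_def power_sum e(2)[symmetric])
    finally show ?thesis .
  qed
  then show ?thesis
    by (simp add: mpol_eval_def sum_distrib_left mult_ac)
qed

lemma vanishes_at_proj_point: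
  assumes "form_of_degree 5 n G" "x \<in> carrier_vec 5"
  shows "vanishes_at G (proj_point x) \<longleftrightarrow> complex_eval G (\<lambda>i. of_real (vec_index x i)) = 0"
  using mpol_eval_smult[OF assms] self_in_proj_point[of x]
  by (auto simp: vanishes_at_def proj_point_def complex_eval_real simp flip: mpol_eval_eq_subst)

text \<open>
  A curve \<open>D\<close> with the mu-basis of the module of its tangent lines. The polynomial \<open>h\<close> is the content
  of the Pluecker vector of \<open>D\<close> and its derivative, up to a constant.
\<close>

locale developable =
  fixes D D1 D2 :: "real poly vec" and h :: "real poly"
  assumes indD: "lin_indep_pair 5 D (map_vec pderiv D)"
    and nonconstant: "plucker_nonconstant D (map_vec pderiv D)"
    and mu: "mu_basis 5 (quasi_module 5 D (map_vec pderiv D)) D1 D2"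
    and plucker_h: "i < 5 \<Longrightarrow> j < 5 \<Longrightarrow> plucker_coord (vec_index D) (vec_index (map_vec pderiv D)) i j
      = h * plucker_vec D1 D2 i j"
begin

abbreviation "D' \<equiv> map_vec pderiv D"
abbreviation "M \<equiv> quasi_module 5 D D'"
abbreviation "n1 \<equiv> vec_degree D1"
abbreviation "n2 \<equiv> vec_degree D2"
abbreviation "P \<equiv> plucker_vec D1 D2"
abbreviation "cP \<equiv> \<lambda>i j. real_poly (P i j)"
abbreviation "a \<equiv> \<lambda>i. real_poly (vec_index D1 i)"
abbreviation "b \<equiv> \<lambda>i. real_poly (vec_index D2 i)"
abbreviation "c \<equiv> \<lambda>i. real_poly (vec_index D i)"

lemma dims: "dim_vec D = 5" "dim_vec D1 = 5" "dim_vec D2 = 5"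
  and carriers: "D \<in> carrier_vec 5" "D' \<in> carrier_vec 5" "D1 \<in> carrier_vec 5" "D2 \<in> carrier_vec 5"
  and indD12: "lin_indep_pair 5 D1 D2" and M_eq: "quasi_module 5 D1 D2 = M"
  using indD mu by (auto simp: mu_basis_def quasi_generators_def lin_indep_pair_def)

lemma D_in_M: "D \<in> M" "D' \<in> M"
  by (rule self_in_quasi_module[OF carriers(1,2)])+

lemma D12_in_M: "D1 \<in> M" "D2 \<in> M"
  using self_in_quasi_module[OF carriers(3,4)] by (simp_all add: M_eq)

lemma h_nonzero: "h \<noteq> 0"
  using lin_indep_plucker_nonzero[OF indD] plucker_h by auto

lemma plucker_at: "plucker_coord (at_param a t) (at_param b t) i j = poly (cP i j) t"
  by (simp add: plucker_coord_def real_poly_mult real_poly_diff)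

lemma indep_at: "indep5 (at_param a t) (at_param b t)"
proof (rule ccontr)
  assume "\<not> indep5 (at_param a t) (at_param b t)"
  then have zero: "poly (cP i j) t = 0" if "i < 5" "j < 5" for i j
    using that by (auto simp: indep5_def plucker_at)
  let ?X = "{P i j | i j. i < 5 \<and> j < 5}"
  obtain i j where "i < 5" "j < 5" "P i j \<noteq> 0" using lin_indep_plucker_nonzero[OF indD12] by blast
  then obtain p where "irreducible p" "\<forall>q\<in>?X. p dvd q"
    using common_complex_root_imp_factor[of "P i j" ?X t] zero by blast
  then show False using mu_basis_plucker_primitive[OF mu] by blast
qed

lemma indep_at_top: "indep5 (top_coeffs a n1) (top_coeffs b n2)"
proof -
  have "coeff (P i j) (n1 + n2) = coeff (vec_index D1 i) n1 * coeff (vec_index D2 j) n2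
      - coeff (vec_index D1 j) n1 * coeff (vec_index D2 i) n2" if "i < 5" "j < 5" for i j
    using that le_vec_degree[of _ D1] le_vec_degree[of _ D2] dims
    by (simp add: plucker_coord_def coeff_mult_top)
  then have "plucker_coord (top_coeffs a n1) (top_coeffs b n2) i j = of_real (coeff (P i j) (n1 + n2))"
    if "i < 5" "j < 5" for i j
    using that by (simp add: plucker_coord_def)
  then show ?thesis
    using mu_basis_top_nonzero[OF mu] unfolding indep5_def by fastforce
qed

sublocale plane_family a b n1 n2
proof
  show "degree (a i) \<le> n1" "degree (b i) \<le> n2" if "i < 5" for i
    using that le_vec_degree[of i D1] le_vec_degree[of i D2] dims
    by (auto intro: order_trans[OF degree_map_poly_le])
qed (rule indep_at indep_at_top)+

lemma module_element_at:
  assumes "C \<in> M" "x \<in> L t"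
  shows "dot5 (\<lambda>k. poly (real_poly (vec_index C k)) t) x = 0"
proof -
  obtain i j where ij: "i < 5" "j < 5" "poly (cP i j) t \<noteq> 0"
    using indep_at[of t] by (auto simp: indep5_def plucker_at)
  let ?A = "poly (real_poly (plucker_vec C D2 i j)) t"
  let ?B = "poly (real_poly (plucker_vec D1 C i j)) t"
  have "poly (cP i j) t * poly (real_poly (vec_index C k)) t = ?A * at_param a t k + ?B * at_param b t k"
    if "k < 5" for k
    using arg_cong[OF quasi_module_cramer[OF carriers(3,4) assms(1)[folded M_eq] ij(1,2) that], of "\<lambda>p. poly (real_poly p) t"]
    by (simp add: real_poly_mult real_poly_add)
  then have "dot5 (\<lambda>k. poly (cP i j) t * poly (real_poly (vec_index C k)) t) x
      = ?A * dot5 (at_param a t) x + ?B * dot5 (at_param b t) x"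
    by (intro dot5_lin) simp
  also have "\<dots> = 0" using assms(2) by (simp add: L_def perp_def)
  also have "dot5 (\<lambda>k. poly (cP i j) t * poly (real_poly (vec_index C k)) t) x
      = poly (cP i j) t * dot5 (\<lambda>k. poly (real_poly (vec_index C k)) t) x"
    by (simp add: dot5_def sum_distrib_left mult_ac)
  finally show ?thesis using ij(3) by simp
qed

lemma pair_with_curve:
  "poly (pair_with c x) t = dot5 (\<lambda>k. poly (real_poly (vec_index D k)) t) x"
  "poly (pderiv (pair_with c x)) t = dot5 (\<lambda>k. poly (real_poly (vec_index D' k)) t) x"
  using dims by (simp_all add: pderiv_pair_with poly_pair_with dot5_def real_poly_pderiv)

text \<open>
  A constant direction of the reduced Pluecker vector makes the Pluecker map constant on its whole
  domain, including infinity.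
\<close>

lemma not_constant_direction:
  "\<not> (\<exists>f v. \<forall>j<5. \<forall>i<j. cP i j = Polynomial.smult (v i j) f)"
proof
  assume "\<exists>f v. \<forall>j<5. \<forall>i<j. cP i j = Polynomial.smult (v i j) f"
  then obtain f v where f: "\<And>i j. i < j \<Longrightarrow> j < 5 \<Longrightarrow> cP i j = Polynomial.smult (v i j) f" by blast
  let ?W = "complex_wedge D D'" and ?v = "wedge_vec v"
  define g where "g = real_poly h * f"
  have W: "?W = wedge_vec (\<lambda>i j. real_poly (h * P i j))"
    unfolding complex_wedge_def wedge_eq_wedge_vec[OF dims(1)] map_vec_wedge_vec wedge_vec_eq_iff
    using plucker_h by simp
  have "\<exists>\<gamma>. proj_eval ?W t = \<gamma> \<cdot>\<^sub>v ?v" for t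
  proof (cases t)
    case (Affine s)
    have "proj_eval ?W t = poly g s \<cdot>\<^sub>v ?v"
      unfolding Affine proj_eval.simps W map_vec_wedge_vec smult_wedge_vec wedge_vec_eq_iff
      using f by (simp add: g_def real_poly_mult mult_ac)
    then show ?thesis by blast
  next
    case Infinity
    have "proj_eval ?W t = coeff g (vec_degree ?W) \<cdot>\<^sub>v ?v"
      unfolding Infinity proj_eval.simps smult_wedge_vec
      by (simp only: W map_vec_wedge_vec wedge_vec_eq_iff) (use f in \<open>simp add: g_def real_poly_mult mult_ac\<close>)
    then show ?thesis by blast
  qed
  then have "plucker_map D D' t = proj_point ?v" if t: "t \<in> plucker_domain D D'" for t
  proof -
    obtain \<gamma> where \<gamma>: "proj_eval ?W t = \<gamma> \<cdot>\<^sub>v ?v" using \<open>\<exists>\<gamma>. proj_eval ?W t = \<gamma> \<cdot>\<^sub>v ?v\<close> by blast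
    have "\<gamma> \<noteq> 0"
    proof
      assume "\<gamma> = 0"
      then have "proj_eval ?W t = 0\<^sub>v (dim_vec ?W)"
        unfolding \<gamma> by (intro eq_vecI) (simp_all add: W wedge_vec_def wedge_list)
      with t show False by (simp add: plucker_domain_def)
    qed
    then have "proj_point (\<gamma> \<cdot>\<^sub>v ?v) = proj_point ?v"
      unfolding proj_point_eq_iff by blast
    then show ?thesis by (simp add: plucker_map_def \<gamma>)
  qed
  then show False using nonconstant by (simp add: plucker_nonconstant_def)
qed

text \<open>
  If infinitely many reduced Pluecker vectors are proportional to \<open>v\<close>, the polynomial relations
  \<open>v i0 j0 * cP i j = v i j * cP i0 j0\<close> hold identically.
\<close>

lemma finite_proportional:
  assumes "j0 < 5" "i0 < j0" "v i0 j0 \<noteq> 0"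
  shows "finite {t. \<exists>\<delta>. \<forall>j<5. \<forall>i<j. poly (cP i j) t = \<delta> * v i j}"
proof (rule ccontr)
  let ?T = "{t. \<exists>\<delta>. \<forall>j<5. \<forall>i<j. poly (cP i j) t = \<delta> * v i j}"
  assume inf: "infinite ?T"
  have "cP i j = Polynomial.smult (v i j) (Polynomial.smult (inverse (v i0 j0)) (cP i0 j0))" if "i < j" "j < 5" for i j
  proof -
    let ?q = "Polynomial.smult (v i0 j0) (cP i j) - Polynomial.smult (v i j) (cP i0 j0)"
    have "?T \<subseteq> {t. poly ?q t = 0}"
    proof
      fix t assume "t \<in> ?T"
      then obtain \<delta> where "\<forall>j<5. \<forall>i<j. poly (cP i j) t = \<delta> * v i j" by blast
      then show "t \<in> {t. poly ?q t = 0}" using assms that by simp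
    qed
    then have "?q = 0" using inf poly_roots_finite finite_subset by blast
    then have "Polynomial.smult (v i0 j0) (cP i j) = Polynomial.smult (v i j) (cP i0 j0)" by simp
    then have "Polynomial.smult (inverse (v i0 j0)) (Polynomial.smult (v i0 j0) (cP i j))
        = Polynomial.smult (inverse (v i0 j0)) (Polynomial.smult (v i j) (cP i0 j0))" by simp
    then show ?thesis using assms(3) by (simp add: mult.commute)
  qed
  then show False using not_constant_direction by blast
qed

lemma finite_perp:
  assumes "indep5 u w"
  shows "finite {t. L t = perp u w}"
proof -
  obtain i0 j0 where ij: "j0 < 5" "i0 < j0" "plucker_coord u w i0 j0 \<noteq> 0"
  proof -
    obtain i j where "i < 5" "j < 5" "plucker_coord u w i j \<noteq> 0" using assms by (auto simp: indep5_def)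
    then show thesis
      using that[of j i] that[of i j] plucker_coord_antisym[of u w i j]
      by (cases i j rule: linorder_cases) (auto simp: plucker_coord_def)
  qed
  have "{t. L t = perp u w} \<subseteq> {t. \<exists>\<delta>. \<forall>j<5. \<forall>i<j. poly (cP i j) t = \<delta> * plucker_coord u w i j}"
  proof
    fix t assume "t \<in> {t. L t = perp u w}"
    then have "perp u w \<subseteq> perp (at_param a t) (at_param b t)" by (simp add: L_def)
    then obtain \<delta> where "\<forall>k<5. \<forall>l<5. plucker_coord (at_param a t) (at_param b t) k l = \<delta> * plucker_coord u w k l"
      using proportional_if_perp_subset[OF assms indep_at] by blast
    then show "t \<in> {t. \<exists>\<delta>. \<forall>j<5. \<forall>i<j. poly (cP i j) t = \<delta> * plucker_coord u w i j}"
      unfolding plucker_at by (auto intro!: exI[of _ \<delta>])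
  qed
  then show ?thesis
    using finite_proportional[of j0 i0 "plucker_coord u w", OF ij] finite_subset by blast
qed

sublocale osculating_family a b n1 n2 c "{t. poly (real_poly h) t = 0}"
proof
  show double: "poly (pair_with c x) t = 0 \<and> poly (pderiv (pair_with c x)) t = 0" if "x \<in> L t" for x t
    unfolding pair_with_curve using module_element_at[OF D_in_M(1) that] module_element_at[OF D_in_M(2) that] by blast
  show "x \<in> L t" if t: "t \<notin> {t. poly (real_poly h) t = 0}" and x: "poly (pair_with c x) t = 0" "poly (pderiv (pair_with c x)) t = 0" for x t
  proof -
    let ?C = "\<lambda>k. poly (real_poly (vec_index D k)) t" and ?C' = "\<lambda>k. poly (real_poly (vec_index D' k)) t"
    obtain i j where ij: "i < 5" "j < 5" "poly (cP i j) t \<noteq> 0"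
      using indep_at[of t] by (auto simp: indep5_def plucker_at)
    have "plucker_coord ?C ?C' i j = poly (real_poly (plucker_vec D D' i j)) t"
      by (simp add: plucker_coord_def real_poly_mult real_poly_diff)
    then have "plucker_coord ?C ?C' i j \<noteq> 0"
      using ij t by (simp add: plucker_h[OF ij(1,2)] real_poly_mult)
    then have "indep5 ?C ?C'" using ij by (auto simp: indep5_def)
    moreover have "perp (at_param a t) (at_param b t) \<subseteq> perp ?C ?C'"
      using double unfolding pair_with_curve L_def perp_def by blast
    ultimately have "perp (at_param a t) (at_param b t) = perp ?C ?C'"
      by (intro perp_eq_if_subset indep_at)
    then show ?thesis using x unfolding pair_with_curve L_def by (simp add: perp_def)
  qed
  have "real_poly h \<noteq> 0" using h_nonzero by (simp add: map_poly_eq_0_iff)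
  then show "finite {t. poly (real_poly h) t = 0}" by (rule poly_roots_finite)
  show "finite {t. L t = L s}" for s
    using finite_perp[OF indep_at[of s]] by (simp add: L_def)
  show "finite {t. L t = L_inf}"
    using finite_perp[OF indep_at_top] by (simp add: L_inf_def)
qed

text \<open>
  Where the derivatives of both generators lie in their span, the Pluecker vector is parallel to its
  derivative, so the Wronskians of its entries vanish. If this happened infinitely often, all the
  entries would be proportional.
\<close>

lemma finite_critical:
  "finite {t. L t \<subseteq> perp (at_param (\<lambda>i. pderiv (a i)) t) (at_param (\<lambda>i. pderiv (b i)) t)}"
proof (rule ccontr)
  let ?T = "{t. L t \<subseteq> perp (at_param (\<lambda>i. pderiv (a i)) t) (at_param (\<lambda>i. pderiv (b i)) t)}"
  assume inf: "infinite ?T"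
  have par: "\<exists>\<gamma>. \<forall>j<5. \<forall>i<5. poly (pderiv (cP i j)) t = \<gamma> * poly (cP i j) t" if "t \<in> ?T" for t
  proof -
    have sub: "\<And>x. x \<in> perp (at_param a t) (at_param b t) \<Longrightarrow>
      dot5 (at_param (\<lambda>i. pderiv (a i)) t) x = 0 \<and> dot5 (at_param (\<lambda>i. pderiv (b i)) t) x = 0"
      using that by (auto simp: L_def perp_def)
    obtain \<alpha> \<beta> where a': "\<And>k. k < 5 \<Longrightarrow> poly (pderiv (a k)) t = \<alpha> * poly (a k) t + \<beta> * poly (b k) t"
      using span_if_perp[OF indep_at[of t], of "at_param (\<lambda>i. pderiv (a i)) t"] sub by blast
    obtain \<gamma> \<delta> where b': "\<And>k. k < 5 \<Longrightarrow> poly (pderiv (b k)) t = \<gamma> * poly (a k) t + \<delta> * poly (b k) t"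
      using span_if_perp[OF indep_at[of t], of "at_param (\<lambda>i. pderiv (b i)) t"] sub by blast
    have "poly (pderiv (cP i j)) t = (\<alpha> + \<delta>) * poly (cP i j) t" if "i < 5" "j < 5" for i j
      by (simp add: plucker_coord_def real_poly_mult real_poly_diff pderiv_diff pderiv_mult a' b' that)
        (simp add: algebra_simps)
    then show ?thesis by blast
  qed
  obtain i0 j0 where ij0: "i0 < 5" "j0 < 5" "P i0 j0 \<noteq> 0" using lin_indep_plucker_nonzero[OF indD12] by blast
  then have nz: "cP i0 j0 \<noteq> 0" by (simp add: map_poly_eq_0_iff)
  have "\<exists>\<kappa>. cP i j = Polynomial.smult \<kappa> (cP i0 j0)" if "i < 5" "j < 5" for i j
  proof -
    let ?q = "cP i0 j0 * pderiv (cP i j) - pderiv (cP i0 j0) * cP i j"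
    have "?T \<subseteq> {t. poly ?q t = 0}"
    proof
      fix t assume "t \<in> ?T"
      then obtain \<gamma> where "\<forall>j<5. \<forall>i<5. poly (pderiv (cP i j)) t = \<gamma> * poly (cP i j) t" using par by blast
      then show "t \<in> {t. poly ?q t = 0}" using ij0 that by simp
    qed
    then have "?q = 0" using inf poly_roots_finite finite_subset by blast
    then show ?thesis using proportional_if_wronskian_zero[OF nz] by simp
  qed
  then have "\<forall>i j. \<exists>\<kappa>. i < 5 \<and> j < 5 \<longrightarrow> cP i j = Polynomial.smult \<kappa> (cP i0 j0)" by blast
  then obtain v where "\<And>i j. i < 5 \<and> j < 5 \<longrightarrow> cP i j = Polynomial.smult (v i j) (cP i0 j0)" by metis
  then show False using not_constant_direction by force
qed

end

section \<open>The degree of the Pluecker map and the implicit equation\<close>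

context developable
begin

lemma complex_wedge_at: "proj_eval (complex_wedge D D') (Affine t) = wedge_vec (\<lambda>i j. poly (real_poly h) t * poly (cP i j) t)"
  unfolding complex_wedge_def wedge_eq_wedge_vec[OF dims(1)] proj_eval.simps map_vec_wedge_vec wedge_vec_eq_iff
  using plucker_h by (simp add: real_poly_mult)

lemma dim_complex_wedge: "dim_vec (complex_wedge D D') = 10"
  unfolding complex_wedge_def wedge_eq_wedge_vec[OF dims(1)] by (simp add: wedge_vec_def wedge_list)

lemma indep_ordered: "\<exists>i j. i < j \<and> j < 5 \<and> poly (cP i j) t \<noteq> 0"
proof -
  obtain i j where ij: "i < 5" "j < 5" "poly (cP i j) t \<noteq> 0"
    using indep_at[of t] by (auto simp: indep5_def plucker_at)
  have swap: "poly (cP j i) t = - poly (cP i j) t" and diag: "poly (cP i i) t = 0"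
    by (simp_all add: plucker_coord_def real_poly_diff real_poly_mult)
  from ij swap diag show ?thesis
    by (cases i j rule: linorder_cases) (metis neg_equal_0_iff_equal)+
qed

lemma Affine_in_domain: "Affine t \<in> plucker_domain D D' \<longleftrightarrow> poly (real_poly h) t \<noteq> 0"
proof -
  have "Affine t \<notin> plucker_domain D D' \<longleftrightarrow> (\<forall>j<5. \<forall>i<j. poly (real_poly h) t * poly (cP i j) t = 0)"
    unfolding plucker_domain_def dim_complex_wedge mem_Collect_eq complex_wedge_at zero_wedge_vec wedge_vec_eq_iff
    by simp
  then show ?thesis using indep_ordered[of t] by auto
qed

lemma plucker_map_eq_iff:
  assumes "poly (real_poly h) t \<noteq> 0" "poly (real_poly h) s \<noteq> 0"
  shows "plucker_map D D' (Affine t) = plucker_map D D' (Affine s) \<longleftrightarrow> L t = L s"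
proof -
  let ?h = "\<lambda>t. poly (real_poly h) t"
  have iff: "plucker_map D D' (Affine t) = plucker_map D D' (Affine s) \<longleftrightarrow>
      (\<exists>\<gamma>. \<gamma> \<noteq> 0 \<and> (\<forall>j<5. \<forall>i<j. ?h t * poly (cP i j) t = \<gamma> * (?h s * poly (cP i j) s)))"
    unfolding plucker_map_def proj_point_eq_iff complex_wedge_at smult_wedge_vec wedge_vec_eq_iff ..
  show ?thesis
  proof
    assume "plucker_map D D' (Affine t) = plucker_map D D' (Affine s)"
    then obtain \<gamma> where \<gamma>: "\<And>i j. i < j \<Longrightarrow> j < 5 \<Longrightarrow> ?h t * poly (cP i j) t = \<gamma> * (?h s * poly (cP i j) s)"
      unfolding iff by blast
    have "plucker_coord (at_param a t) (at_param b t) k l = (\<gamma> * ?h s / ?h t) * plucker_coord (at_param a s) (at_param b s) k l"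
      if "k < 5" "l < 5" for k l
    proof -
      have *: "poly (cP i j) t = (\<gamma> * ?h s / ?h t) * poly (cP i j) s" if "i < j" "j < 5" for i j
        using \<gamma>[OF that] assms(1) by (simp add: field_simps)
      have anti: "poly (cP l k) r = - poly (cP k l) r" "poly (cP k k) r = 0" for r
        by (simp_all add: plucker_coord_def real_poly_diff real_poly_mult)
      show ?thesis
        unfolding plucker_at using that *[of k l] *[of l k] anti
        by (cases k l rule: linorder_cases) auto
    qed
    then have "perp (at_param a s) (at_param b s) \<subseteq> perp (at_param a t) (at_param b t)"
      by (intro perp_subset_if_proportional[OF indep_at])
    then show "L t = L s" using L_subset_imp_eq[of s t] by (simp add: L_def)
  next
    assume "L t = L s"
    then have "perp (at_param a s) (at_param b s) \<subseteq> perp (at_param a t) (at_param b t)" by (simp add: L_def)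
    from proportional_if_perp_subset[OF indep_at indep_at this]
    obtain \<delta> where \<delta>: "\<delta> \<noteq> 0" "\<forall>k<5. \<forall>l<5. plucker_coord (at_param a t) (at_param b t) k l
        = \<delta> * plucker_coord (at_param a s) (at_param b s) k l" by (elim exE conjE)
    have "?h t * poly (cP k l) t = (\<delta> * ?h t / ?h s) * (?h s * poly (cP k l) s)" if "l < 5" "k < l" for k l
    proof -
      have "k < 5" using that by simp
      have "poly (cP k l) t = \<delta> * poly (cP k l) s"
        unfolding plucker_at[symmetric] using \<delta>(2) \<open>k < 5\<close> that(1) by simp
      then show ?thesis using assms(2) by simp
    qed
    moreover have "\<delta> * ?h t / ?h s \<noteq> 0" using \<delta>(1) assms by simp
    ultimately show "plucker_map D D' (Affine t) = plucker_map D D' (Affine s)"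
      unfolding iff by blast
  qed
qed

lemma finite_plucker_eq:
  assumes "x \<in> plucker_domain D D'"
  shows "finite {t. plucker_map D D' (Affine t) = plucker_map D D' x \<and> poly (real_poly h) t \<noteq> 0}"
proof -
  define w where "w = proj_eval (complex_wedge D D') x"
  obtain v where w: "w = wedge_vec v"
  proof (cases x)
    case (Affine s)
    then show thesis using that complex_wedge_at w_def by blast
  next
    case Infinity
    have "w = wedge_vec (\<lambda>i j. coeff (real_poly (plucker_vec D D' i j)) (vec_degree (complex_wedge D D')))"
      unfolding w_def Infinity proj_eval.simps
      by (simp add: complex_wedge_def wedge_eq_wedge_vec[OF dims(1)] map_vec_wedge_vec)
    then show thesis using that by blast
  qed
  have "w \<noteq> 0\<^sub>v 10" using assms by (simp add: plucker_domain_def w_def dim_complex_wedge)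
  then obtain i j where ij: "j < 5" "i < j" "v i j \<noteq> 0"
    unfolding w zero_wedge_vec wedge_vec_eq_iff by blast
  have "{t. plucker_map D D' (Affine t) = plucker_map D D' x \<and> poly (real_poly h) t \<noteq> 0}
      \<subseteq> {t. \<exists>\<delta>. \<forall>j<5. \<forall>i<j. poly (cP i j) t = \<delta> * v i j}"
  proof
    fix t assume "t \<in> {t. plucker_map D D' (Affine t) = plucker_map D D' x \<and> poly (real_poly h) t \<noteq> 0}"
    then have nz: "poly (real_poly h) t \<noteq> 0" and "plucker_map D D' (Affine t) = plucker_map D D' x" by auto
    then obtain \<gamma> where "\<And>i j. i < j \<Longrightarrow> j < 5 \<Longrightarrow> poly (real_poly h) t * poly (cP i j) t = \<gamma> * v i j"
      unfolding plucker_map_def proj_point_eq_iff w_def[symmetric] w complex_wedge_at smult_wedge_vec wedge_vec_eq_iff by blast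
    then show "t \<in> {t. \<exists>\<delta>. \<forall>j<5. \<forall>i<j. poly (cP i j) t = \<delta> * v i j}"
      using nz by (auto intro!: exI[of _ "\<gamma> / poly (real_poly h) t"] simp: field_simps)
  qed
  then show ?thesis using finite_proportional[of j i v, OF ij] finite_subset by blast
qed

text \<open>
  Outside a finite set of parameters, the fibres of the Pluecker map on the projective line are
  those of \<open>t \<mapsto> L t\<close>: excluded are the roots of \<open>h\<close>, the planes of such roots, and the fibre
  through infinity.
\<close>

lemma plucker_degree_eq:
  assumes "finite T0" "\<And>s. s \<notin> T0 \<Longrightarrow> finite {t. L t = L s} \<and> card {t. L t = L s} = j" "j > 0"
  shows "plucker_degree D D' = j"
proof -
  let ?h0 = "{t. poly (real_poly h) t = 0}" and ?dom = "plucker_domain D D'" and ?\<phi> = "plucker_map D D'"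
  define T1 where "T1 = (if Infinity \<in> ?dom then {t. ?\<phi> (Affine t) = ?\<phi> Infinity \<and> poly (real_poly h) t \<noteq> 0} else {})"
  define T where "T = T0 \<union> ?h0 \<union> T1 \<union> (\<Union>s\<in>?h0. {t. L t = L s})"
  have "finite T"
    unfolding T_def T1_def using assms(1) finite_Q finite_fibre finite_plucker_eq by auto
  have fibre: "{t \<in> ?dom. ?\<phi> t = ?\<phi> (Affine s)} = Affine ` {t. L t = L s}" if s: "s \<notin> T" for s
  proof -
    have hs: "poly (real_poly h) s \<noteq> 0" using s by (simp add: T_def)
    have "Affine t \<in> ?dom \<and> ?\<phi> (Affine t) = ?\<phi> (Affine s) \<longleftrightarrow> L t = L s" for t
    proof (cases "poly (real_poly h) t = 0")
      case True
      then have "L t \<noteq> L s" using s by (auto simp: T_def)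
      then show ?thesis using True by (simp add: Affine_in_domain)
    next
      case False
      then show ?thesis using plucker_map_eq_iff[OF False hs] by (simp add: Affine_in_domain)
    qed
    moreover have "\<not> (Infinity \<in> ?dom \<and> ?\<phi> Infinity = ?\<phi> (Affine s))"
      using s hs by (auto simp: T_def T1_def split: if_splits)
    ultimately have "x \<in> {t \<in> ?dom. ?\<phi> t = ?\<phi> (Affine s)} \<longleftrightarrow> x \<in> Affine ` {t. L t = L s}" for x
      by (cases x) auto
    then show ?thesis by blast
  qed
  have card: "card {t \<in> ?dom. ?\<phi> t = ?\<phi> (Affine s)} = j" "finite {t \<in> ?dom. ?\<phi> t = ?\<phi> (Affine s)}" if "s \<notin> T" for s
    using assms(2)[of s] that unfolding fibre[OF that]
    by (simp_all add: card_image inj_on_def T_def)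
  let ?bad = "\<lambda>k. {p \<in> ?\<phi> ` ?dom. card {t \<in> ?dom. ?\<phi> t = p} \<noteq> k}"
  have "?bad j \<subseteq> ?\<phi> ` (insert Infinity (Affine ` T))"
  proof
    fix p assume p: "p \<in> ?bad j"
    then obtain x where x: "x \<in> ?dom" "p = ?\<phi> x" by blast
    show "p \<in> ?\<phi> ` (insert Infinity (Affine ` T))"
    proof (cases x)
      case (Affine s)
      then have "s \<in> T" using p x card(1)[of s] by blast
      then show ?thesis using x Affine by blast
    qed (use x in blast)
  qed
  then have bad: "finite (?bad j)"
    using \<open>finite T\<close> by (auto intro: finite_subset)
  have "k = j" if k: "finite (?bad k)" for k
  proof (rule ccontr)
    assume "k \<noteq> j"
    let ?U = "- T"
    have "infinite ?U"
      unfolding finite_compl[OF \<open>finite T\<close>] by (rule infinite_UNIV_char_0)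
    have "?\<phi> (Affine s) \<in> ?bad k" if "s \<in> ?U" for s
    proof -
      have s: "s \<notin> T" using that by simp
      have "Affine s \<in> ?dom" using s by (simp add: Affine_in_domain T_def)
      then show ?thesis using card(1)[OF s] \<open>k \<noteq> j\<close> by simp
    qed
    then have "(\<lambda>s. ?\<phi> (Affine s)) ` ?U \<subseteq> ?bad k" by blast
    then have "finite ((\<lambda>s. ?\<phi> (Affine s)) ` ?U)" using k finite_subset by blast
    then obtain s where s: "s \<in> ?U" "infinite {t \<in> ?U. ?\<phi> (Affine t) = ?\<phi> (Affine s)}"
      using pigeonhole_infinite[OF \<open>infinite ?U\<close>] by blast
    have "Affine ` {t \<in> ?U. ?\<phi> (Affine t) = ?\<phi> (Affine s)} \<subseteq> {t \<in> ?dom. ?\<phi> t = ?\<phi> (Affine s)}"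
      by (auto simp: Affine_in_domain T_def)
    then have "finite (Affine ` {t \<in> ?U. ?\<phi> (Affine t) = ?\<phi> (Affine s)})"
      using card(2)[of s] s(1) finite_subset by blast
    then show False using s(2) by (simp add: finite_image_iff inj_on_def)
  qed
  then show ?thesis
    unfolding plucker_degree_def using bad by (intro the_equality) blast+
qed

definition swept :: "real vec set set" where
  "swept = swept_variety 5 M"

text \<open>
  The mu-basis belongs to the module, so the swept variety consists of points on the planes of the
  family.
\<close>

lemma swept_subset:
  assumes "p \<in> swept"
  shows "\<exists>x\<in>carrier_vec 5. x \<noteq> 0\<^sub>v 5 \<and> p = proj_point x \<and>
    ((\<exists>t. (\<lambda>i. of_real (vec_index x i)) \<in> L t) \<or> (\<lambda>i. of_real (vec_index x i)) \<in> L_inf)"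
proof -
  obtain t x where x: "x \<in> fibre_space 5 M t" "x \<noteq> 0\<^sub>v 5" "p = proj_point x"
    using assms by (auto simp: swept_def swept_variety_def)
  then have carrier: "x \<in> carrier_vec 5" and "proj_eval D1 t \<bullet> x = 0" "proj_eval D2 t \<bullet> x = 0"
    using D12_in_M by (auto simp: fibre_space_def)
  have "(\<exists>t. (\<lambda>i. of_real (vec_index x i)) \<in> L t) \<or> (\<lambda>i. of_real (vec_index x i)) \<in> L_inf"
  proof (cases t)
    case (Affine s)
    then have "(\<lambda>i. of_real (vec_index x i)) \<in> L (of_real s)"
      using \<open>proj_eval D1 t \<bullet> x = 0\<close> \<open>proj_eval D2 t \<bullet> x = 0\<close>
        proj_eval_real_at[OF dims(2) carrier, of s] proj_eval_real_at[OF dims(3) carrier, of s]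
      by (simp add: L_def perp_def)
    then show ?thesis by blast
  next
    case Infinity
    have "of_real (proj_eval C Infinity \<bullet> x)
        = dot5 (\<lambda>k. coeff (real_poly (vec_index C k)) (vec_degree C)) (\<lambda>i. of_real (vec_index x i))"
      if "dim_vec C = 5" for C
      using that carrier by (simp add: scalar_prod_def dot5_def atLeast0LessThan)
    from this[OF dims(2)] this[OF dims(3)] have "(\<lambda>i. of_real (vec_index x i)) \<in> L_inf"
      using \<open>proj_eval D1 t \<bullet> x = 0\<close> \<open>proj_eval D2 t \<bullet> x = 0\<close>
      by (simp add: Infinity L_inf_def perp_def)
    then show ?thesis by blast
  qed
  with x carrier show ?thesis by blast
qed

lemma real_point_in_swept:
  assumes x: "x \<in> carrier_vec 5" "x \<noteq> 0\<^sub>v 5" and "(\<lambda>i. of_real (vec_index x i)) \<in> L (of_real t)"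
  shows "proj_point x \<in> swept"
proof -
  have "proj_eval C (Affine t) \<bullet> x = 0" if "C \<in> M" for C
  proof -
    have "dim_vec C = 5" using that by (auto simp: quasi_module_def)
    then have "complex_of_real (proj_eval C (Affine t) \<bullet> x) = 0"
      using module_element_at[OF that assms(3)] proj_eval_real_at[OF _ x(1)] by simp
    then show ?thesis by simp
  qed
  then show ?thesis
    using x unfolding swept_def swept_variety_def fibre_space_def by blast
qed

lemma real_point_on_plane: "\<exists>w k. (\<lambda>i. of_real (w i)) \<in> L (of_real t) \<and> k < 5 \<and> w k \<noteq> (0::real)"
proof -
  let ?A = "\<lambda>i. poly (vec_index D1 i) t" and ?B = "\<lambda>i. poly (vec_index D2 i) t"
  obtain i j where ij: "i < 5" "j < 5"
    "plucker_coord (at_param a (of_real t)) (at_param b (of_real t)) i j \<noteq> 0"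
    using indep_at[of "of_real t"] unfolding indep5_def by blast
  have "plucker_coord (at_param a (of_real t)) (at_param b (of_real t)) i j = of_real (plucker_coord ?A ?B i j)"
    by (simp add: plucker_coord_def)
  then have nz: "plucker_coord ?A ?B i j \<noteq> 0" using ij(3) by auto
  have "\<exists>k<5. k \<noteq> i \<and> k \<noteq> j" by presburger
  then obtain k where k: "k < 5" "k \<noteq> i" "k \<noteq> j" by blast
  define w where "w = project5 ?A ?B i j (unit5 k)"
  have "w k \<noteq> 0" using nz k by (simp add: w_def project5_def)
  moreover have "w \<in> perp ?A ?B" unfolding w_def by (rule project5_in_perp[OF ij(1,2)])
  then have "(\<lambda>i. of_real (w i)) \<in> L (of_real t)"
    using dot5_of_real[of ?A w] dot5_of_real[of ?B w] by (simp add: L_def perp_def)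
  ultimately show ?thesis using k(1) by blast
qed

text \<open>
  The real points are Zariski dense in the complex family. A complex point of a plane with a real
  parameter is the value at the imaginary unit of a line \<open>u + z v\<close> whose points with real \<open>z\<close> are real;
  the real parameters are infinitely many, so the remaining planes follow. The zero vector, which is
  no projective point, is reached along a real line through it.
\<close>

lemma vanishes_on_planes_if_swept:
  assumes G: "vars_below 5 G" "\<And>p. p \<in> swept \<Longrightarrow> vanishes_at G p"
  shows "vanishes_on_planes G"
proof -
  have nonzero: "complex_eval G (\<lambda>i. of_real (x i)) = 0"
    if x: "(\<lambda>i. of_real (x i)) \<in> L (of_real t)" "k < 5" "x k \<noteq> 0" for x :: "nat \<Rightarrow> real" and t k
  proof -
    let ?v = "vec 5 x"
    have "?v \<noteq> 0\<^sub>v 5" using x(2,3) by (metis index_vec index_zero_vec(1))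
    moreover have "dot5 u (\<lambda>i. of_real (vec_index ?v i)) = dot5 u (\<lambda>i. of_real (x i))" for u :: "nat \<Rightarrow> complex"
      by (simp add: dot5_def)
    then have "(\<lambda>i. of_real (vec_index ?v i)) \<in> L (of_real t)"
      using x(1) by (simp add: L_def perp_def)
    ultimately have "proj_point ?v \<in> swept"
      by (intro real_point_in_swept[of _ t]) auto
    then have "mpol_eval G ?v = 0"
      using G(2) self_in_proj_point by (auto simp: vanishes_at_def)
    moreover have "mpol_subst (\<lambda>r. r) (vec_index ?v) G = mpol_subst (\<lambda>r. r) x G"
    proof (rule mpol_subst_cong)
      fix e i assume "e \<in> Poly_Mapping.keys G" "i \<in> Poly_Mapping.keys e"
      then have "i < 5" using G(1) unfolding vars_below_def by blast
      then show "vec_index ?v i = x i" by simp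
    qed
    ultimately show ?thesis by (simp add: complex_eval_real mpol_eval_eq_subst)
  qed
  have real: "complex_eval G (\<lambda>i. of_real (x i)) = 0"
    if x: "(\<lambda>i. of_real (x i)) \<in> L (of_real t)" for x :: "nat \<Rightarrow> real" and t
  proof -
    obtain w k where w: "(\<lambda>i. of_real (w i)) \<in> L (of_real t)" "k < 5" "w k \<noteq> (0::real)"
      using real_point_on_plane by blast
    let ?\<phi> = "\<lambda>z. complex_eval G (\<lambda>i. of_real (x i) + z * of_real (w i))"
    have "?\<phi> 0 = 0"
    proof (rule polyfun_zero_if_infinite[of ?\<phi>])
      show "polyfun ?\<phi>" by (rule linewise_polyD[OF linewise_poly_complex_eval])
      have zero: "?\<phi> (of_real z) = 0" if "z \<noteq> - x k / w k" for z
      proof -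
        have "(\<lambda>i. of_real (x i + z * w i)) \<in> L (of_real t)"
          using L_line[OF x w(1), of "of_real z"] by simp
        moreover have "x k + z * w k \<noteq> 0" using that w(3) by (auto simp: field_simps add_eq_0_iff)
        ultimately have "complex_eval G (\<lambda>i. of_real (x i + z * w i)) = 0"
          using nonzero[of "\<lambda>i. x i + z * w i"] w(2) by blast
        then show ?thesis by simp
      qed
      have "range of_real - {of_real (- x k / w k)} \<subseteq> {z. ?\<phi> z = 0}"
      proof
        fix y :: complex assume "y \<in> range of_real - {of_real (- x k / w k)}"
        then obtain z where "y = of_real z" "z \<noteq> - x k / w k" by blast
        then show "y \<in> {z. ?\<phi> z = 0}" using zero[of z] by blast
      qed
      moreover have "infinite (range of_real - {of_real (- x k / w k) :: complex})"
        using infinite_real by simp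
      ultimately show "infinite {z. ?\<phi> z = 0}" using finite_subset by blast
    qed
    then show ?thesis by simp
  qed
  have "complex_eval G y = 0" if t: "t \<in> range of_real" and y: "y \<in> L t" for t y
  proof -
    obtain s where s: "t = of_real s" using t by blast
    let ?A = "\<lambda>i. poly (vec_index D1 i) s" and ?B = "\<lambda>i. poly (vec_index D2 i) s"
    have at: "at_param a t = (\<lambda>i. of_real (?A i))" "at_param b t = (\<lambda>i. of_real (?B i))"
      by (simp_all add: s)
    have Re: "Re (dot5 (\<lambda>i. of_real (u i)) y) = dot5 u (\<lambda>i. Re (y i))" for u
      by (simp add: dot5_def)
    have Im: "Im (dot5 (\<lambda>i. of_real (u i)) y) = dot5 u (\<lambda>i. Im (y i))" for u
      by (simp add: dot5_def)
    have "dot5 ?A (\<lambda>i. Re (y i)) = 0" "dot5 ?B (\<lambda>i. Re (y i)) = 0"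
      "dot5 ?A (\<lambda>i. Im (y i)) = 0" "dot5 ?B (\<lambda>i. Im (y i)) = 0"
      using y unfolding L_def perp_def at by (simp_all flip: Re Im)
    then have u: "(\<lambda>i. of_real (Re (y i))) \<in> L t" and v: "(\<lambda>i. of_real (Im (y i))) \<in> L t"
      unfolding L_def perp_def at by (simp_all add: dot5_of_real)
    let ?\<phi> = "\<lambda>z. complex_eval G (\<lambda>i. of_real (Re (y i)) + z * of_real (Im (y i)))"
    have "?\<phi> \<i> = 0"
    proof (rule polyfun_zero_if_infinite[of ?\<phi>])
      show "polyfun ?\<phi>" by (rule linewise_polyD[OF linewise_poly_complex_eval])
      have "?\<phi> (of_real z) = 0" for z
        using real[of "\<lambda>i. Re (y i) + z * Im (y i)" s] L_line[OF u v, of "of_real z"] by (simp add: s)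
      then have "range of_real \<subseteq> {z. ?\<phi> z = 0}" by auto
      then show "infinite {z. ?\<phi> z = 0}" using infinite_real finite_subset by blast
    qed
    moreover have "(\<lambda>i. of_real (Re (y i)) + \<i> * of_real (Im (y i))) = y"
      by (rule ext) (simp flip: complex_eq)
    ultimately show ?thesis by simp
  qed
  then show ?thesis
    unfolding vanishes_on_planes_def using vanishes_on_family(1)[OF infinite_real] by blast
qed

lemma vanishes_on_swept:
  assumes "form_of_degree 5 n G" "vanishes_on_planes G" "p \<in> swept"
  shows "vanishes_at G p"
proof -
  obtain x where x: "x \<in> carrier_vec 5" "p = proj_point x"
    "(\<exists>t. (\<lambda>i. of_real (vec_index x i)) \<in> L t) \<or> (\<lambda>i. of_real (vec_index x i)) \<in> L_inf"
    using swept_subset[OF assms(3)] by blast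
  then have "complex_eval G (\<lambda>i. of_real (vec_index x i)) = 0"
    using assms(2) vanishes_on_planes_inf unfolding vanishes_on_planes_def by blast
  then show ?thesis using vanishes_at_proj_point[OF assms(1) x(1)] x(2) by simp
qed

lemma swept_subset_closure: "swept \<subseteq> zariski_closure 5 swept"
  using swept_subset by (auto simp: zariski_closure_def proj_space_def)

text \<open>
  The ideal of the swept variety is generated by the irreducible factor \<open>F0\<close> of the resultant that
  vanishes on all planes, so \<open>F0\<close> is an implicit equation. Any other choice vanishes on the planes
  as well, and vanishing there is all that the power representation and the count of fibres use.
\<close>

theorem implicit_equation_swept:
  defines "R \<equiv> resultant (dot_vars D1) (dot_vars D2)" and "F \<equiv> implicit_equation 5 swept"
  shows "\<exists>j c n. j > 0 \<and> c \<noteq> 0 \<and> R = mpol_const c * F ^ j \<and> form_of_degree 5 n F \<and> F \<noteq> 0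
    \<and> n1 + n2 = j * n \<and> plucker_degree D D' = j"
proof -
  have R: "complex_eval R y = res_at y" for y
    unfolding R_def res_at_def by (rule complex_eval_resultant[OF dims(2,3)])
  have R_form: "form_of_degree 5 (n1 + n2) R"
    unfolding R_def by (rule resultant_form[OF dims(2,3)])
  have R_nz: "R \<noteq> 0"
    using res_at_nonzero R by (auto simp: mpol_subst_def)
  have R_zero: "(\<exists>t. y \<in> L t) \<or> y \<in> L_inf" if "complex_eval R y = 0" for y
    using that R res_at_zero_iff by metis
  have "vanishes_on_planes R"
    using vanishes_on_planes_if_res_at[OF R finite_fibre_inf] .
  moreover have "\<not> vanishes_on_planes (mpol_const c)" if "c \<noteq> 0" for c
  proof -
    have "(\<lambda>_. 0) \<in> L 0" by (simp add: L_def perp_def dot5_def)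
    then show ?thesis
      using that by (auto simp: vanishes_on_planes_def comm_ring_hom.mpol_subst_const[OF comm_ring_hom_of_real])
  qed
  ultimately obtain F0 where F0: "irreducible F0" "F0 dvd R" "vanishes_on_planes F0"
    using exists_irreducible_factor[OF R_form R_nz, of vanishes_on_planes] vanishes_on_planes_mult by blast
  obtain K where K: "R = F0 * K" using F0(2) by (elim dvdE)
  obtain d where F0_form: "form_of_degree 5 d F0"
    using form_of_degree_factor[of 5 "n1 + n2" F0 K] R_form R_nz K by blast
  have F0_dvd: "F0 dvd G" if G: "form_of_degree 5 e G" "\<And>p. p \<in> swept \<Longrightarrow> vanishes_at G p" for G e
  proof (rule irreducible_dvd_if_zeros[OF F0(1)])
    have van: "vanishes_on_planes G"
      by (rule vanishes_on_planes_if_swept[OF form_of_degree_vars_below[OF G(1)] G(2)])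
    fix y assume "complex_eval F0 y = 0"
    then have "complex_eval R y = 0"
      by (simp add: K comm_ring_hom.mpol_subst_mult[OF comm_ring_hom_of_real])
    from R_zero[OF this] show "complex_eval G y = 0"
      using van vanishes_on_planes_inf[OF van] unfolding vanishes_on_planes_def by blast
  qed (rule form_of_degree_vars_below, fact)+
  have "is_implicit_equation 5 swept F0"
    unfolding is_implicit_equation_def
  proof (intro conjI equalityI subsetI)
    show "form_in 5 F0" using F0_form form_in_iff by blast
    show "irreducible F0" by fact
  next
    fix p assume "p \<in> {p \<in> proj_space 5. vanishes_at F0 p}"
    then have p: "p \<in> proj_space 5" "vanishes_at F0 p" by auto
    have "vanishes_at G p" if G: "form_in 5 G" "\<forall>q\<in>swept. vanishes_at G q" for G
    proof -
      obtain e where "form_of_degree 5 e G" using G(1) form_in_iff by blast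
      then obtain H where "G = F0 * H" using F0_dvd G(2) by (meson dvdE)
      moreover have "mpol_eval (F0 * H) x = mpol_eval F0 x * mpol_eval H x" for x
        unfolding mpol_eval_eq_subst by (rule comm_ring_hom.mpol_subst_mult[OF comm_ring_hom_id])
      ultimately show ?thesis using p(2) by (simp add: vanishes_at_def)
    qed
    then show "p \<in> zariski_closure 5 swept" using p(1) by (simp add: zariski_closure_def)
  next
    fix p assume "p \<in> zariski_closure 5 swept"
    then show "p \<in> {p \<in> proj_space 5. vanishes_at F0 p}"
      using vanishes_on_swept[OF F0_form F0(3)] F0_form form_in_iff unfolding zariski_closure_def by blast
  qed
  then have "is_implicit_equation 5 swept F"
    unfolding F_def implicit_equation_def by (rule someI)
  then have F: "form_in 5 F" "irreducible F" "{p \<in> proj_space 5. vanishes_at F p} = zariski_closure 5 swept"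
    by (auto simp: is_implicit_equation_def)
  obtain n where n: "form_of_degree 5 n F" using F(1) form_in_iff by blast
  have "F \<noteq> 0" using F(2) by auto
  have "vanishes_at F p" if "p \<in> swept" for p
    using swept_subset_closure that F(3) by blast
  then have van: "vanishes_on_planes F"
    by (rule vanishes_on_planes_if_swept[OF form_of_degree_vars_below[OF n]])
  have RF: "complex_eval F y = 0" if "complex_eval R y = 0" for y
    using R_zero[OF that] van vanishes_on_planes_inf[OF van] unfolding vanishes_on_planes_def by blast
  obtain c j where cj: "c \<noteq> 0" "R = mpol_const c * F ^ j"
    using power_of_irreducible[OF F(2) n RF R_form R_nz dvd_refl] by blast
  have "res_at y = of_real c * complex_eval F y ^ j" for y
  proof -
    interpret e: comm_ring_hom "\<lambda>G. complex_eval G y"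
      by (rule comm_ring_hom.mpol_subst_hom[OF comm_ring_hom_of_real])
    show ?thesis
      unfolding R[symmetric] cj(2) by (simp add: e.hom_mult e.hom_power comm_ring_hom.mpol_subst_const[OF comm_ring_hom_of_real])
  qed
  then obtain T0 where T0: "finite T0" "\<And>s. s \<notin> T0 \<Longrightarrow> finite {t. L t = L s} \<and> card {t. L t = L s} = j" "j > 0"
    using card_fibre[OF F(2) n, of "of_real c" j] finite_critical cj(1) by auto
  have "plucker_degree D D' = j" by (rule plucker_degree_eq[OF T0])
  moreover have "n1 + n2 = j * n"
  proof (rule form_of_degree_unique[OF R_form _ R_nz])
    have "form_of_degree 5 (0 + j * n) (mpol_const c * F ^ j)"
      by (intro form_of_degree_mult form_of_degree_const form_of_degree_power n)
    then show "form_of_degree 5 (j * n) R" by (simp add: cj(2))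
  qed
  ultimately show ?thesis using T0(3) cj n \<open>F \<noteq> 0\<close> by blast
qed

text \<open>
  The Pluecker vector of \<open>D\<close> and \<open>D'\<close> is \<open>h\<close> times that of the mu-basis, which has no common factor
  and degree \<open>n1 + n2\<close>; so its greatest common divisor is associated to \<open>h\<close>.
\<close>

lemma vec_degree_wedge:
  "vec_degree (wedge D D') = degree (Gcd (set\<^sub>v (wedge D D'))) + (n1 + n2)"
proof -
  let ?Q = "plucker_vec D D'"
  let ?X = "set\<^sub>v (wedge D D')"
  have X: "?X = {?Q i j | i j. i < j \<and> j < 5}"
    unfolding wedge_eq_wedge_vec[OF dims(1)] set_wedge_vec ..
  have ex: "h * P i j \<in> ?X" if "i < j" "j < 5" for i j
    unfolding X using plucker_h[of i j] that by (intro CollectI exI[of _ i] exI[of _ j]) simp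
  have "h dvd Gcd ?X"
    using plucker_h by (intro Gcd_greatest) (auto simp: X)
  then obtain r where r: "Gcd ?X = h * r" by (elim dvdE)
  have rP: "r dvd P i j" if "i < j" "j < 5" for i j
  proof -
    have "h * r dvd h * P i j" unfolding r[symmetric] by (rule Gcd_dvd[OF ex[OF that]])
    then show ?thesis using h_nonzero by simp
  qed
  have rdvd: "r dvd P i j" if "i < 5" "j < 5" for i j
    by (rule plucker_coord_all[OF _ _ _ that]) (use rP in auto)
  have "r \<noteq> 0"
  proof
    assume "r = 0"
    then have "P i j = 0" if "i < 5" "j < 5" for i j using rdvd[OF that] by simp
    then show False using lin_indep_plucker_nonzero[OF indD12] by blast
  qed
  have "r dvd 1"
  proof (rule ccontr)
    assume "\<not> r dvd 1"
    then obtain p where p: "p dvd r" "prime p" using prime_divisor_exists[of r] \<open>r \<noteq> 0\<close> by blast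
    then have "irreducible p" using prime_elem_imp_irreducible prime_imp_prime_elem by blast
    then show False using mu_basis_plucker_primitive[OF mu] rdvd p(1) dvd_trans by blast
  qed
  then have "degree (Gcd ?X) = degree h"
    using r h_nonzero \<open>r \<noteq> 0\<close> by (simp add: degree_mult_eq is_unit_iff_degree)
  moreover have "vec_degree (wedge D D') = degree h + (n1 + n2)"
  proof (rule antisym)
    show "vec_degree (wedge D D') \<le> degree h + (n1 + n2)"
      unfolding vec_degree_wedge_le_iff[OF dims(1)]
      using degree_plucker_coord_le[OF dims(2,3)] plucker_h
      by (auto intro!: order_trans[OF degree_mult_le])
    obtain i j where ij: "i < 5" "j < 5" "coeff (P i j) (n1 + n2) \<noteq> 0"
      using mu_basis_top_nonzero[OF mu] by blast
    have "P i j \<noteq> 0" using ij(3) by auto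
    have "degree h + (n1 + n2) \<le> degree (h * P i j)"
      using le_degree[OF ij(3)] h_nonzero \<open>P i j \<noteq> 0\<close> by (simp add: degree_mult_eq)
    also have "\<dots> \<le> vec_degree (wedge D D')"
      using vec_degree_wedge_le_iff[OF dims(1), of D' "vec_degree (wedge D D')"] plucker_h ij by simp
    finally show "degree h + (n1 + n2) \<le> vec_degree (wedge D D')" .
  qed
  ultimately show ?thesis by simp
qed

end

theorem proposition21:
  fixes e :: "nat \<Rightarrow> real poly" and d :: real
    and D D' D1 D2 :: "real poly vec" and q :: "real poly" and k :: nat
  assumes "Gcd (e ` {0..4}) = 1"
    and "D = spine_vec d e" and "D' = spine_vec_deriv d e"
    and "lin_indep_pair 5 D D'"
    and "plucker_nonconstant D D'"
    and "mu_basis 5 (quasi_module 5 D D') D1 D2"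
    and "k = plucker_degree D D'"
    and "q = Gcd (set\<^sub>v (wedge D D'))"
  shows "k * hypersurface_degree 5 (dual_offset d e) = vec_degree D1 + vec_degree D2
    \<and> int (vec_degree D1 + vec_degree D2) = int (vec_degree (wedge D D')) - int (Polynomial.degree q)
    \<and> (\<exists>c::real. c \<noteq> 0 \<and>
          resultant (dot_vars D1) (dot_vars D2)
            = mpol_const c * implicit_equation 5 (dual_offset d e) ^ k)"
proof -
  have D': "D' = map_vec pderiv D"
    by (simp add: assms(2,3) spine_vec_deriv_def)
  have carrier: "D \<in> carrier_vec 5" "D' \<in> carrier_vec 5"
    using assms(4) by (auto simp: lin_indep_pair_def)
  obtain h where h: "\<forall>i<5. \<forall>j<5. plucker_vec D D' i j
      = h * plucker_vec D1 D2 i j"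
    using plucker_multiple[OF assms(6) self_in_quasi_module[OF carrier]] by blast
  interpret developable D D1 D2 h
    by unfold_locales (use assms(4-6) h in \<open>simp_all add: D'\<close>)
  have S: "dual_offset d e = swept"
    unfolding dual_offset_def swept_def assms(2,3)[symmetric] D'[symmetric] ..
  obtain j c n where *: "c \<noteq> 0" "resultant (dot_vars D1) (dot_vars D2) = mpol_const c * implicit_equation 5 swept ^ j"
    "form_of_degree 5 n (implicit_equation 5 swept)" "implicit_equation 5 swept \<noteq> 0"
    "vec_degree D1 + vec_degree D2 = j * n" "plucker_degree D D' = j"
    using implicit_equation_swept unfolding D'[symmetric] by blast
  have k: "k = j" using assms(7) *(6) by simp
  have "hypersurface_degree 5 (dual_offset d e) = n"
    unfolding hypersurface_degree_def S by (rule total_degree_form[OF *(3,4)])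
  moreover have "vec_degree (wedge D D') = Polynomial.degree q + (vec_degree D1 + vec_degree D2)"
    using vec_degree_wedge unfolding assms(8) D' .
  ultimately show ?thesis
    using *(1,2,5) unfolding S k by auto
qed

end
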